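(* Let $d\ge2$ and let $\Omega$ be a bounded domain in $\mathbb R^d$ such that the Neumann Laplacian on $\Omega$ has discrete spectrum, with eigenvalues $\mu_1\le\mu_2\le\dots$. For all positive integers $k$, $$\frac{d+2}{d}\frac{1}{k}\sum_{j=1}^{k}\mu_j-C_d\left(\frac{k}{|\Omega|}\right)^{\frac{2}{d}}\leq -C_d\left(\frac{k}{|\Omega|}\right)^{\frac{2}{d}}\,\left(C_d^{-1}\left(\frac{k}{|\Omega|}\right)^{-\frac{2}{d}}\mu_{k+1}-1\right)^2,$$ and for single eigenvalues, $$C_d\left(\frac{k}{|\Omega|}\right)^{\frac{2}{d}}x_-\leq \mu_k\leq\mu_{k+1} \leq C_d\left(\frac{k}{|\Omega|}\right)^{\frac{2}{d}}x_+,\qquad x_{\pm}=1\pm\sqrt{1-\frac{\frac{d+2}{d}\frac{1}{k}\sum_{j=1}^{k}\mu_j}{C_d\left(\frac{k}{|\Omega|}\right)^{\frac{2}{d}}}}.$$ For all $z>0$, $$\sum_{j}(z-\mu_{j})_{+}\geq \frac{2}{d+2}C_d^{-\frac{d}{2}}\,|\Omega|z^{1+d/2}.$$ For all $t>0$, $$\sum_{j=1}^{\infty}e^{-\mu_j t}\geq\frac{|\Omega|}{(4\pi t)^{\frac{d}{2}}}.$$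
   Context: $-\Delta_\Omega^N$ is the (nonnegative) self-adjoint realization of the Laplacian in $L^2(\Omega)$ with Neumann boundary conditions (form domain $H^1(\Omega)$); $0=\mu_1\le\mu_2\le\dots$ are its eigenvalues repeated according to multiplicity. $x_+=\max\{x,0\}$ (in $(z-\mu_j)_+$); $\sum_j$ is the sum over all positive integers; $|\Omega|$ is Lebesgue measure; $\omega_d=\pi^{d/2}/\Gamma(1+d/2)$ is the volume of the unit ball in $\mathbb R^d$; $C_d=4\pi^2\omega_d^{-2/d}$. *)

theory Defs
  imports "HOL-Analysis.Analysis"
begin

text \<open>
  Elements of the complex Hilbert space \<open>L\<^sup>2(\<Omega>)\<close> are represented by functions on the whole
  space; only their values on \<open>\<Omega>\<close>, up to null sets, matter.
\<close>

definition L2 :: "'a::euclidean_space set \<Rightarrow> ('a \<Rightarrow> complex) set" where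
  "L2 \<Omega> = {u \<in> borel_measurable (lebesgue_on \<Omega>).
             integrable (lebesgue_on \<Omega>) (\<lambda>x. (cmod (u x))\<^sup>2)}"

definition L2_inner ::
  "'a::euclidean_space set \<Rightarrow> ('a \<Rightarrow> complex) \<Rightarrow> ('a \<Rightarrow> complex) \<Rightarrow> complex" where
  "L2_inner \<Omega> u v = (LINT x|lebesgue_on \<Omega>. u x * cnj (v x))"

definition L2_norm :: "'a::euclidean_space set \<Rightarrow> ('a \<Rightarrow> complex) \<Rightarrow> real" where
  "L2_norm \<Omega> u = sqrt (LINT x|lebesgue_on \<Omega>. (cmod (u x))\<^sup>2)"

definition partial_deriv ::
  "'a::euclidean_space \<Rightarrow> ('a \<Rightarrow> real) \<Rightarrow> 'a \<Rightarrow> real" where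
  "partial_deriv b \<phi> x = frechet_derivative \<phi> (at x) b"

primrec C_diff :: "nat \<Rightarrow> ('a::euclidean_space \<Rightarrow> real) \<Rightarrow> bool" where
  "C_diff 0 \<phi> \<longleftrightarrow> continuous_on UNIV \<phi>"
| "C_diff (Suc m) \<phi> \<longleftrightarrow>
     (\<forall>x. \<phi> differentiable (at x)) \<and> (\<forall>b\<in>Basis. C_diff m (partial_deriv b \<phi>))"

definition test_function :: "'a::euclidean_space set \<Rightarrow> ('a \<Rightarrow> real) \<Rightarrow> bool" where
  "test_function \<Omega> \<phi> \<longleftrightarrow>
     (\<forall>m. C_diff m \<phi>) \<and>
     compact (closure {x. \<phi> x \<noteq> 0}) \<and> closure {x. \<phi> x \<noteq> 0} \<subseteq> \<Omega>"

definition weak_partial_deriv ::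
  "'a::euclidean_space set \<Rightarrow> 'a \<Rightarrow> ('a \<Rightarrow> complex) \<Rightarrow> ('a \<Rightarrow> complex) \<Rightarrow> bool" where
  "weak_partial_deriv \<Omega> b u g \<longleftrightarrow>
     (\<forall>\<phi>. test_function \<Omega> \<phi> \<longrightarrow>
        (LINT x|lebesgue_on \<Omega>. partial_deriv b \<phi> x *\<^sub>R u x)
          = - (LINT x|lebesgue_on \<Omega>. \<phi> x *\<^sub>R g x))"

definition H1 :: "'a::euclidean_space set \<Rightarrow> ('a \<Rightarrow> complex) set" where
  "H1 \<Omega> = {u \<in> L2 \<Omega>. \<forall>b\<in>Basis. \<exists>g\<in>L2 \<Omega>. weak_partial_deriv \<Omega> b u g}"

text \<open>A representative of the weak derivative, which is unique up to null sets.\<close>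

definition weak_partial ::
  "'a::euclidean_space set \<Rightarrow> 'a \<Rightarrow> ('a \<Rightarrow> complex) \<Rightarrow> 'a \<Rightarrow> complex" where
  "weak_partial \<Omega> b u = (SOME g. g \<in> L2 \<Omega> \<and> weak_partial_deriv \<Omega> b u g)"

definition dirichlet_form ::
  "'a::euclidean_space set \<Rightarrow> ('a \<Rightarrow> complex) \<Rightarrow> ('a \<Rightarrow> complex) \<Rightarrow> complex" where
  "dirichlet_form \<Omega> u v =
     (\<Sum>b\<in>Basis. L2_inner \<Omega> (weak_partial \<Omega> b u) (weak_partial \<Omega> b v))"

text \<open>
  The graph of the Neumann Laplacian, i.e. of the self-adjoint operator associated with the
  closed form \<^const>\<open>dirichlet_form\<close> on \<^const>\<open>H1\<close>: \<open>neumann_laplacian \<Omega> u f\<close> says that \<open>u\<close>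
  lies in the operator domain and \<open>- \<Delta> u = f\<close>.
\<close>

definition neumann_laplacian ::
  "'a::euclidean_space set \<Rightarrow> ('a \<Rightarrow> complex) \<Rightarrow> ('a \<Rightarrow> complex) \<Rightarrow> bool" where
  "neumann_laplacian \<Omega> u f \<longleftrightarrow>
     u \<in> H1 \<Omega> \<and> f \<in> L2 \<Omega> \<and> (\<forall>v\<in>H1 \<Omega>. dirichlet_form \<Omega> u v = L2_inner \<Omega> f v)"

text \<open>
  \<open>z\<close> is in the resolvent set if \<open>- \<Delta> - z\<close> maps its domain onto \<open>L\<^sup>2(\<Omega>)\<close> with bounded inverse;
  injectivity (up to null sets) is the case \<open>f = 0\<close> of the bound.
\<close>

definition neumann_resolvent_set :: "'a::euclidean_space set \<Rightarrow> complex set" where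
  "neumann_resolvent_set \<Omega> =
     {z. (\<forall>f\<in>L2 \<Omega>. \<exists>u. neumann_laplacian \<Omega> u (\<lambda>x. z * u x + f x)) \<and>
         (\<exists>C. \<forall>u. \<forall>f\<in>L2 \<Omega>. neumann_laplacian \<Omega> u (\<lambda>x. z * u x + f x)
                 \<longrightarrow> L2_norm \<Omega> u \<le> C * L2_norm \<Omega> f)}"

definition neumann_spectrum :: "'a::euclidean_space set \<Rightarrow> complex set" where
  "neumann_spectrum \<Omega> = - neumann_resolvent_set \<Omega>"

definition neumann_eigenspace :: "'a::euclidean_space set \<Rightarrow> complex \<Rightarrow> ('a \<Rightarrow> complex) set" where
  "neumann_eigenspace \<Omega> z = {u. neumann_laplacian \<Omega> u (\<lambda>x. z * u x)}"

text \<open>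
  The space of functions \<open>E\<close>, taken modulo equality almost everywhere on \<open>\<Omega>\<close>, has complex
  dimension \<open>n\<close>.
\<close>

definition has_ae_dim ::
  "'a::euclidean_space set \<Rightarrow> ('a \<Rightarrow> complex) set \<Rightarrow> nat \<Rightarrow> bool" where
  "has_ae_dim \<Omega> E n \<longleftrightarrow>
     (\<exists>e. (\<forall>i<n. e i \<in> E) \<and>
          (\<forall>c. (AE x in lebesgue_on \<Omega>. (\<Sum>i<n. c i * e i x) = 0) \<longrightarrow> (\<forall>i<n. c i = 0)) \<and>
          (\<forall>u\<in>E. \<exists>c. AE x in lebesgue_on \<Omega>. u x = (\<Sum>i<n. c i * e i x)))"

definition neumann_discrete_spectrum :: "'a::euclidean_space set \<Rightarrow> bool" where
  "neumann_discrete_spectrum \<Omega> \<longleftrightarrow>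
     (\<forall>z\<in>neumann_spectrum \<Omega>.
        z isolated_in neumann_spectrum \<Omega> \<and>
        (\<exists>n>0. has_ae_dim \<Omega> (neumann_eigenspace \<Omega> z) n))"

text \<open>
  \<open>\<mu> 1 \<le> \<mu> 2 \<le> \<dots>\<close> lists the eigenvalues (which are all real), each as often as its
  multiplicity; \<open>\<mu> 0\<close> is not used.
\<close>

definition neumann_eigenvalues :: "'a::euclidean_space set \<Rightarrow> (nat \<Rightarrow> real) \<Rightarrow> bool" where
  "neumann_eigenvalues \<Omega> \<mu> \<longleftrightarrow>
     mono_on {1..} \<mu> \<and>
     (\<forall>t::real. finite {j \<in> {1..}. \<mu> j = t} \<and>
        has_ae_dim \<Omega> (neumann_eigenspace \<Omega> (complex_of_real t)) (card {j \<in> {1..}. \<mu> j = t}))"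

definition weyl_const :: "nat \<Rightarrow> real" where
  "weyl_const d = 4 * pi\<^sup>2 * unit_ball_vol (real d) powr (- 2 / real d)"

end

theory Submission
  imports Defs "HOL-Library.Function_Algebras"
begin

text \<open>
  Kroeger's argument. Let \<open>u\<^sub>1, \<dots>, u\<^sub>k\<close> be orthonormal eigenfunctions such that every eigenvalue
  below \<open>z\<close> is among \<open>\<mu>\<^sub>1, \<dots>, \<mu>\<^sub>k\<close>. The plane wave \<open>x \<mapsto> exp (i y \<bullet> x)\<close>, minus its projection onto their
  span, is a trial function in \<open>H\<^sup>1(\<Omega>)\<close>, and the variational principle yields
  \<open>(z - \<bar>y\<bar>\<^sup>2) \<bar>\<Omega>\<bar> \<le> \<Sum>\<^sub>j (z - \<mu>\<^sub>j) \<bar>c\<^sub>j(y)\<bar>\<^sup>2\<close>, where \<open>c\<^sub>j\<close> is the Fourier coefficient of \<open>u\<^sub>j\<close>.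
  Integrating over \<open>\<bar>y\<bar>\<^sup>2 < z\<close> and using Plancherel's inequality on the right gives the bound on Riesz
  means. The choices \<open>z = \<mu>\<^sub>k\<^sub>+\<^sub>1\<close> and \<open>z = \<mu>\<^sub>k\<close> give the inequalities for eigenvalue sums and single
  eigenvalues, and a Laplace transform in \<open>z\<close> gives the heat trace.

  The variational principle is the only spectral-theoretic input. By assumption every spectral point is
  an eigenvalue, so every other number is in the resolvent set; it remains to see that the bottom of
  the form on the complement of \<open>u\<^sub>1, \<dots>, u\<^sub>k\<close> is either at least \<open>z\<close> or an eigenvalue, which is done for the
  bounded operator \<open>(1 - \<Delta>)\<^sup>-\<^sup>1\<close>.
\<close>

section \<open>Symmetric operators with a spectral gap\<close>

text \<open>Discreteness says nothing directly about completeness of the eigenfunctions; what it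
  supplies is a bounded resolvent at every real number that is not an eigenvalue. The variational
  principle is extracted from these bounds alone. On the complement of the chosen eigenfunctions let
  S be the supremum of the Rayleigh quotients of K = (1 - Delta)^-1, and put T = S - K, which is
  positive. If S > 1 / (1 + z), then T is injective, and T - \<tau> is bounded below for 0 < \<tau>
  <= \<delta>, because 1 / (S - \<tau>) - 1 is no eigenvalue. This gap above 0 yields \<delta> T <=
  T^2, injectivity upgrades it to \<delta> <= T, and that contradicts the choice of S. The way back
  from K to the form is Cauchy-Schwarz for the form plus the inner product. Constants: 2 / (d + 2)
  and the unit ball volume come from integrating the paraboloid z - |y|^2, and (2 pi)^d from
  Plancherel; the ball volume over (2 pi)^d is C^(-d/2). Both the inequality for sums and those for
  single eigenvalues follow from one quadratic inequality in z by completing the square.\<close>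

lemma discriminant_nonneg_imp:
  fixes a b c :: real
  assumes nn: "\<And>t. 0 \<le> a + 2 * t * b + t\<^sup>2 * c" and c: "0 \<le> c"
  shows "b\<^sup>2 \<le> a * c"
\<comment> \<open>The forms below are only semidefinite, so \<open>c = 0\<close> must be covered.
  The quadratic is then affine in \<open>t\<close>, and a nonconstant affine function takes negative
  values.\<close>
proof (cases "c = 0")
  case True
  have "b = 0"
  proof (rule ccontr)
    assume "b \<noteq> 0"
    then show False
      using nn[of "- (a + 1) / (2 * b)"] True by (simp add: field_simps)
  qed
  then show ?thesis using True by simp
next
  case False
  then have "c > 0" using c by simp
  have "0 \<le> a + 2 * (- b / c) * b + (- b / c)\<^sup>2 * c" by (rule nn)
  also have "\<dots> = a - b\<^sup>2 / c"
    using False by (simp add: power2_eq_square field_simps)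
  finally show ?thesis using \<open>c > 0\<close> by (simp add: field_simps)
qed

text \<open>Functions that agree almost everywhere are not identified, so \<open>ip\<close> has null
  vectors and completeness means convergence in the seminorm. It is demanded for sequences with
  geometrically small steps: these are what the iteration in \<open>coercive_of_gap\<close>
  produces, and for square integrable functions they converge pointwise almost everywhere.\<close>

locale semi_hilbert =
  fixes G :: "'v::real_vector set" and ip :: "'v \<Rightarrow> 'v \<Rightarrow> real"
  assumes subspace: "subspace G"
    and ip_add: "\<lbrakk>u \<in> G; v \<in> G; w \<in> G\<rbrakk> \<Longrightarrow> ip (u + v) w = ip u w + ip v w"
    and ip_scale: "\<lbrakk>u \<in> G; w \<in> G\<rbrakk> \<Longrightarrow> ip (r *\<^sub>R u) w = r * ip u w"
    and ip_sym: "\<lbrakk>u \<in> G; v \<in> G\<rbrakk> \<Longrightarrow> ip u v = ip v u"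
    and ip_nonneg: "u \<in> G \<Longrightarrow> 0 \<le> ip u u"
    and complete: "\<lbrakk>\<And>n. y n \<in> G; 0 \<le> q; q < 1;
        \<And>n. ip (y (Suc n) - y n) (y (Suc n) - y n) \<le> C * q ^ n\<rbrakk>
      \<Longrightarrow> \<exists>l\<in>G. (\<lambda>n. ip (y n - l) (y n - l)) \<longlonglongrightarrow> 0"
begin

lemma mem [simp, intro]:
  "0 \<in> G" "\<lbrakk>u \<in> G; v \<in> G\<rbrakk> \<Longrightarrow> u + v \<in> G" "\<lbrakk>u \<in> G; v \<in> G\<rbrakk> \<Longrightarrow> u - v \<in> G" "u \<in> G \<Longrightarrow> r *\<^sub>R u \<in> G"
  using subspace by (auto simp: subspace_0 subspace_add subspace_diff subspace_scale)

lemma ip_diff: "\<lbrakk>u \<in> G; v \<in> G; w \<in> G\<rbrakk> \<Longrightarrow> ip (u - v) w = ip u w - ip v w"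
  using ip_add[of u "(-1) *\<^sub>R v" w] ip_scale[of v w "-1"] mem(4)[of v "-1"] by simp

lemma ip_zero: "w \<in> G \<Longrightarrow> ip 0 w = 0"
  using ip_diff[of w w w] by simp

lemma ip_add_right: "\<lbrakk>u \<in> G; v \<in> G; w \<in> G\<rbrakk> \<Longrightarrow> ip w (u + v) = ip w u + ip w v"
  by (metis ip_add ip_sym mem(2))

lemma ip_diff_right: "\<lbrakk>u \<in> G; v \<in> G; w \<in> G\<rbrakk> \<Longrightarrow> ip w (u - v) = ip w u - ip w v"
  by (metis ip_diff ip_sym mem(3))

lemma ip_scale_right: "\<lbrakk>u \<in> G; w \<in> G\<rbrakk> \<Longrightarrow> ip w (r *\<^sub>R u) = r * ip w u"
  by (metis ip_scale ip_sym mem(4))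

lemmas ip_simps = ip_add ip_diff ip_scale ip_zero ip_add_right ip_diff_right ip_scale_right

lemma cauchy_schwarz:
  assumes "u \<in> G" "v \<in> G"
  shows "(ip u v)\<^sup>2 \<le> ip u u * ip v v"
proof (rule discriminant_nonneg_imp)
  fix t
  have "0 \<le> ip (u + t *\<^sub>R v) (u + t *\<^sub>R v)" using assms by (intro ip_nonneg) simp
  also have "\<dots> = ip u u + 2 * t * ip u v + t\<^sup>2 * ip v v"
    using assms ip_sym[of u v] by (simp add: ip_simps power2_eq_square algebra_simps)
  finally show "0 \<le> ip u u + 2 * t * ip u v + t\<^sup>2 * ip v v" .
qed (use assms ip_nonneg in auto)

lemma null_ip: "\<lbrakk>u \<in> G; v \<in> G; ip u u = 0\<rbrakk> \<Longrightarrow> ip u v = 0"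
  using cauchy_schwarz[of u v] by simp

lemma ip_eq_of_null_diff:
  assumes "u \<in> G" "v \<in> G" "w \<in> G" "ip (u - v) (u - v) = 0"
  shows "ip u w = ip v w"
  using null_ip[of "u - v" w] assms by (simp add: ip_diff)

lemma ip_add_le: 
  assumes "u \<in> G" "v \<in> G"
  shows "ip (u + v) (u + v) \<le> 2 * ip u u + 2 * ip v v"
proof -
  have "0 \<le> ip (u - v) (u - v)" using assms by (intro ip_nonneg) simp
  then show ?thesis using assms ip_sym[of u v] by (simp add: ip_simps)
qed

lemma ip_diff_le: 
  assumes "u \<in> G" "v \<in> G"
  shows "ip (u - v) (u - v) \<le> 2 * ip u u + 2 * ip v v"
proof -
  have "0 \<le> ip (u + v) (u + v)" using assms by (intro ip_nonneg) simp
  then show ?thesis using assms ip_sym[of u v] by (simp add: ip_simps)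
qed

text \<open>The inner product is only semidefinite, so a symmetric \<open>T\<close> is linear up to null vectors;
  linearity is therefore always used inside \<open>ip\<close>.\<close>

definition symm :: "('v \<Rightarrow> 'v) \<Rightarrow> bool" where
  "symm T \<longleftrightarrow> (\<forall>u\<in>G. T u \<in> G) \<and> (\<forall>u\<in>G. \<forall>v\<in>G. ip (T u) v = ip u (T v))"

definition psd :: "('v \<Rightarrow> 'v) \<Rightarrow> bool" where
  "psd T \<longleftrightarrow> symm T \<and> (\<forall>u\<in>G. 0 \<le> ip (T u) u)"

definition bounded_op :: "real \<Rightarrow> ('v \<Rightarrow> 'v) \<Rightarrow> bool" where
  "bounded_op \<beta> T \<longleftrightarrow> (\<forall>u\<in>G. ip (T u) (T u) \<le> \<beta>\<^sup>2 * ip u u)"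

definition bounded_below_op :: "real \<Rightarrow> ('v \<Rightarrow> 'v) \<Rightarrow> bool" where
  "bounded_below_op c T \<longleftrightarrow> (\<forall>u\<in>G. c * ip u u \<le> ip (T u) (T u))"

lemma symm_mem: "symm T \<Longrightarrow> u \<in> G \<Longrightarrow> T u \<in> G"
  by (simp add: symm_def)

lemma symm_ip: "symm T \<Longrightarrow> u \<in> G \<Longrightarrow> v \<in> G \<Longrightarrow> ip (T u) v = ip u (T v)"
  by (simp add: symm_def)

lemma symm_add:
  assumes "symm T" "u \<in> G" "v \<in> G" "w \<in> G" 
  shows "ip (T (u + v)) w = ip (T u) w + ip (T v) w"
  using assms by (simp add: symm_ip[of T] ip_simps symm_mem)

lemma symm_diff:
  assumes "symm T" "u \<in> G" "v \<in> G" "w \<in> G" 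
  shows "ip (T (u - v)) w = ip (T u) w - ip (T v) w"
  using assms by (simp add: symm_ip[of T] ip_simps symm_mem)

lemma symm_scale:
  assumes "symm T" "u \<in> G" "w \<in> G" 
  shows "ip (T (r *\<^sub>R u)) w = r * ip (T u) w"
  using assms by (simp add: symm_ip[of T] ip_simps symm_mem)

lemmas symm_simps = symm_add symm_diff symm_scale

lemma psd_cauchy_schwarz:
  assumes T: "psd T" and "u \<in> G" "v \<in> G"
  shows "(ip (T u) v)\<^sup>2 \<le> ip (T u) u * ip (T v) v"
proof (rule discriminant_nonneg_imp)
  fix t
  have s: "symm T" using T by (simp add: psd_def)
  have "0 \<le> ip (T (u + t *\<^sub>R v)) (u + t *\<^sub>R v)" using assms by (simp add: psd_def)
  also have "\<dots> = ip (T u) u + 2 * t * ip (T u) v + t\<^sup>2 * ip (T v) v"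
    using assms s ip_sym[of u "T v"] symm_ip[OF s, of u v]
    by (simp add: ip_simps symm_simps symm_mem power2_eq_square algebra_simps)
  finally show "0 \<le> ip (T u) u + 2 * t * ip (T u) v + t\<^sup>2 * ip (T v) v" .
qed (use assms in \<open>auto simp: psd_def\<close>)

lemma numerical_range_bound:
  assumes "bounded_op \<beta> T" "0 \<le> \<beta>" "symm T" "u \<in> G"
  shows "\<bar>ip (T u) u\<bar> \<le> \<beta> * ip u u"
proof -
  have "(ip (T u) u)\<^sup>2 \<le> ip (T u) (T u) * ip u u"
    using assms by (intro cauchy_schwarz) (auto simp: symm_mem)
  also have "\<dots> \<le> \<beta>\<^sup>2 * ip u u * ip u u"
    using assms by (intro mult_right_mono) (auto simp: bounded_op_def ip_nonneg)
  also have "\<dots> = (\<beta> * ip u u)\<^sup>2" by (simp add: power2_eq_square)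
  finally show ?thesis
    using assms ip_nonneg by (metis abs_le_square_iff abs_of_nonneg mult_nonneg_nonneg)
qed

text \<open>In operator form, T^2 <= \<beta> T when 0 <= T <= \<beta>. Cauchy-Schwarz for the
  semidefinite form (u, v) -> (T u, v), taken at u and T u, leaves one factor |T u|^2 to
  cancel.\<close>

lemma psd_image_le:
  assumes T: "psd T" and b: "bounded_op \<beta> T" "0 \<le> \<beta>" and u: "u \<in> G"
  shows "ip (T u) (T u) \<le> \<beta> * ip (T u) u"
proof (cases "ip (T u) (T u) = 0")
  case True
  then show ?thesis using assms by (simp add: psd_def)
next
  case False
  have s: "symm T" using T by (simp add: psd_def)
  have p: "0 < ip (T u) (T u)" using False ip_nonneg[of "T u"] symm_mem[OF s u] by linarith
  have "(ip (T u) (T u))\<^sup>2 \<le> ip (T u) u * ip (T (T u)) (T u)"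
    using T u s by (intro psd_cauchy_schwarz) (auto simp: symm_mem)
  also have "\<dots> \<le> ip (T u) u * (\<beta> * ip (T u) (T u))"
    using numerical_range_bound[OF b s, of "T u"] T u symm_mem[OF s u]
    by (intro mult_left_mono) (auto simp: psd_def)
  finally have "ip (T u) (T u) * ip (T u) (T u) \<le> (\<beta> * ip (T u) u) * ip (T u) (T u)"
    by (simp add: power2_eq_square mult_ac)
  then show ?thesis using p by (rule mult_right_le_imp_le)
qed

text \<open>The infimum of the numerical range is an approximate eigenvalue.\<close>

lemma psd_bounded_below:
  assumes T: "psd T" and b: "bounded_op \<beta> T" "0 < \<beta>" and c: "bounded_below_op c T" and u: "u \<in> G"
  shows "c / \<beta> * ip u u \<le> ip (T u) u"
proof -
  have "c * ip u u \<le> \<beta> * ip (T u) u"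
    using psd_image_le[OF T b(1) _ u] b c u unfolding bounded_below_op_def by force
  then show ?thesis using b by (simp add: field_simps)
qed

text \<open>With \<open>S = (T - \<delta>)\<^sup>-\<^sup>1\<close>, a numerical range of \<open>S\<close> reaching below \<open>- 1 / \<delta>\<close> would give
  an approximate eigenvalue of \<open>T\<close> in the gap. So \<open>S \<ge> - 1 / \<delta>\<close>, which is the claim.\<close>

lemma square_ge_of_gap:
  assumes T: "symm T"
    and low: "\<And>\<tau>. 0 < \<tau> \<Longrightarrow> \<tau> \<le> \<delta> \<Longrightarrow> \<exists>c>0. bounded_below_op c (\<lambda>u. T u - \<tau> *\<^sub>R u)"
    and onto: "\<And>f. f \<in> G \<Longrightarrow> \<exists>u\<in>G. ip (T u - \<delta> *\<^sub>R u - f) (T u - \<delta> *\<^sub>R u - f) = 0"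
    and \<delta>: "0 < \<delta>" and v: "v \<in> G"
  shows "\<delta> * ip (T v) v \<le> ip (T v) (T v)"
proof -
  note [simp] = symm_mem[OF T]
  \<comment> \<open>\<open>S\<close> chooses solutions of (T - \<delta>) u = f one by one, hence is
    an inverse only up to null vectors; \<open>S_eq\<close> is the form in which it can be computed
    with.\<close>
  obtain S where S: "\<And>f. f \<in> G \<Longrightarrow> S f \<in> G"
    and S_null: "\<And>f. f \<in> G \<Longrightarrow> ip (T (S f) - \<delta> *\<^sub>R S f - f) (T (S f) - \<delta> *\<^sub>R S f - f) = 0"
    using onto by metis
  note [simp] = S
  have S_eq: "ip (T (S f)) w = \<delta> * ip (S f) w + ip f w" if "f \<in> G" "w \<in> G" for f w
    using ip_eq_of_null_diff[of "T (S f) - \<delta> *\<^sub>R S f" f w] S_null[of f] that by (simp add: ip_simps)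
  have symS: "symm S"
    unfolding symm_def
  proof (intro conjI ballI)
    fix f g assume fg: "f \<in> G" "g \<in> G"
    show "ip (S f) g = ip f (S g)"
      using fg S_eq[of f "S g"] S_eq[of g "S f"] ip_sym[of "S f" "T (S g)"] symm_ip[OF T, of "S f" "S g"]
         ip_sym[of "S f" "S g"] ip_sym[of "S f" g] by auto
  qed simp
  obtain c where c: "c > 0" "bounded_below_op c (\<lambda>u. T u - \<delta> *\<^sub>R u)" using low[of \<delta>] \<delta> by auto
  have S_img: "ip (T (S f) - \<delta> *\<^sub>R S f) (T (S f) - \<delta> *\<^sub>R S f) = ip f f" if "f \<in> G" for f
    using that ip_sym[of "S f" "T (S f)"] ip_sym[of "S f" f] ip_sym[of f "T (S f)"] 
    by (simp add: ip_simps S_eq algebra_simps)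
  \<comment> \<open>The lower bound for T - \<tau> at \<tau> = \<delta> is an upper bound for the
    inverse.\<close>
  have bS: "bounded_op (sqrt (1 / c)) S"
    unfolding bounded_op_def
  proof
    fix u assume u: "u \<in> G"
    have "c * ip (S u) (S u) \<le> ip u u" using c(2) S_img[OF u] S[OF u] unfolding bounded_below_op_def by metis
    then show "ip (S u) (S u) \<le> (sqrt (1 / c))\<^sup>2 * ip u u" using c(1) by (simp add: field_simps)
  qed
  define bs where "bs = sqrt (1 / c)"
  have bs0: "bs > 0" and bS: "bounded_op bs S" using bS c by (auto simp: bs_def)
  have key: "- (1 / \<delta>) * ip f f \<le> ip (S f) f" if f: "f \<in> G" for f
  proof (rule ccontr)
    assume neg: "\<not> - (1 / \<delta>) * ip f f \<le> ip (S f) f"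
    define R where "R = {ip (S h) h / ip h h | h. h \<in> G \<and> ip h h \<noteq> 0}"
    have fne: "ip f f \<noteq> 0" using neg null_ip[of f "S f"] ip_sym[of f "S f"] f by force
    have lowR: "- bs \<le> r" if "r \<in> R" for r
    proof -
      obtain h where h: "h \<in> G" "ip h h \<noteq> 0" "r = ip (S h) h / ip h h" using \<open>r \<in> R\<close> by (auto simp: R_def)
      then have "ip h h > 0" using ip_nonneg[of h] by simp
      moreover have "- ip (S h) h \<le> bs * ip h h"
        using numerical_range_bound[OF bS _ symS h(1)] bs0 by (simp add: abs_le_iff)
      ultimately show ?thesis using h by (simp add: le_divide_eq)
    qed
    have bR: "bdd_below R" by (rule bdd_belowI) (rule lowR)
    have Rne: "ip (S f) f / ip f f \<in> R" using f fne by (auto simp: R_def)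
    define b where "b = Inf R"
    have ipf: "ip f f > 0" using ip_nonneg[OF f] fne by simp
    have "b \<le> ip (S f) f / ip f f" unfolding b_def by (rule cInf_lower[OF Rne bR])
    also have "\<dots> < - (1 / \<delta>)" using neg ipf by (simp add: field_simps)
    finally have b: "b < - (1 / \<delta>)" .
    then have b0: "b < 0" using \<delta> divide_pos_pos[of 1 \<delta>] by linarith
    have num: "b * ip h h \<le> ip (S h) h" if "h \<in> G" for h
    proof (cases "ip h h = 0")
      case True
      then show ?thesis using null_ip[of h "S h"] ip_sym[of h "S h"] that by simp
    next
      case False
      then have "b \<le> ip (S h) h / ip h h" unfolding b_def by (intro cInf_lower[OF _ bR]) (auto simp: R_def that)
      then show ?thesis using False ip_nonneg[OF that] by (simp add: field_simps)
    qed
    define B where "B h = S h - b *\<^sub>R h" for h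
    have BG: "B h \<in> G" if "h \<in> G" for h using that by (simp add: B_def)
    have psdB: "psd B"
      unfolding psd_def symm_def
      using num symS by (auto simp: B_def ip_simps symm_ip)
    \<comment> \<open>Spectral mapping: 1 / (T - \<delta>) takes the value \<open>b\<close> where
      \<open>T\<close> takes the value \<delta> + 1 / b, and b < - 1 / \<delta> puts the latter into
      the gap. Concretely, (T - \<tau>) S h = - (1 / b) (S - b) h up to null vectors.\<close>
    define \<tau> where "\<tau> = \<delta> + 1 / b"
    have \<tau>: "0 < \<tau>" "\<tau> \<le> \<delta>" using b b0 \<delta> by (auto simp: \<tau>_def field_simps)
    obtain ct where ct: "ct > 0" "bounded_below_op ct (\<lambda>u. T u - \<tau> *\<^sub>R u)" using low[OF \<tau>] by auto
    have Bimg: "ip (T (S h) - \<tau> *\<^sub>R S h) (T (S h) - \<tau> *\<^sub>R S h) = (1 / b)\<^sup>2 * ip (B h) (B h)" if "h \<in> G" for h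
      using that b0 ip_sym[of "S h" "T (S h)"] ip_sym[of "S h" h] ip_sym[of h "T (S h)"] 
      by (simp add: ip_simps S_eq B_def \<tau>_def field_simps power2_eq_square)
    have lowB1: "ct * ip (S h) (S h) \<le> (1 / b)\<^sup>2 * ip (B h) (B h)" if "h \<in> G" for h
      using ct(2) Bimg[OF that] S[OF that] unfolding bounded_below_op_def by metis
    \<comment> \<open>- b h is the difference of \<open>B h\<close> and \<open>S h\<close>, up to
      sign conventions of the square, and \<open>lowB1\<close> controls \<open>S h\<close> by
      \<open>B h\<close>.\<close>
    have lowB: "ip h h \<le> ((1 / b)\<^sup>2 * 2 * ((1 / b)\<^sup>2 / ct + 1)) * ip (B h) (B h)" if h: "h \<in> G" for h
    proof -
      have "ip h h = (1 / b)\<^sup>2 * ip (S h - B h) (S h - B h)"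
        using h b0 by (simp add: B_def ip_simps power2_eq_square)
      also have "\<dots> \<le> (1 / b)\<^sup>2 * (2 * ip (S h) (S h) + 2 * ip (B h) (B h))"
        using h by (intro mult_left_mono ip_diff_le) (auto simp: BG)
      also have "\<dots> \<le> (1 / b)\<^sup>2 * (2 * ((1 / b)\<^sup>2 * ip (B h) (B h) / ct) + 2 * ip (B h) (B h))"
        using lowB1[OF h] ct(1) by (intro mult_left_mono add_mono) (simp_all add: pos_le_divide_eq mult.commute)
      finally show ?thesis by (simp add: algebra_simps)
    qed
    define K where "K = (1 / b)\<^sup>2 * 2 * ((1 / b)\<^sup>2 / ct + 1)"
    have K: "K > 0" using b0 ct by (simp add: K_def add_pos_pos)
    have bb: "bounded_below_op (1 / K) B" unfolding bounded_below_op_def using lowB[folded K_def] K 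
      by (simp add: pos_divide_le_eq mult.commute)
    have bdB: "bounded_op (sqrt (2 * bs\<^sup>2 + 2 * b\<^sup>2)) B"
      unfolding bounded_op_def
    proof
      fix u assume u: "u \<in> G"
      have "ip (B u) (B u) \<le> 2 * ip (S u) (S u) + 2 * ip (b *\<^sub>R u) (b *\<^sub>R u)"
        unfolding B_def using u by (intro ip_diff_le) auto
      also have "\<dots> \<le> 2 * (bs\<^sup>2 * ip u u) + 2 * (b\<^sup>2 * ip u u)"
        using u bS by (intro add_mono mult_left_mono) (auto simp: bounded_op_def ip_simps power2_eq_square)
      finally show "ip (B u) (B u) \<le> (sqrt (2 * bs\<^sup>2 + 2 * b\<^sup>2))\<^sup>2 * ip u u"
        by (simp add: algebra_simps)
    qed
    define \<beta> where "\<beta> = sqrt (2 * bs\<^sup>2 + 2 * b\<^sup>2)"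
    have \<beta>: "\<beta> > 0" using bs0 by (simp add: \<beta>_def add_pos_nonneg)
    \<comment> \<open>A positive bounded operator that is bounded below has a strictly positive
      lower bound for its quadratic form; \<open>e\<close> is that bound for \<open>B\<close>, so
      every Rayleigh quotient of \<open>S\<close> exceeds the infimum by \<open>e\<close>.\<close>
    define e where "e = 1 / K / \<beta>"
    have e: "e > 0" using K \<beta> by (simp add: e_def)
    have "b + e \<le> r" if "r \<in> R" for r
    proof -
      obtain h where h: "h \<in> G" "ip h h \<noteq> 0" "r = ip (S h) h / ip h h" using \<open>r \<in> R\<close> by (auto simp: R_def)
      then have hp: "ip h h > 0" using ip_nonneg[of h] by simp
      have "e * ip h h \<le> ip (B h) h" unfolding e_def
        by (rule psd_bounded_below[OF psdB bdB[folded \<beta>_def] \<beta> bb h(1)])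
      then show ?thesis using h hp by (simp add: B_def ip_simps pos_le_divide_eq distrib_right)
    qed
    then have "b + e \<le> b" unfolding b_def using Rne by (intro cInf_greatest) auto
    then show False using e by simp
  qed
  let ?f = "T v - \<delta> *\<^sub>R v"
  have fG: "?f \<in> G" using v by simp
  \<comment> \<open>\<open>S\<close> is also a left inverse: T - \<delta> sends
    \<open>S ?f - v\<close> to a null vector and is bounded below.\<close>
  have z: "ip (S ?f - v) (S ?f - v) = 0"
  proof -
    let ?d = "S ?f - v"
    have "c * ip ?d ?d \<le> ip (T ?d - \<delta> *\<^sub>R ?d) (T ?d - \<delta> *\<^sub>R ?d)" using c v fG by (simp add: bounded_below_op_def)
    also have "\<dots> = 0"
    proof -
      have "ip (T ?d - \<delta> *\<^sub>R ?d) w = 0" if "w \<in> G" for w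
        using that v fG symm_diff[OF T S[OF fG] v that] S_eq[OF fG that] by (simp add: ip_diff ip_scale right_diff_distrib)
      then show ?thesis using v fG by simp
    qed
    finally show ?thesis using c ip_nonneg[of ?d] v fG by (simp add: mult_le_0_iff)
  qed
  \<comment> \<open>Expanding - (1 / \<delta>) |f|^2 <= (v, f) at f = (T - \<delta>) v cancels the
    terms in |v|^2 and leaves \<delta> (T v, v) <= |T v|^2.\<close>
  have "- (1 / \<delta>) * ip ?f ?f \<le> ip (S ?f) ?f" using key fG by blast
  also have "\<dots> = ip v ?f" using ip_eq_of_null_diff[OF _ v fG z] fG by simp
  finally have "- ip ?f ?f \<le> \<delta> * ip v ?f" using \<delta> by (simp add: field_simps)
  then show ?thesis using v ip_sym[of v "T v"] by (simp add: ip_simps algebra_simps)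
qed

text \<open>On the range of \<open>T\<close> the inequality \<open>\<delta> T \<le> T\<^sup>2\<close> becomes \<open>\<delta> \<le> T\<close>. The iterates
  \<open>(1 - c T)\<^sup>n v\<close> differ from \<open>v\<close> by elements of the range and converge to the kernel, which is
  trivial; hence the range is dense.\<close>

theorem coercive_of_gap:
  assumes T: "psd T" and b: "bounded_op \<beta> T" "0 < \<beta>"
    and low: "\<And>\<tau>. 0 < \<tau> \<Longrightarrow> \<tau> \<le> \<delta> \<Longrightarrow> \<exists>c>0. bounded_below_op c (\<lambda>u. T u - \<tau> *\<^sub>R u)"
    and onto: "\<And>f. f \<in> G \<Longrightarrow> \<exists>u\<in>G. ip (T u - \<delta> *\<^sub>R u - f) (T u - \<delta> *\<^sub>R u - f) = 0"
    and \<delta>: "0 < \<delta>"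
    and inj: "\<And>u. u \<in> G \<Longrightarrow> ip (T u) (T u) = 0 \<Longrightarrow> ip u u = 0"
    and v: "v \<in> G"
  shows "\<delta> * ip v v \<le> ip (T v) v"
proof -
  have s: "symm T" using T by (simp add: psd_def)
  note [simp] = symm_mem[OF s]
  have sq: "\<delta> * ip (T u) u \<le> ip (T u) (T u)" if "u \<in> G" for u
    by (rule square_ge_of_gap[OF s low onto \<delta> that]) auto
  \<comment> \<open>\<open>xw\<close> says that \<open>x\<close> is \<open>T w\<close> up to null
    vectors. Cauchy-Schwarz for (T u, v) gives |x|^4 <= (T w, w) (T x, x), and \<open>sq\<close>
    bounds \<delta> (T w, w) by |x|^2.\<close>
  have ran: "\<delta> * ip x x \<le> ip (T x) x"
    if x: "x \<in> G" and w: "w \<in> G" and xw: "\<And>u. u \<in> G \<Longrightarrow> ip x u = ip (T w) u" for x w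
  proof (cases "ip x x = 0")
    case True
    then show ?thesis using T x by (simp add: psd_def)
  next
    case False
    have p: "ip x x > 0" using False ip_nonneg[OF x] by simp
    have xx: "ip x x = ip (T w) x" using xw x by simp
    have TT: "ip (T w) (T w) = ip x x" using xw[of "T w"] xw[of x] w x ip_sym[of x "T w"] by simp
    have "(ip x x)\<^sup>2 = (ip (T w) x)\<^sup>2" using xx by simp
    also have "\<dots> \<le> ip (T w) w * ip (T x) x" using T w x by (intro psd_cauchy_schwarz)
    finally have "\<delta> * (ip x x)\<^sup>2 \<le> (\<delta> * ip (T w) w) * ip (T x) x" using \<delta> by (simp add: mult.assoc)
    also have "\<dots> \<le> ip x x * ip (T x) x"
      using sq[OF w] T x unfolding TT by (intro mult_right_mono) (auto simp: psd_def)
    finally show ?thesis using p by (simp add: power2_eq_square)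
  qed
  \<comment> \<open>Enlarging the bound to at least \<delta> makes
    \<open>c * \<delta> \<le> 1\<close>, so that the contraction factor \<open>q\<close> is
    nonnegative.\<close>
  define \<gamma> where "\<gamma> = max \<beta> \<delta>"
  have \<gamma>: "\<gamma> > 0" "\<delta> \<le> \<gamma>" using b by (auto simp: \<gamma>_def)
  have bg: "bounded_op \<gamma> T" unfolding bounded_op_def
  proof
    fix u assume u: "u \<in> G"
    have "\<beta>\<^sup>2 \<le> \<gamma>\<^sup>2" using b by (intro power_mono) (auto simp: \<gamma>_def)
    then show "ip (T u) (T u) \<le> \<gamma>\<^sup>2 * ip u u"
      using b u ip_nonneg[OF u] unfolding bounded_op_def by (meson mult_right_mono order_trans)
  qed
  define c where "c = 1 / \<gamma>"
  define q where "q = 1 - c * \<delta>"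
  have c: "c > 0" "c * \<delta> \<le> 1" and q: "0 \<le> q" "q < 1" using \<gamma> \<delta> by (auto simp: c_def q_def)
  define y where "y = rec_nat v (\<lambda>_ u. u - c *\<^sub>R T u)"
  have y0: "y 0 = v" and yS: "y (Suc n) = y n - c *\<^sub>R T (y n)" for n by (simp_all add: y_def)
  have yG [simp]: "y n \<in> G" for n by (induction n) (simp_all add: y0 yS v)
  \<comment> \<open>With x = T u, |(1 - c T) x|^2 = |x|^2 - 2 c (T x, x) + c^2 |T x|^2. The last
    term is absorbed by c T^2 <= T, and what remains is bounded through \<open>ran\<close>, since
    \<open>x\<close> lies in the range.\<close>
  have contr: "ip (T (u - c *\<^sub>R T u)) (T (u - c *\<^sub>R T u)) \<le> q * ip (T u) (T u)" if u: "u \<in> G" for u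
  proof -
    let ?x = "T u"
    have lin: "ip (T (u - c *\<^sub>R T u)) w = ip (?x - c *\<^sub>R T ?x) w" if "w \<in> G" for w
      using u that s by (simp add: ip_simps symm_simps)
    have "ip (T (u - c *\<^sub>R T u)) (T (u - c *\<^sub>R T u)) = ip (?x - c *\<^sub>R T ?x) (?x - c *\<^sub>R T ?x)"
      using u lin[of "T (u - c *\<^sub>R T u)"] lin[of "?x - c *\<^sub>R T ?x"] 
        ip_sym[of "T (u - c *\<^sub>R T u)" "?x - c *\<^sub>R T ?x"] by simp
    also have "\<dots> = ip ?x ?x - 2 * c * ip (T ?x) ?x + c * (c * ip (T ?x) (T ?x))"
      using u ip_sym[of ?x "T ?x"] by (simp add: ip_simps algebra_simps)
    also have "\<dots> \<le> ip ?x ?x - 2 * c * ip (T ?x) ?x + c * ip (T ?x) ?x"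
    proof -
      have "ip (T ?x) (T ?x) \<le> \<gamma> * ip (T ?x) ?x" using psd_image_le[OF T bg, of ?x] \<gamma> u by simp
      then have "c * ip (T ?x) (T ?x) \<le> ip (T ?x) ?x" using \<gamma> by (simp add: c_def field_simps)
      then show ?thesis using c by simp
    qed
    also have "\<dots> = ip ?x ?x - c * ip (T ?x) ?x" by simp
    also have "\<dots> \<le> ip ?x ?x - c * (\<delta> * ip ?x ?x)"
      using ran[of ?x u] u c by simp
    finally show ?thesis by (simp add: q_def algebra_simps)
  qed
  have geo: "ip (T (y n)) (T (y n)) \<le> ip (T v) (T v) * q ^ n" for n
  proof (induction n)
    case (Suc n)
    have "ip (T (y (Suc n))) (T (y (Suc n))) \<le> q * ip (T (y n)) (T (y n))"
      unfolding yS by (rule contr) simp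
    also have "\<dots> \<le> q * (ip (T v) (T v) * q ^ n)" using Suc q by (intro mult_left_mono)
    finally show ?case by (simp add: algebra_simps)
  qed (simp add: y0)
  \<comment> \<open>The increments are - c T (y n), so the decay in \<open>geo\<close> bounds the
    steps; completeness applies before anything is known about the size of \<open>y n\<close>
    itself.\<close>
  have step: "ip (y (Suc n) - y n) (y (Suc n) - y n) \<le> (c\<^sup>2 * ip (T v) (T v)) * q ^ n" for n
  proof -
    have eq: "y (Suc n) - y n = (- c) *\<^sub>R T (y n)" by (simp add: yS)
    have "ip (y (Suc n) - y n) (y (Suc n) - y n) = c\<^sup>2 * ip (T (y n)) (T (y n))"
      unfolding eq using ip_scale[of "T (y n)" "(- c) *\<^sub>R T (y n)" "- c"] 
        ip_scale_right[of "T (y n)" "T (y n)" "- c"] mem(4)[of "T (y n)" "- c"]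
      by (simp add: power2_eq_square)
    also have "\<dots> \<le> c\<^sup>2 * (ip (T v) (T v) * q ^ n)" by (intro mult_left_mono geo) simp
    finally show ?thesis by (simp add: mult.assoc)
  qed
  obtain l where l: "l \<in> G" and lim: "(\<lambda>n. ip (y n - l) (y n - l)) \<longlonglongrightarrow> 0"
    using complete[OF yG q step] by blast
  have conv: "(\<lambda>n. ip (y n) w) \<longlonglongrightarrow> ip l w" if w: "w \<in> G" for w
  proof -
    have "(\<lambda>n. (ip (y n) w - ip l w)\<^sup>2) \<longlonglongrightarrow> 0"
    proof (rule tendsto_sandwich[of "\<lambda>_. 0" _ _ "\<lambda>n. ip (y n - l) (y n - l) * ip w w"])
      show "\<forall>\<^sub>F n in sequentially. (ip (y n) w - ip l w)\<^sup>2 \<le> ip (y n - l) (y n - l) * ip w w"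
      proof (intro always_eventually allI)
        show "(ip (y n) w - ip l w)\<^sup>2 \<le> ip (y n - l) (y n - l) * ip w w" for n
          using cauchy_schwarz[of "y n - l" w] ip_diff[of "y n" l w] w l by simp
      qed
      show "(\<lambda>n. ip (y n - l) (y n - l) * ip w w) \<longlonglongrightarrow> 0"
        using tendsto_mult_right[OF lim, of "ip w w"] by simp
    qed auto
    then have "(\<lambda>n. ip (y n) w - ip l w) \<longlonglongrightarrow> 0"
      using power_tendsto_0_iff[of 2 "\<lambda>n. ip (y n) w - ip l w", OF pos2] by blast
    then show ?thesis by (rule LIM_zero_cancel)
  qed
  have Tnull: "(\<lambda>n. ip (T (y n)) w) \<longlonglongrightarrow> 0" if w: "w \<in> G" for w
  proof -
    have "(\<lambda>n. (ip (T (y n)) w)\<^sup>2) \<longlonglongrightarrow> 0"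
    proof (rule tendsto_sandwich[of "\<lambda>_. 0" _ _ "\<lambda>n. (ip (T v) (T v) * q ^ n) * ip w w"])
      show "\<forall>\<^sub>F n in sequentially. (ip (T (y n)) w)\<^sup>2 \<le> (ip (T v) (T v) * q ^ n) * ip w w"
      proof (intro always_eventually allI)
        show "(ip (T (y n)) w)\<^sup>2 \<le> (ip (T v) (T v) * q ^ n) * ip w w" for n
          by (rule order_trans[OF cauchy_schwarz mult_right_mono[OF geo ip_nonneg[OF w]]]) (use w in auto)
      qed
      show "(\<lambda>n. (ip (T v) (T v) * q ^ n) * ip w w) \<longlonglongrightarrow> 0"
        using q by (auto intro!: tendsto_eq_intros LIMSEQ_realpow_zero)
    qed auto
    then show ?thesis using power_tendsto_0_iff[of 2 "\<lambda>n. ip (T (y n)) w", OF pos2] by blast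
  qed
  \<comment> \<open>The limit lies in the kernel: (y n, T (T l)) = (T (y n), T l) tends both to (l,
    T (T l)) and to 0. Injectivity then makes \<open>l\<close> a null vector.\<close>
  have "ip l (T (T l)) = 0"
    using LIMSEQ_unique[OF conv[of "T (T l)"]] Tnull[of "T l"] l s by (simp add: symm_ip)
  then have "ip (T l) (T l) = 0" using symm_ip[OF s l, of "T l"] l by simp
  then have l0: "ip l l = 0" using inj l by blast
  have yn: "(\<lambda>n. ip (y n) (y n)) \<longlonglongrightarrow> 0"
  proof -
    have "ip (y n - l) (y n - l) = ip (y n) (y n)" for n
      using null_ip[OF l _ l0] l l0 ip_sym[of l "y n"] by (simp add: ip_simps)
    then show ?thesis using lim by simp
  qed
  \<comment> \<open>Telescoping: \<open>v - y n\<close> equals \<open>T (w n)\<close> up to null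
    vectors, so \<open>ran\<close> applies to it.\<close>
  define w where "w n = c *\<^sub>R (\<Sum>i<n. y i)" for n
  have wG: "w n \<in> G" for n
    unfolding w_def by (intro mem(4) subspace_sum[OF subspace]) simp
  have vw: "ip (v - y n) u = ip (T (w n)) u" if u: "u \<in> G" for n u
  proof (induction n)
    case 0
    have "ip (T 0) u = 0" using symm_ip[OF s, of 0 u] u by (simp add: ip_zero)
    then show ?case using u by (simp add: y0 w_def ip_zero)
  next
    case (Suc n)
    have "w (Suc n) = w n + c *\<^sub>R y n" by (simp add: w_def scaleR_add_right)
    then show ?case using u v Suc wG[of n] s by (simp add: yS ip_simps symm_simps)
  qed
  have ineq: "\<delta> * ip (v - y n) (v - y n) \<le> ip (T (v - y n)) (v - y n)" for n
    using ran[of "v - y n" "w n"] vw wG v by simp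
  have e1: "ip (v - y n) (v - y n) = ip v v - 2 * ip (y n) v + ip (y n) (y n)" for n
    using v ip_sym[of v "y n"] by (simp add: ip_simps)
  have e2: "ip (T (v - y n)) (v - y n) = ip (T v) v - 2 * ip (T (y n)) v + ip (T (y n)) (y n)" for n
    using v s ip_sym[of v "T (y n)"] symm_ip[OF s, of v "y n"] by (simp add: ip_simps symm_simps)
  have lv: "ip l v = 0" using null_ip[OF l v l0] .
  have Tyy: "(\<lambda>n. ip (T (y n)) (y n)) \<longlonglongrightarrow> 0"
  proof (rule tendsto_sandwich[of "\<lambda>_. 0" _ _ "\<lambda>n. \<gamma> * ip (y n) (y n)"])
    show "\<forall>\<^sub>F n in sequentially. ip (T (y n)) (y n) \<le> \<gamma> * ip (y n) (y n)"
    proof (intro always_eventually allI)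
      show "ip (T (y n)) (y n) \<le> \<gamma> * ip (y n) (y n)" for n
        using numerical_range_bound[OF bg _ s yG, of n] \<gamma> by simp
    qed
    show "\<forall>\<^sub>F n in sequentially. 0 \<le> ip (T (y n)) (y n)" using T by (simp add: psd_def)
    show "(\<lambda>n. \<gamma> * ip (y n) (y n)) \<longlonglongrightarrow> 0" using tendsto_mult_left[OF yn, of \<gamma>] by simp
  qed auto
  have "(\<lambda>n. \<delta> * (ip v v - 2 * ip (y n) v + ip (y n) (y n))) \<longlonglongrightarrow> \<delta> * (ip v v - 2 * 0 + 0)"
    using conv[OF v] yn unfolding lv by (intro tendsto_intros) 
  moreover have "(\<lambda>n. ip (T v) v - 2 * ip (T (y n)) v + ip (T (y n)) (y n)) \<longlonglongrightarrow> ip (T v) v - 2 * 0 + 0"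
    using Tnull[OF v] Tyy by (intro tendsto_intros) 
  ultimately have "\<delta> * (ip v v - 2 * 0 + 0) \<le> ip (T v) v - 2 * 0 + 0"
    using ineq unfolding e1 e2 by (intro LIMSEQ_le) auto
  then show ?thesis by simp
qed

end

section \<open>Square integrable functions\<close>

text \<open>Pointwise scaling; with the pointwise addition of \<open>Function_Algebras\<close> it
  lets sets of functions serve as carriers of \<open>semi_hilbert\<close>.\<close>

instantiation "fun" :: (type, real_vector) real_vector
begin
definition "r *\<^sub>R f = (\<lambda>x. r *\<^sub>R f x)"
instance by standard (simp_all add: fun_eq_iff scaleR_fun_def scaleR_add_right scaleR_add_left)
end

text \<open>Dividing |y (i + 1) - y i|^2 by r ^ (2 i), with r the fourth root of the decay rate,
  still leaves integrals of order r ^ (2 i). So the weighted sum \<open>g\<close> is integrable,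
  each step is at most sqrt (g x) r ^ i almost everywhere, and this gives both pointwise convergence
  and the integrable bound |y n - l|^2 <= g r ^ (2 n) / (1 - r)^2.\<close>

lemma L2_fast_cauchy_limit:
  fixes y :: "nat \<Rightarrow> 'x \<Rightarrow> complex"
  assumes meas [measurable]: "\<And>n. y n \<in> borel_measurable M"
    and int: "\<And>n. integrable M (\<lambda>x. (cmod (y n x))\<^sup>2)"
    and q: "0 \<le> q" "q < 1"
    and int_step: "\<And>n. integrable M (\<lambda>x. (cmod (y (Suc n) x - y n x))\<^sup>2)"
    and step: "\<And>n. (LINT x|M. (cmod (y (Suc n) x - y n x))\<^sup>2) \<le> C * q ^ n"
  shows "\<exists>l \<in> borel_measurable M. integrable M (\<lambda>x. (cmod (l x))\<^sup>2) \<and>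
      (\<lambda>n. LINT x|M. (cmod (y n x - l x))\<^sup>2) \<longlonglongrightarrow> 0"
proof -
  \<comment> \<open>\<open>q\<close> may be 0; raising it to at least 1 / 2 keeps the weights r ^ (2
    i) invertible.\<close>
  define p where "p = max q (1 / 2)"
  have p: "0 < p" "p < 1" "q \<le> p" using q by (auto simp: p_def)
  define r where "r = sqrt (sqrt p)"
  have r: "0 < r" "r < 1" "r ^ 4 = p" "q \<le> r ^ 4"
  proof -
    show "0 < r" "r < 1" using p by (auto simp: r_def)
    have "r ^ 4 = (r\<^sup>2)\<^sup>2" by (simp add: power_mult[symmetric])
    also have "\<dots> = p" using p by (simp add: r_def)
    finally show "r ^ 4 = p" .
    then show "q \<le> r ^ 4" using p by simp
  qed
  have C: "0 \<le> C" using step[of 0] order_trans[OF integral_nonneg_AE step[of 0]] by simp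
  define h where "h i x = (cmod (y (Suc i) x - y i x))\<^sup>2 / r ^ (2 * i)" for i x
  have h0: "0 \<le> h i x" for i x using r by (simp add: h_def)
  have hint: "integrable M (h i)" for i unfolding h_def using int_step by simp
  have hle: "(LINT x|M. h i x) \<le> C * (r\<^sup>2) ^ i" for i
  proof -
    have "(LINT x|M. h i x) \<le> C * q ^ i / r ^ (2 * i)"
      unfolding h_def using step[of i] r by (simp add: divide_right_mono)
    also have "\<dots> \<le> C * (r ^ 4) ^ i / r ^ (2 * i)"
      using q r C by (intro divide_right_mono mult_left_mono power_mono) auto
    also have "\<dots> = C * (r\<^sup>2) ^ i"
    proof -
      have "(r ^ 4) ^ i = r ^ (2 * i) * (r\<^sup>2) ^ i"
        by (simp only: power_mult[symmetric] power_add[symmetric]) simp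
      then show ?thesis using r(1) by simp
    qed
    finally show ?thesis .
  qed
  have r2: "0 \<le> r\<^sup>2" "r\<^sup>2 < 1" using r by (auto simp: power_less_one_iff)
  have sumC: "summable (\<lambda>i. C * (r\<^sup>2) ^ i)" using r2 by (intro summable_mult summable_geometric) auto
  have "(\<integral>\<^sup>+x. (\<Sum>i. ennreal (h i x)) \<partial>M) = (\<Sum>i. \<integral>\<^sup>+x. ennreal (h i x) \<partial>M)"
    using hint by (intro nn_integral_suminf) auto
  also have "\<dots> = (\<Sum>i. ennreal (LINT x|M. h i x))"
    using hint h0 by (simp add: nn_integral_eq_integral)
  also have "\<dots> \<le> (\<Sum>i. ennreal (C * (r\<^sup>2) ^ i))"
    using hle by (intro suminf_le ennreal_leI) auto
  also have "\<dots> = ennreal (\<Sum>i. C * (r\<^sup>2) ^ i)"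
    using sumC C r by (intro suminf_ennreal2) auto
  finally have "(\<integral>\<^sup>+x. (\<Sum>i. ennreal (h i x)) \<partial>M) \<noteq> \<infinity>"
    by (auto simp: top_unique)
  then have "AE x in M. (\<Sum>i. ennreal (h i x)) \<noteq> \<infinity>"
    using hint by (intro nn_integral_PInf_AE) auto
  then have AEs: "AE x in M. summable (\<lambda>i. h i x)"
    by eventually_elim (auto intro: summable_suminf_not_top h0)
  define g where "g x = (\<Sum>i. h i x)" for x
  have gint: "integrable M g" unfolding g_def
  proof (rule integrable_suminf[OF hint])
    show "AE x in M. summable (\<lambda>i. norm (h i x))" using AEs h0 by simp
    have eq: "(LINT x|M. norm (h i x)) = (LINT x|M. h i x)" for i using h0 by simp
    show "summable (\<lambda>i. LINT x|M. norm (h i x))"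
      unfolding eq using hle sumC by (intro summable_comparison_test'[OF sumC, of 0]) (auto intro!: integral_nonneg_AE simp: h0)
  qed
  \<comment> \<open>\<open>lim\<close> is total, so \<open>l\<close> is measurable although the
    sequence converges only almost everywhere.\<close>
  define l where "l x = lim (\<lambda>n. y n x)" for x
  have l_meas [measurable]: "l \<in> borel_measurable M" unfolding l_def by measurable
  have bound: "AE x in M. \<forall>n. (cmod (y n x - l x))\<^sup>2 \<le> g x * ((r\<^sup>2) ^ n / (1 - r)\<^sup>2)"
    using AEs
  proof eventually_elim
    fix x assume s: "summable (\<lambda>i. h i x)"
    have hg: "h i x \<le> g x" for i
      unfolding g_def using s h0 sum_le_suminf[OF s, of "{i}"] by simp
    have g0: "0 \<le> g x" using hg[of 0] h0[of 0 x] by linarith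
    define d where "d i = y (Suc i) x - y i x" for i
    have dle: "cmod (d i) \<le> sqrt (g x) * r ^ i" for i
    proof (rule power2_le_imp_le)
      have "(cmod (d i))\<^sup>2 = h i x * r ^ (2 * i)" using r by (simp add: h_def d_def)
      also have "\<dots> \<le> g x * r ^ (2 * i)" using hg r by (intro mult_right_mono) auto
      also have "\<dots> = (sqrt (g x) * r ^ i)\<^sup>2" using g0 by (simp add: power_mult_distrib power_mult[symmetric] mult.commute)
      finally show "(cmod (d i))\<^sup>2 \<le> (sqrt (g x) * r ^ i)\<^sup>2" .
    qed (use g0 r in auto)
    have sg: "summable (\<lambda>i. sqrt (g x) * r ^ i)" using r by (intro summable_mult summable_geometric) auto
    have sd: "summable (\<lambda>i. norm (d i))" using dle by (intro summable_comparison_test'[OF sg, of 0]) auto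
    have dsum: "(\<lambda>n. \<Sum>i<n. d i) \<longlonglongrightarrow> suminf d"
      using summable_LIMSEQ[OF summable_norm_cancel[OF sd]] .
    have tel: "(\<Sum>i<n. d i) = y n x - y 0 x" for n unfolding d_def by (rule sum_lessThan_telescope)
    have "(\<lambda>n. (\<Sum>i<n. d i) + y 0 x) \<longlonglongrightarrow> suminf d + y 0 x" by (intro tendsto_intros dsum)
    then have conv: "(\<lambda>n. y n x) \<longlonglongrightarrow> suminf d + y 0 x" by (simp add: tel)
    then have lx: "l x = suminf d + y 0 x" unfolding l_def by (rule limI)
    show "\<forall>n. (cmod (y n x - l x))\<^sup>2 \<le> g x * ((r\<^sup>2) ^ n / (1 - r)\<^sup>2)"
    proof
      fix n
      have "l x - y n x = suminf d - (\<Sum>i<n. d i)" by (simp add: lx tel)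
      also have "\<dots> = (\<Sum>i. d (i + n))" by (subst suminf_minus_initial_segment[OF summable_norm_cancel[OF sd]]) simp
      finally have "cmod (y n x - l x) = cmod (\<Sum>i. d (i + n))" by (metis norm_minus_commute)
      also have "\<dots> \<le> (\<Sum>i. cmod (d (i + n)))" 
        by (intro summable_norm summable_ignore_initial_segment sd)
      also have "\<dots> \<le> (\<Sum>i. sqrt (g x) * r ^ n * r ^ i)"
      proof (rule suminf_le)
        show "cmod (d (i + n)) \<le> sqrt (g x) * r ^ n * r ^ i" for i
          using dle[of "i + n"] by (simp add: power_add mult_ac)
        show "summable (\<lambda>i. cmod (d (i + n)))" by (intro summable_ignore_initial_segment sd)
        show "summable (\<lambda>i. sqrt (g x) * r ^ n * r ^ i)" using r by (intro summable_mult summable_geometric) auto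
      qed
      also have "\<dots> = sqrt (g x) * r ^ n * (1 / (1 - r))"
        using r by (subst suminf_mult) (auto simp: suminf_geometric summable_geometric)
      finally have "(cmod (y n x - l x))\<^sup>2 \<le> (sqrt (g x) * r ^ n * (1 / (1 - r)))\<^sup>2"
        by (intro power_mono) auto
      also have "\<dots> = g x * ((r\<^sup>2) ^ n / (1 - r)\<^sup>2)"
        using g0 by (simp add: power_mult_distrib power_divide power_mult[symmetric] mult.commute)
      finally show "(cmod (y n x - l x))\<^sup>2 \<le> g x * ((r\<^sup>2) ^ n / (1 - r)\<^sup>2)" .
    qed
  qed
  have dint: "integrable M (\<lambda>x. (cmod (y n x - l x))\<^sup>2)" for n
  proof (rule Bochner_Integration.integrable_bound)
    show "integrable M (\<lambda>x. g x * ((r\<^sup>2) ^ n / (1 - r)\<^sup>2))" using gint by simp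
    show "AE x in M. norm ((cmod (y n x - l x))\<^sup>2) \<le> norm (g x * ((r\<^sup>2) ^ n / (1 - r)\<^sup>2))"
      using bound
    proof eventually_elim
      case (elim x)
      then have "(cmod (y n x - l x))\<^sup>2 \<le> g x * ((r\<^sup>2) ^ n / (1 - r)\<^sup>2)" by blast
      also have "\<dots> \<le> norm (g x * ((r\<^sup>2) ^ n / (1 - r)\<^sup>2))" by (metis abs_ge_self real_norm_def)
      finally show ?case by simp
    qed
  qed measurable
  have lint: "integrable M (\<lambda>x. (cmod (l x))\<^sup>2)"
  proof (rule Bochner_Integration.integrable_bound)
    show "integrable M (\<lambda>x. 2 * (cmod (y 0 x - l x))\<^sup>2 + 2 * (cmod (y 0 x))\<^sup>2)" using dint int by simp
    have "(cmod (l x))\<^sup>2 \<le> 2 * (cmod (y 0 x - l x))\<^sup>2 + 2 * (cmod (y 0 x))\<^sup>2" for x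
    proof -
      have "(cmod (l x))\<^sup>2 \<le> (cmod (y 0 x - l x) + cmod (y 0 x))\<^sup>2"
        by (intro power_mono) (metis norm_minus_commute norm_triangle_sub add.commute, simp)
      also have "\<dots> \<le> 2 * (cmod (y 0 x - l x))\<^sup>2 + 2 * (cmod (y 0 x))\<^sup>2"
        using sum_squares_bound[of "cmod (y 0 x - l x)" "cmod (y 0 x)"] by (simp add: power2_eq_square algebra_simps)
      finally show ?thesis .
    qed
    then show "AE x in M. norm ((cmod (l x))\<^sup>2) \<le> norm (2 * (cmod (y 0 x - l x))\<^sup>2 + 2 * (cmod (y 0 x))\<^sup>2)"
      by simp
  qed measurable
  have "(\<lambda>n. LINT x|M. (cmod (y n x - l x))\<^sup>2) \<longlonglongrightarrow> 0"
  proof (rule tendsto_sandwich[of "\<lambda>_. 0" _ _ "\<lambda>n. (LINT x|M. g x) * ((r\<^sup>2) ^ n / (1 - r)\<^sup>2)"])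
    show "\<forall>\<^sub>F n in sequentially. (LINT x|M. (cmod (y n x - l x))\<^sup>2) \<le> (LINT x|M. g x) * ((r\<^sup>2) ^ n / (1 - r)\<^sup>2)"
    proof (intro always_eventually allI)
      fix n
      have "(LINT x|M. (cmod (y n x - l x))\<^sup>2) \<le> (LINT x|M. g x * ((r\<^sup>2) ^ n / (1 - r)\<^sup>2))"
        using bound gint by (intro integral_mono_AE dint) auto
      then show "(LINT x|M. (cmod (y n x - l x))\<^sup>2) \<le> (LINT x|M. g x) * ((r\<^sup>2) ^ n / (1 - r)\<^sup>2)" by simp
    qed
    show "(\<lambda>n. (LINT x|M. g x) * ((r\<^sup>2) ^ n / (1 - r)\<^sup>2)) \<longlonglongrightarrow> 0"
      using r2 by (auto intro!: tendsto_eq_intros LIMSEQ_realpow_zero)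
  qed auto
  then show ?thesis using l_meas lint by blast
qed

section \<open>Closure properties of square integrable functions and the sesquilinear inner
  product\<close>

lemma L2_integrable: "u \<in> L2 \<Omega> \<Longrightarrow> integrable (lebesgue_on \<Omega>) (\<lambda>x. (cmod (u x))\<^sup>2)"
  by (simp add: L2_def)

lemma L2_prod_integrable:
  assumes "u \<in> L2 \<Omega>" "v \<in> L2 \<Omega>"
  shows "integrable (lebesgue_on \<Omega>) (\<lambda>x. u x * cnj (v x))"
proof (rule Bochner_Integration.integrable_bound)
  show "integrable (lebesgue_on \<Omega>) (\<lambda>x. (cmod (u x))\<^sup>2 + (cmod (v x))\<^sup>2)"
    using assms by (simp add: L2_integrable)
  have "cmod (u x) * cmod (v x) \<le> (cmod (u x))\<^sup>2 + (cmod (v x))\<^sup>2" for x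
    using sum_squares_bound[of "cmod (u x)" "cmod (v x)"]
      mult_nonneg_nonneg[OF norm_ge_zero[of "u x"] norm_ge_zero[of "v x"]] by linarith
  then show "AE x in lebesgue_on \<Omega>. norm (u x * cnj (v x)) \<le> norm ((cmod (u x))\<^sup>2 + (cmod (v x))\<^sup>2)"
    by (simp add: norm_mult)
  have "u \<in> borel_measurable (lebesgue_on \<Omega>)" "v \<in> borel_measurable (lebesgue_on \<Omega>)"
    using assms by (auto simp: L2_def)
  then show "(\<lambda>x. u x * cnj (v x)) \<in> borel_measurable (lebesgue_on \<Omega>)" 
    by (intro borel_measurable_times borel_measurable_continuous_on[where f=cnj]) (auto intro: continuous_intros)
qed

lemma L2_add [intro]:
  assumes "u \<in> L2 \<Omega>" "v \<in> L2 \<Omega>" shows "(\<lambda>x. u x + v x) \<in> L2 \<Omega>"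
  unfolding L2_def
proof (intro CollectI conjI)
  have m [measurable]: "u \<in> borel_measurable (lebesgue_on \<Omega>)" "v \<in> borel_measurable (lebesgue_on \<Omega>)"
    using assms by (auto simp: L2_def)
  show "(\<lambda>x. u x + v x) \<in> borel_measurable (lebesgue_on \<Omega>)" by measurable
  show "integrable (lebesgue_on \<Omega>) (\<lambda>x. (cmod (u x + v x))\<^sup>2)"
  proof (rule Bochner_Integration.integrable_bound)
    show "integrable (lebesgue_on \<Omega>) (\<lambda>x. 2 * (cmod (u x))\<^sup>2 + 2 * (cmod (v x))\<^sup>2)"
      using assms by (simp add: L2_integrable)
    have "(cmod (u x + v x))\<^sup>2 \<le> 2 * (cmod (u x))\<^sup>2 + 2 * (cmod (v x))\<^sup>2" for x
    proof -
      have "(cmod (u x + v x))\<^sup>2 \<le> (cmod (u x) + cmod (v x))\<^sup>2"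
        by (intro power_mono norm_triangle_ineq) simp
      also have "\<dots> \<le> 2 * (cmod (u x))\<^sup>2 + 2 * (cmod (v x))\<^sup>2"
        using sum_squares_bound[of "cmod (u x)" "cmod (v x)"] by (simp add: power2_eq_square algebra_simps)
      finally show ?thesis .
    qed
    then show "AE x in lebesgue_on \<Omega>. norm ((cmod (u x + v x))\<^sup>2) \<le> norm (2 * (cmod (u x))\<^sup>2 + 2 * (cmod (v x))\<^sup>2)"
      by simp
  qed measurable
qed

lemma L2_cmult [intro]:
  assumes "u \<in> L2 \<Omega>" shows "(\<lambda>x. c * u x) \<in> L2 \<Omega>"
  using assms by (auto simp: L2_def norm_mult power_mult_distrib)

lemma L2_zero [simp, intro]: "(\<lambda>x. 0) \<in> L2 \<Omega>"
  by (simp add: L2_def)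

lemma L2_minus [intro]:
  assumes "u \<in> L2 \<Omega>" shows "(\<lambda>x. - u x) \<in> L2 \<Omega>"
  using L2_cmult[OF assms, of "-1"] by simp

lemma L2_diff [intro]:
  assumes "u \<in> L2 \<Omega>" "v \<in> L2 \<Omega>" shows "(\<lambda>x. u x - v x) \<in> L2 \<Omega>"
  using L2_add[OF assms(1) L2_minus[OF assms(2)]] by simp

lemma L2_sum [intro]:
  assumes "\<And>i. i \<in> I \<Longrightarrow> f i \<in> L2 \<Omega>" shows "(\<lambda>x. \<Sum>i\<in>I. f i x) \<in> L2 \<Omega>"
  using assms by (induction I rule: infinite_finite_induct) auto

lemma L2_inner_add:
  "\<lbrakk>u \<in> L2 \<Omega>; v \<in> L2 \<Omega>; w \<in> L2 \<Omega>\<rbrakk> \<Longrightarrow> L2_inner \<Omega> (\<lambda>x. u x + v x) w = L2_inner \<Omega> u w + L2_inner \<Omega> v w"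
  by (simp add: L2_inner_def ring_distribs L2_prod_integrable)

lemma L2_inner_diff:
  "\<lbrakk>u \<in> L2 \<Omega>; v \<in> L2 \<Omega>; w \<in> L2 \<Omega>\<rbrakk> \<Longrightarrow> L2_inner \<Omega> (\<lambda>x. u x - v x) w = L2_inner \<Omega> u w - L2_inner \<Omega> v w"
  by (simp add: L2_inner_def ring_distribs L2_prod_integrable)

lemma L2_inner_cmult: "L2_inner \<Omega> (\<lambda>x. c * u x) w = c * L2_inner \<Omega> u w"
  by (simp add: L2_inner_def mult.assoc)

lemma L2_inner_zero: "L2_inner \<Omega> (\<lambda>x. 0) w = 0"
  by (simp add: L2_inner_def)

lemma L2_inner_sum:
  "\<lbrakk>\<And>i. i \<in> I \<Longrightarrow> f i \<in> L2 \<Omega>; w \<in> L2 \<Omega>\<rbrakk> \<Longrightarrow> L2_inner \<Omega> (\<lambda>x. \<Sum>i\<in>I. f i x) w = (\<Sum>i\<in>I. L2_inner \<Omega> (f i) w)"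
  by (induction I rule: infinite_finite_induct) (auto simp: L2_inner_zero L2_inner_add L2_sum)

lemma L2_inner_cnj: "L2_inner \<Omega> v u = cnj (L2_inner \<Omega> u v)"
proof -
  have "(\<lambda>x. v x * cnj (u x)) = (\<lambda>x. cnj (u x * cnj (v x)))" by (simp add: mult.commute)
  then show ?thesis unfolding L2_inner_def by (simp only: Bochner_Integration.integral_cnj)
qed

lemma L2_inner_add_right:
  "\<lbrakk>u \<in> L2 \<Omega>; v \<in> L2 \<Omega>; w \<in> L2 \<Omega>\<rbrakk> \<Longrightarrow> L2_inner \<Omega> w (\<lambda>x. u x + v x) = L2_inner \<Omega> w u + L2_inner \<Omega> w v"
  by (simp add: L2_inner_cnj[of \<Omega> w] L2_inner_add)

lemma L2_inner_diff_right:
  "\<lbrakk>u \<in> L2 \<Omega>; v \<in> L2 \<Omega>; w \<in> L2 \<Omega>\<rbrakk> \<Longrightarrow> L2_inner \<Omega> w (\<lambda>x. u x - v x) = L2_inner \<Omega> w u - L2_inner \<Omega> w v"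
  by (simp add: L2_inner_cnj[of \<Omega> w] L2_inner_diff)

lemma L2_inner_cmult_right: "L2_inner \<Omega> w (\<lambda>x. c * u x) = cnj c * L2_inner \<Omega> w u"
  by (simp add: L2_inner_cnj[of \<Omega> w] L2_inner_cmult)

lemma L2_inner_sum_right:
  "\<lbrakk>\<And>i. i \<in> I \<Longrightarrow> f i \<in> L2 \<Omega>; w \<in> L2 \<Omega>\<rbrakk> \<Longrightarrow> L2_inner \<Omega> w (\<lambda>x. \<Sum>i\<in>I. f i x) = (\<Sum>i\<in>I. L2_inner \<Omega> w (f i))"
  by (simp add: L2_inner_cnj[of \<Omega> w] L2_inner_sum)

lemma L2_inner_self: "L2_inner \<Omega> u u = of_real (LINT x|lebesgue_on \<Omega>. (cmod (u x))\<^sup>2)"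
  unfolding L2_inner_def complex_norm_square[symmetric] by (rule integral_complex_of_real)

lemma L2_inner_self_norm: "L2_inner \<Omega> u u = of_real ((L2_norm \<Omega> u)\<^sup>2)"
  unfolding L2_inner_self L2_norm_def by simp

lemma L2_norm_nonneg [simp]: "0 \<le> L2_norm \<Omega> u"
  by (simp add: L2_norm_def)

lemma L2_inner_AE_cong:
  assumes "AE x in lebesgue_on \<Omega>. u x = u' x" "AE x in lebesgue_on \<Omega>. v x = v' x"
    "u \<in> L2 \<Omega>" "v \<in> L2 \<Omega>" "u' \<in> L2 \<Omega>" "v' \<in> L2 \<Omega>"
  shows "L2_inner \<Omega> u v = L2_inner \<Omega> u' v'"
  unfolding L2_inner_def
proof (rule integral_cong_AE)
  show "AE x in lebesgue_on \<Omega>. u x * cnj (v x) = u' x * cnj (v' x)"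
    using assms(1,2) by eventually_elim simp
qed (use assms in \<open>auto intro: borel_measurable_integrable L2_prod_integrable\<close>)

lemma L2_norm_eq_0_iff:
  assumes "u \<in> L2 \<Omega>"
  shows "L2_norm \<Omega> u = 0 \<longleftrightarrow> (AE x in lebesgue_on \<Omega>. u x = 0)"
  using integral_nonneg_eq_0_iff_AE[OF L2_integrable[OF assms]] by (simp add: L2_norm_def)

definition L2_perp :: "'a::euclidean_space set \<Rightarrow> ('a \<Rightarrow> complex) set \<Rightarrow> ('a \<Rightarrow> complex) set" where
  "L2_perp \<Omega> E = {u \<in> L2 \<Omega>. \<forall>e\<in>E. L2_inner \<Omega> u e = 0}"

lemma Re_L2_inner_self: "Re (L2_inner \<Omega> u u) = (LINT x|lebesgue_on \<Omega>. (cmod (u x))\<^sup>2)"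
  by (simp add: L2_inner_self)

lemma L2_cauchy_schwarz:
  assumes u: "u \<in> L2 \<Omega>" and v: "v \<in> L2 \<Omega>"
  shows "cmod (L2_inner \<Omega> u v) \<le> L2_norm \<Omega> u * L2_norm \<Omega> v"
proof -
  have *: "(Re (L2_inner \<Omega> w v))\<^sup>2 \<le> (L2_norm \<Omega> w)\<^sup>2 * (L2_norm \<Omega> v)\<^sup>2" if w: "w \<in> L2 \<Omega>" for w
  proof (rule discriminant_nonneg_imp)
    fix t
    let ?s = "\<lambda>x. w x + of_real t * v x"
    have tv: "(\<lambda>x. of_real t * v x) \<in> L2 \<Omega>" using v by (rule L2_cmult)
    have "L2_inner \<Omega> ?s ?s = (L2_inner \<Omega> w w + of_real t * L2_inner \<Omega> w v)
        + of_real t * (cnj (L2_inner \<Omega> w v) + of_real t * L2_inner \<Omega> v v)"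
      using w v tv L2_add[OF w tv]
      by (simp add: L2_inner_add L2_inner_add_right L2_inner_cmult L2_inner_cmult_right L2_inner_cnj[of \<Omega> v w] distrib_left)
    then have e: "Re (L2_inner \<Omega> ?s ?s) = (L2_norm \<Omega> w)\<^sup>2 + 2 * t * Re (L2_inner \<Omega> w v) + t\<^sup>2 * (L2_norm \<Omega> v)\<^sup>2"
      unfolding L2_inner_self_norm[of \<Omega> w] L2_inner_self_norm[of \<Omega> v]
      by (simp add: distrib_left power2_eq_square)
    have "0 \<le> Re (L2_inner \<Omega> ?s ?s)" by (simp add: Re_L2_inner_self)
    also note e
    finally show "0 \<le> (L2_norm \<Omega> w)\<^sup>2 + 2 * t * Re (L2_inner \<Omega> w v) + t\<^sup>2 * (L2_norm \<Omega> v)\<^sup>2" .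
  qed simp
  \<comment> \<open>Multiplying \<open>u\<close> by \<open>cnj ?z\<close> turns its inner product
    with \<open>v\<close> into the real number |z|^2. The estimate for real parts is applied to that
    function, and a factor |z|^2 is cancelled.\<close>
  let ?z = "L2_inner \<Omega> u v"
  have un: "(L2_norm \<Omega> (\<lambda>x. cnj ?z * u x))\<^sup>2 = (cmod ?z)\<^sup>2 * (L2_norm \<Omega> u)\<^sup>2"
  proof -
    have "complex_of_real ((L2_norm \<Omega> (\<lambda>x. cnj ?z * u x))\<^sup>2) = cnj ?z * (cnj (cnj ?z) * L2_inner \<Omega> u u)"
      unfolding L2_inner_self_norm[symmetric] L2_inner_cmult L2_inner_cmult_right ..
    also have "\<dots> = (?z * cnj ?z) * L2_inner \<Omega> u u" by (simp add: mult.assoc mult.left_commute)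
    also have "\<dots> = of_real ((cmod ?z)\<^sup>2 * (L2_norm \<Omega> u)\<^sup>2)"
      unfolding complex_norm_square[symmetric] L2_inner_self_norm by simp
    finally have "complex_of_real ((L2_norm \<Omega> (\<lambda>x. cnj ?z * u x))\<^sup>2) = of_real ((cmod ?z)\<^sup>2 * (L2_norm \<Omega> u)\<^sup>2)" .
    then show ?thesis by (simp only: of_real_eq_iff)
  qed
  have "(Re (cnj ?z * ?z))\<^sup>2 \<le> (cmod ?z)\<^sup>2 * (L2_norm \<Omega> u)\<^sup>2 * (L2_norm \<Omega> v)\<^sup>2"
    using *[OF L2_cmult[OF u, of "cnj ?z"]] unfolding un L2_inner_cmult .
  also have "Re (cnj ?z * ?z) = (cmod ?z)\<^sup>2"
    by (metis Re_complex_of_real complex_norm_square mult.commute)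
  finally have "(cmod ?z)\<^sup>2 * (cmod ?z)\<^sup>2 \<le> (cmod ?z)\<^sup>2 * ((L2_norm \<Omega> u) * (L2_norm \<Omega> v))\<^sup>2"
    by (simp add: power_mult_distrib mult.assoc)
  note le = this
  show ?thesis
  proof (cases "cmod ?z = 0")
    case False
    then have "(cmod ?z)\<^sup>2 \<le> (L2_norm \<Omega> u * L2_norm \<Omega> v)\<^sup>2"
      using le by (simp only: mult_le_cancel_left) auto
    then show ?thesis by (rule power2_le_imp_le) simp
  qed simp
qed

text \<open>Taking real parts gives a real space with the same norm. Orthogonality to each element
  of \<open>E\<close> survives limits by Cauchy-Schwarz, so the complement inherits
  completeness.\<close>

lemma semi_hilbert_L2_perp:
  assumes E: "E \<subseteq> L2 \<Omega>"
  shows "semi_hilbert (L2_perp \<Omega> E) (\<lambda>u v. Re (L2_inner \<Omega> u v))"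
proof
  show "subspace (L2_perp \<Omega> E)"
    unfolding subspace_def
  proof (intro conjI ballI allI)
    show "0 \<in> L2_perp \<Omega> E" by (simp add: L2_perp_def zero_fun_def L2_inner_zero)
    show "x + y \<in> L2_perp \<Omega> E" if "x \<in> L2_perp \<Omega> E" "y \<in> L2_perp \<Omega> E" for x y
      using that E by (auto simp: L2_perp_def plus_fun_def L2_inner_add subset_iff)
    show "c *\<^sub>R x \<in> L2_perp \<Omega> E" if "x \<in> L2_perp \<Omega> E" for c x
      using that E by (auto simp: L2_perp_def scaleR_fun_def scaleR_conv_of_real L2_inner_cmult)
  qed
  show "Re (L2_inner \<Omega> (u + v) w) = Re (L2_inner \<Omega> u w) + Re (L2_inner \<Omega> v w)"
    if "u \<in> L2_perp \<Omega> E" "v \<in> L2_perp \<Omega> E" "w \<in> L2_perp \<Omega> E" for u v w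
    using that by (simp add: L2_perp_def plus_fun_def L2_inner_add)
  show "Re (L2_inner \<Omega> (r *\<^sub>R u) w) = r * Re (L2_inner \<Omega> u w)" for r u w
    by (simp add: scaleR_fun_def scaleR_conv_of_real L2_inner_cmult)
  show "Re (L2_inner \<Omega> u v) = Re (L2_inner \<Omega> v u)" for u v
    by (subst L2_inner_cnj) simp
  show "0 \<le> Re (L2_inner \<Omega> u u)" for u by (simp add: Re_L2_inner_self)
next
  fix y :: "nat \<Rightarrow> 'a \<Rightarrow> complex" and q C :: real
  assume y: "\<And>n. y n \<in> L2_perp \<Omega> E" and q: "0 \<le> q" "q < 1"
    and step: "\<And>n. Re (L2_inner \<Omega> (y (Suc n) - y n) (y (Suc n) - y n)) \<le> C * q ^ n"
  have yL: "y n \<in> L2 \<Omega>" for n using y by (simp add: L2_perp_def)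
  obtain l where l: "l \<in> borel_measurable (lebesgue_on \<Omega>)" "integrable (lebesgue_on \<Omega>) (\<lambda>x. (cmod (l x))\<^sup>2)"
    and lim: "(\<lambda>n. LINT x|lebesgue_on \<Omega>. (cmod (y n x - l x))\<^sup>2) \<longlonglongrightarrow> 0"
    using L2_fast_cauchy_limit[of y "lebesgue_on \<Omega>", OF _ _ q _ step[unfolded Re_L2_inner_self fun_diff_def]]
      yL L2_integrable[OF L2_diff[OF yL yL]] by (auto simp: L2_def)
  have lL: "l \<in> L2 \<Omega>" using l by (simp add: L2_def)
  have lim': "(\<lambda>n. L2_norm \<Omega> (\<lambda>x. y n x - l x)) \<longlonglongrightarrow> 0"
    unfolding L2_norm_def using tendsto_real_sqrt[OF lim] by simp
  have "L2_inner \<Omega> l e = 0" if e: "e \<in> E" for e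
  proof -
    have eL: "e \<in> L2 \<Omega>" using e E by auto
    have "(\<lambda>n. L2_norm \<Omega> (\<lambda>x. y n x - l x) * L2_norm \<Omega> e) \<longlonglongrightarrow> 0 * L2_norm \<Omega> e"
      by (intro tendsto_intros lim')
    moreover have "cmod (L2_inner \<Omega> l e) \<le> L2_norm \<Omega> (\<lambda>x. y n x - l x) * L2_norm \<Omega> e" for n
    proof -
      have "L2_inner \<Omega> (\<lambda>x. y n x - l x) e = - L2_inner \<Omega> l e"
        using y[of n] e eL lL by (simp add: L2_perp_def L2_inner_diff)
      then show ?thesis using L2_cauchy_schwarz[OF L2_diff[OF yL lL] eL, of n] by simp
    qed
    ultimately have "cmod (L2_inner \<Omega> l e) \<le> 0 * L2_norm \<Omega> e"
      by (intro LIMSEQ_le_const) auto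
    then show ?thesis by simp
  qed
  then have "l \<in> L2_perp \<Omega> E" using lL by (simp add: L2_perp_def)
  moreover have "(\<lambda>n. Re (L2_inner \<Omega> (y n - l) (y n - l))) \<longlonglongrightarrow> 0"
    unfolding Re_L2_inner_self using lim by (simp add: fun_diff_def)
  ultimately show "\<exists>l\<in>L2_perp \<Omega> E. (\<lambda>n. Re (L2_inner \<Omega> (y n - l) (y n - l))) \<longlonglongrightarrow> 0" by blast
qed

section \<open>Test functions\<close>

text \<open>The functions exp (- 1 / t) / t ^ k, continued by 0. Their span is closed under
  differentiation, so smoothness of the classical flat function reduces to one formula for a first
  derivative.\<close>

definition flat_exp :: "nat \<Rightarrow> real \<Rightarrow> real" where
  "flat_exp k t = (if 0 < t then exp (- (1 / t)) / t ^ k else 0)"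

lemma flat_exp_tendsto_0: "(flat_exp k \<longlongrightarrow> 0) (at 0)"
proof (rule filterlim_split_at)
  show "(flat_exp k \<longlongrightarrow> 0) (at_left 0)"
    by (rule tendsto_eventually) (auto simp: flat_exp_def eventually_at_filter)
  have "(flat_exp k \<longlongrightarrow> 0) (at_right 0) \<longleftrightarrow> ((\<lambda>x. flat_exp k (inverse x)) \<longlongrightarrow> 0) at_top"
    by (simp add: filterlim_at_right_to_top)
  moreover have "((\<lambda>x. flat_exp k (inverse x)) \<longlongrightarrow> 0) at_top"
  proof (rule Lim_transform_eventually[OF tendsto_power_div_exp_0[of k]])
    show "\<forall>\<^sub>F x in at_top. x ^ k / exp x = flat_exp k (inverse x)"
      using eventually_gt_at_top[of 0]
      by eventually_elim (simp add: flat_exp_def exp_minus field_simps)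
  qed
  ultimately show "(flat_exp k \<longlongrightarrow> 0) (at_right 0)" by simp
qed

lemma flat_exp_has_derivative:
  "(flat_exp k has_real_derivative (- real k * flat_exp (Suc k) t + flat_exp (k + 2) t)) (at t)"
proof -
  consider "t > 0" | "t < 0" | "t = 0" by linarith
  then show ?thesis
  proof cases
    case 1
    have "((\<lambda>t. exp (- (1 / t)) / t ^ k) has_real_derivative
        (exp (- (1 / t)) * (1 / t\<^sup>2) * t ^ k - exp (- (1 / t)) * (real k * t ^ (k - 1))) / (t ^ k * t ^ k)) (at t)"
      using 1 by (auto intro!: derivative_eq_intros simp: power2_eq_square)
    also have "(exp (- (1 / t)) * (1 / t\<^sup>2) * t ^ k - exp (- (1 / t)) * (real k * t ^ (k - 1))) / (t ^ k * t ^ k)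
        = - real k * flat_exp (Suc k) t + flat_exp (k + 2) t"
      using 1 by (cases k) (simp_all add: flat_exp_def field_simps power2_eq_square)
    finally show ?thesis
      by (rule has_field_derivative_transform_within_open[of _ _ _ "{0<..}"]) (use 1 in \<open>auto simp: flat_exp_def\<close>)
  next
    case 2
    have "((\<lambda>_. 0) has_real_derivative 0) (at t)" by simp
    then have "(flat_exp k has_real_derivative 0) (at t)"
      by (rule has_field_derivative_transform_within_open[of _ _ _ "{..<0}"]) (use 2 in \<open>auto simp: flat_exp_def\<close>)
    then show ?thesis using 2 by (simp add: flat_exp_def)
  next
    case 3
    \<comment> \<open>At 0 the difference quotient of \<open>flat_exp k\<close> is
      \<open>flat_exp (Suc k)\<close> itself.\<close>
    have "((\<lambda>h. (flat_exp k (0 + h) - flat_exp k 0) / h) \<longlongrightarrow> 0) (at 0)"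
    proof (rule Lim_transform_eventually[OF flat_exp_tendsto_0[of "Suc k"]])
      show "\<forall>\<^sub>F x in at 0. flat_exp (Suc k) x = (flat_exp k (0 + x) - flat_exp k 0) / x"
        by (rule always_eventually) (auto simp: flat_exp_def field_simps)
    qed
    then show ?thesis using 3 by (simp add: DERIV_def flat_exp_def)
  qed
qed

text \<open>A class that contains all directional derivatives of its members, so differentiability
  of every order follows by a single induction. The rule \<open>bump\<close> allows affine arguments
  in one direction, from which boxes can be cut out coordinate by coordinate.\<close>

inductive smooth_alg :: "('a::euclidean_space \<Rightarrow> real) \<Rightarrow> bool" where
  const: "smooth_alg (\<lambda>x. c)"
| bump: "smooth_alg (\<lambda>x. flat_exp k (\<alpha> * (x \<bullet> b) + \<beta>))"
| add: "smooth_alg f \<Longrightarrow> smooth_alg g \<Longrightarrow> smooth_alg (\<lambda>x. f x + g x)"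
| mult: "smooth_alg f \<Longrightarrow> smooth_alg g \<Longrightarrow> smooth_alg (\<lambda>x. f x * g x)"

lemma smooth_alg_derivative:
  assumes "smooth_alg f"
  shows "\<exists>D. (\<forall>x. (f has_derivative D x) (at x)) \<and> (\<forall>v. smooth_alg (\<lambda>x. D x v))"
  using assms
proof induction
  case (const c)
  show ?case by (rule exI[of _ "\<lambda>x v. 0"]) (auto intro: smooth_alg.const)
next
  case (bump k \<alpha> b \<beta>)
  let ?D = "\<lambda>x v. (\<alpha> * (v \<bullet> b)) * (- real k * flat_exp (Suc k) (\<alpha> * (x \<bullet> b) + \<beta>) + flat_exp (k + 2) (\<alpha> * (x \<bullet> b) + \<beta>))"
  have "((\<lambda>x. flat_exp k (\<alpha> * (x \<bullet> b) + \<beta>)) has_derivative ?D x) (at x)" for x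
  proof -
    have 1: "((\<lambda>x. \<alpha> * (x \<bullet> b) + \<beta>) has_derivative (\<lambda>v. \<alpha> * (v \<bullet> b))) (at x)"
      by (auto intro!: derivative_eq_intros)
    have 2: "(flat_exp k has_derivative (\<lambda>h. h * (- real k * flat_exp (Suc k) (\<alpha> * (x \<bullet> b) + \<beta>) + flat_exp (k + 2) (\<alpha> * (x \<bullet> b) + \<beta>))))
        (at (\<alpha> * (x \<bullet> b) + \<beta>))"
      using flat_exp_has_derivative[of k] by (simp add: has_field_derivative_def mult.commute[of "_ + _"] mult_commute_abs)
    show ?thesis using has_derivative_compose[OF 1 2] by simp
  qed
  moreover have "smooth_alg (\<lambda>x. ?D x v)" for v
    by (intro smooth_alg.intros)
  ultimately show ?case by (intro exI[of _ ?D]) blast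
next
  case (add f g)
  then obtain D E where D: "\<And>x. (f has_derivative D x) (at x)" "\<And>v. smooth_alg (\<lambda>x. D x v)"
    and E: "\<And>x. (g has_derivative E x) (at x)" "\<And>v. smooth_alg (\<lambda>x. E x v)" by blast
  show ?case
    by (rule exI[of _ "\<lambda>x v. D x v + E x v"]) (auto intro!: has_derivative_add D E smooth_alg.add)
next
  case (mult f g)
  then obtain D E where D: "\<And>x. (f has_derivative D x) (at x)" "\<And>v. smooth_alg (\<lambda>x. D x v)"
    and E: "\<And>x. (g has_derivative E x) (at x)" "\<And>v. smooth_alg (\<lambda>x. E x v)" by blast
  show ?case
    by (rule exI[of _ "\<lambda>x v. f x * E x v + D x v * g x"])
      (auto intro!: has_derivative_mult D E smooth_alg.add smooth_alg.mult mult.hyps)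
qed

lemma smooth_alg_C_diff: "smooth_alg f \<Longrightarrow> C_diff m f"
proof (induction m arbitrary: f)
  case 0
  then obtain D where "\<And>x. (f has_derivative D x) (at x)" using smooth_alg_derivative by blast
  then show ?case
    by (auto intro!: continuous_at_imp_continuous_on dest: has_derivative_continuous)
next
  case (Suc m)
  then obtain D where D: "\<And>x. (f has_derivative D x) (at x)" "\<And>v. smooth_alg (\<lambda>x. D x v)"
    using smooth_alg_derivative by blast
  have "partial_deriv b f = (\<lambda>x. D x b)" for b
    by (rule ext) (metis partial_deriv_def frechet_derivative_at D(1))
  then show ?case using D Suc.IH by (auto simp: differentiable_def)
qed

lemma smooth_alg_prod:
  assumes "finite I" "\<And>i. i \<in> I \<Longrightarrow> smooth_alg (f i)"
  shows "smooth_alg (\<lambda>x. \<Prod>i\<in>I. f i x)"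
  using assms by (induction I rule: finite_induct) (auto intro: smooth_alg.const smooth_alg.mult)

text \<open>Supported in the box, and tending to 1 inside it as \<open>n\<close> grows, since exp (-
  1 / (n s)) tends to 1 for s > 0. The arguments are written in the affine shape of the rule
  \<open>smooth_alg.bump\<close>.\<close>

definition box_bump :: "'a::euclidean_space \<Rightarrow> 'a \<Rightarrow> nat \<Rightarrow> 'a \<Rightarrow> real" where
  "box_bump a c n x = (\<Prod>b\<in>Basis. flat_exp 0 (real n * (x \<bullet> b) + (- real n * (a \<bullet> b)))
     * flat_exp 0 ((- real n) * (x \<bullet> b) + real n * (c \<bullet> b)))"

lemma smooth_alg_box_bump: "smooth_alg (box_bump a c n)"
  unfolding box_bump_def[abs_def] by (intro smooth_alg_prod smooth_alg.mult smooth_alg.bump) simp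

lemma flat_exp_0_bounds: "0 \<le> flat_exp 0 t" "flat_exp 0 t \<le> 1"
  by (auto simp: flat_exp_def)

lemma box_bump_bounds: "0 \<le> box_bump a c n x" "box_bump a c n x \<le> 1"
  unfolding box_bump_def
  by (intro prod_nonneg prod_le_1 mult_le_one mult_nonneg_nonneg flat_exp_0_bounds conjI)+

lemma box_bump_support: "box_bump a c n x \<noteq> 0 \<Longrightarrow> x \<in> box a c"
  by (force simp: box_bump_def flat_exp_def mem_box split: if_splits simp: mult_less_cancel_left zero_less_mult_iff
     right_diff_distrib[symmetric])

lemma flat_exp_scaled_tendsto:
  assumes "s > 0" shows "(\<lambda>n. flat_exp 0 (real n * s)) \<longlonglongrightarrow> 1"
proof (rule Lim_transform_eventually)
  have "(\<lambda>n. exp (- (1 / real n * (1 / s)))) \<longlonglongrightarrow> exp (- (0 * (1 / s)))"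
    by (intro tendsto_intros lim_1_over_n)
  then show "(\<lambda>n. exp (- (1 / real n * (1 / s)))) \<longlonglongrightarrow> 1" by simp
  show "\<forall>\<^sub>F n in sequentially. exp (- (1 / real n * (1 / s))) = flat_exp 0 (real n * s)"
    using eventually_gt_at_top[of 0] by eventually_elim (use assms in \<open>auto simp: flat_exp_def\<close>)
qed

lemma box_bump_tendsto:
  assumes "x \<in> box a c" shows "(\<lambda>n. box_bump a c n x) \<longlonglongrightarrow> 1"
proof -
  have "(\<lambda>n. \<Prod>b\<in>Basis. flat_exp 0 (real n * (x \<bullet> b - a \<bullet> b)) * flat_exp 0 (real n * (c \<bullet> b - x \<bullet> b)))
     \<longlonglongrightarrow> (\<Prod>b\<in>(Basis::'a set). 1 * 1)"
    using assms by (intro tendsto_prod tendsto_mult flat_exp_scaled_tendsto) (auto simp: mem_box)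
  then show ?thesis by (simp add: box_bump_def algebra_simps)
qed

lemma smooth_alg_test_function:
  fixes \<phi> :: "'a::euclidean_space \<Rightarrow> real"
  assumes "smooth_alg \<phi>" "{x. \<phi> x \<noteq> 0} \<subseteq> K" "compact K" "K \<subseteq> U"
  shows "test_function U \<phi>"
proof -
  have "closure {x. \<phi> x \<noteq> 0} \<subseteq> K" using assms by (intro closure_minimal compact_imp_closed)
  then show ?thesis
    unfolding test_function_def using assms smooth_alg_C_diff bounded_subset[OF compact_imp_bounded[OF assms(3)] assms(2)] by auto
qed

text \<open>Countably many boxes with closure in \<open>U\<close> cover \<open>U\<close>. One minus
  the product of the complements of the first \<open>n\<close> bumps is a smooth substitute for
  their maximum; it involves finitely many boxes, so its support is compact in
  \<open>U\<close>.\<close>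

lemma open_bump_sequence:
  fixes U :: "'a::euclidean_space set"
  assumes "open U"
  obtains \<psi> :: "nat \<Rightarrow> 'a \<Rightarrow> real" where "\<And>n. test_function U (\<psi> n)"
    "\<And>n x. 0 \<le> \<psi> n x" "\<And>n x. \<psi> n x \<le> 1" "\<And>x. (\<lambda>n. \<psi> n x) \<longlonglongrightarrow> indicator U x"
proof -
  define F where "F = {box a c | a c. cbox a c \<subseteq> U}"
  have "\<Union>F = U"
  proof
    show "\<Union>F \<subseteq> U" using box_subset_cbox by (fastforce simp: F_def)
    show "U \<subseteq> \<Union>F"
    proof
      fix x assume "x \<in> U"
      then obtain a c where "cbox a c \<subseteq> U" "x \<in> box a c" using open_contains_cbox[OF assms] by metis
      then show "x \<in> \<Union>F" by (auto simp: F_def)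
    qed
  qed
  moreover obtain F' where F': "F' \<subseteq> F" "countable F'" "\<Union>F' = \<Union>F"
    using Lindelof[of F] by (auto simp: F_def open_box)
  ultimately have UF: "\<Union>F' = U" by simp
  \<comment> \<open>Inserting {} keeps the family nonempty, as \<open>from_nat_into\<close>
    requires, even when \<open>U\<close> is empty.\<close>
  define F'' where "F'' = insert {} F'"
  have F'': "countable F''" "F'' \<noteq> {}" "\<Union>F'' = U" using F' UF by (auto simp: F''_def)
  have "\<exists>a c. X = box a c \<and> cbox a c \<subseteq> U" if "X \<in> F''" for X
  proof (cases "X = {}")
    case True
    \<comment> \<open>The empty set must also be given as a box: in direction \<open>i\<close> the
      lower corner \<open>i\<close> exceeds the upper corner 0.\<close>
    obtain i :: 'a where i: "i \<in> Basis" using nonempty_Basis by blast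
    have "cbox i 0 = {}" "box i 0 = {}" using i by (auto simp: box_eq_empty intro!: bexI[of _ i])
    then show ?thesis using True by (metis empty_subsetI)
  next
    case False
    then show ?thesis using that F' by (auto simp: F''_def F_def)
  qed
  then obtain a c where ac: "\<And>X. X \<in> F'' \<Longrightarrow> X = box (a X) (c X) \<and> cbox (a X) (c X) \<subseteq> U" by metis
  define X where "X = from_nat_into F''"
  have X: "X i \<in> F''" for i unfolding X_def by (rule from_nat_into[OF F''(2)])
  have Xr: "range X = F''" unfolding X_def by (rule range_from_nat_into[OF F''(2,1)])
  define \<psi> where "\<psi> n x = 1 + (- 1) * (\<Prod>i<n. 1 + (- 1) * box_bump (a (X i)) (c (X i)) n x)" for n x
  have fac: "0 \<le> 1 + (- 1) * box_bump (a (X i)) (c (X i)) n x" "1 + (- 1) * box_bump (a (X i)) (c (X i)) n x \<le> 1" for i n x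
    using box_bump_bounds[of "a (X i)" "c (X i)" n x] by auto
  have supp: "{x. \<psi> n x \<noteq> 0} \<subseteq> (\<Union>i<n. cbox (a (X i)) (c (X i)))" for n
  proof
    fix x assume "x \<in> {x. \<psi> n x \<noteq> 0}"
    then have "\<exists>i<n. box_bump (a (X i)) (c (X i)) n x \<noteq> 0"
      by (rule contrapos_pp) (auto simp: \<psi>_def)
    then obtain i where i: "i < n" "box_bump (a (X i)) (c (X i)) n x \<noteq> 0" by auto
    then have "x \<in> cbox (a (X i)) (c (X i))"
      using box_bump_support[OF i(2)] box_subset_cbox[of "a (X i)" "c (X i)"] by (auto simp: mem_box less_imp_le)
    then show "x \<in> (\<Union>i<n. cbox (a (X i)) (c (X i)))" using i(1) by auto
  qed
  show ?thesis
  proof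
    show "test_function U (\<psi> n)" for n
    proof (rule smooth_alg_test_function[OF _ supp])
      show "smooth_alg (\<psi> n)" unfolding \<psi>_def[abs_def]
        by (rule smooth_alg.add[OF smooth_alg.const smooth_alg.mult[OF smooth_alg.const smooth_alg_prod]])
          (simp, rule smooth_alg.add[OF smooth_alg.const smooth_alg.mult[OF smooth_alg.const smooth_alg_box_bump]])
      show "(\<Union>i<n. cbox (a (X i)) (c (X i))) \<subseteq> U" using ac[OF X] by blast
    qed (intro compact_UN, auto)
    show "0 \<le> \<psi> n x" "\<psi> n x \<le> 1" for n x
      using prod_nonneg[of "{..<n}" "\<lambda>i. 1 + (- 1) * box_bump (a (X i)) (c (X i)) n x"]
        prod_le_1[of "{..<n}" "\<lambda>i. 1 + (- 1) * box_bump (a (X i)) (c (X i)) n x"] fac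
      unfolding \<psi>_def by auto
    show "(\<lambda>n. \<psi> n x) \<longlonglongrightarrow> indicator U x" for x
    proof (cases "x \<in> U")
      case False
      have "\<psi> n x = 0" for n
        using supp[of n] ac[OF X] False by blast
      then show ?thesis using False by simp
    next
      case True
      then obtain j where j: "x \<in> X j" using F''(3) Xr by (metis UnionE imageE)
      have lim: "(\<lambda>n. \<Prod>i<n. 1 + (- 1) * box_bump (a (X i)) (c (X i)) n x) \<longlonglongrightarrow> 0"
      proof (rule tendsto_sandwich[of "\<lambda>_. 0" _ _ "\<lambda>n. 1 - box_bump (a (X j)) (c (X j)) n x"])
        show "\<forall>\<^sub>F n in sequentially. 0 \<le> (\<Prod>i<n. 1 + (- 1) * box_bump (a (X i)) (c (X i)) n x)"
          using fac by (intro always_eventually allI prod_nonneg) auto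
        have "(\<lambda>n. 1 - box_bump (a (X j)) (c (X j)) n x) \<longlonglongrightarrow> 1 - 1"
          using ac[OF X, of j] j by (intro tendsto_intros box_bump_tendsto) auto
        then show "(\<lambda>n. 1 - box_bump (a (X j)) (c (X j)) n x) \<longlonglongrightarrow> 0" by simp
        show "\<forall>\<^sub>F n in sequentially. (\<Prod>i<n. 1 + (- 1) * box_bump (a (X i)) (c (X i)) n x) \<le> 1 - box_bump (a (X j)) (c (X j)) n x"
          using eventually_gt_at_top[of j]
        proof eventually_elim
          case (elim n)
          let ?f = "\<lambda>i. 1 + (- 1) * box_bump (a (X i)) (c (X i)) n x"
          have "(\<Prod>i<n. ?f i) = ?f j * (\<Prod>i\<in>{..<n} - {j}. ?f i)"
            using elim by (intro prod.remove) auto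
          also have "\<dots> \<le> ?f j * 1" using fac by (intro mult_left_mono prod_le_1 conjI) auto
          finally show ?case by simp
        qed
      qed auto
      have "(\<lambda>n. \<psi> n x) \<longlonglongrightarrow> 1 + (- 1) * 0" unfolding \<psi>_def by (intro tendsto_intros lim)
      then show ?thesis using True by simp
    qed
  qed
qed

lemma test_function_continuous: "test_function U \<phi> \<Longrightarrow> continuous_on UNIV \<phi>"
  unfolding test_function_def by (metis C_diff.simps(1))

lemma test_function_mono: "test_function U \<phi> \<Longrightarrow> U \<subseteq> V \<Longrightarrow> test_function V \<phi>"
  by (auto simp: test_function_def)

lemma test_function_measurable [measurable_dest]: "test_function U \<phi> \<Longrightarrow> \<phi> \<in> borel_measurable borel"
  by (intro borel_measurable_continuous_onI test_function_continuous)

lemma borel_measurable_lebesgue_onI: "f \<in> borel_measurable borel \<Longrightarrow> f \<in> borel_measurable (lebesgue_on S)"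
  by (intro measurable_restrict_space1 measurable_completion) simp

text \<open>With |g| as dominating function, bump sequences give vanishing integrals over open
  subsets of \<Omega>, and finite intersections of open sets carry this to G_delta sets. Every
  measurable set is a G_delta set up to a null set, so \<open>g\<close> has integral zero over every
  measurable set.\<close>

theorem fundamental_lemma_of_variations:
  fixes g :: "'a::euclidean_space \<Rightarrow> complex"
  assumes "open \<Omega>" "bounded \<Omega>" and int: "integrable (lebesgue_on \<Omega>) g"
    and test: "\<And>\<phi>. test_function \<Omega> \<phi> \<Longrightarrow> (LINT x|lebesgue_on \<Omega>. \<phi> x *\<^sub>R g x) = 0"
  shows "AE x in lebesgue_on \<Omega>. g x = 0"
proof (rule sigma_finite_measure.density_zero[OF _ int])
  show "sigma_finite_measure (lebesgue_on \<Omega>)"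
    using finite_measure_lebesgue_on[OF lmeasurable_open[OF assms(2,1)]] by (rule finite_measure.axioms)
  note [measurable] = borel_measurable_integrable[OF int]
  have open_zero: "set_lebesgue_integral (lebesgue_on \<Omega>) U g = 0" if U: "open U" "U \<subseteq> \<Omega>" for U
  proof -
    obtain \<psi> where \<psi>: "\<And>n. test_function U (\<psi> n)" "\<And>n x. 0 \<le> \<psi> n x" "\<And>n x. \<psi> n x \<le> 1"
      "\<And>x. (\<lambda>n. \<psi> n x) \<longlonglongrightarrow> indicator U x" using open_bump_sequence[OF U(1)] by metis
    have [measurable]: "\<psi> n \<in> borel_measurable (lebesgue_on \<Omega>)" for n
      using test_function_measurable[OF \<psi>(1)] by (rule borel_measurable_lebesgue_onI)
    have [measurable]: "(indicator U :: 'a \<Rightarrow> real) \<in> borel_measurable (lebesgue_on \<Omega>)"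
      using U by (intro borel_measurable_lebesgue_onI) simp
    have "(\<lambda>n. LINT x|lebesgue_on \<Omega>. \<psi> n x *\<^sub>R g x) \<longlonglongrightarrow> (LINT x|lebesgue_on \<Omega>. indicator U x *\<^sub>R g x)"
    proof (rule integral_dominated_convergence[where w = "\<lambda>x. norm (g x)"])
      show "AE x in lebesgue_on \<Omega>. (\<lambda>n. \<psi> n x *\<^sub>R g x) \<longlonglongrightarrow> indicator U x *\<^sub>R g x"
        using \<psi>(4) by (intro AE_I2 tendsto_intros)
      show "AE x in lebesgue_on \<Omega>. norm (\<psi> n x *\<^sub>R g x) \<le> norm (g x)" for n
        using \<psi>(2,3) by (intro AE_I2) (simp add: mult_left_le_one_le)
      show "integrable (lebesgue_on \<Omega>) (\<lambda>x. norm (g x))" using int by simp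
    qed measurable
    moreover have "(LINT x|lebesgue_on \<Omega>. \<psi> n x *\<^sub>R g x) = 0" for n
      using test[OF test_function_mono[OF \<psi>(1) U(2)]] .
    ultimately show ?thesis unfolding set_lebesgue_integral_def by (simp add: LIMSEQ_const_iff)
  qed
  fix A assume "A \<in> sets (lebesgue_on \<Omega>)"
  moreover have "\<Omega> \<in> sets lebesgue" using assms(1) by (simp add: borel_open)
  ultimately have A: "A \<in> sets lebesgue" "A \<subseteq> \<Omega>" by (auto simp: sets_restrict_space_iff)
  obtain D N where D: "gdelta D" and N: "N \<in> null_sets lebesgue" and AN: "A \<union> N = D" "disjnt A N"
    using lebesgue_set_almost_gdelta[OF A(1)] by metis
  obtain F :: "nat \<Rightarrow> 'a set" where F: "\<And>n. open (F n)" "D = (\<Inter>n. F n)"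
    using D by (auto elim!: gdelta.cases)
  define U where "U n = \<Omega> \<inter> (\<Inter>i\<le>n. F i)" for n
  have U: "open (U n)" "U n \<subseteq> \<Omega>" for n using F assms(1) by (auto simp: U_def intro!: open_Int open_INT)
  have lim: "(\<lambda>n. indicat_real (U n) x) \<longlonglongrightarrow> indicat_real (\<Omega> \<inter> D) x" for x
  proof (cases "x \<in> \<Omega> \<inter> D")
    case True
    then show ?thesis using F by (auto simp: U_def)
  next
    case False
    then obtain k where "x \<notin> \<Omega> \<or> x \<notin> F k" using F by auto
    then have "\<forall>n\<ge>k. indicat_real (U n) x = 0" by (auto simp: U_def indicator_def)
    then have "\<forall>\<^sub>F n in sequentially. indicat_real (U n) x = indicat_real (\<Omega> \<inter> D) x"
      using False unfolding eventually_sequentially by (auto simp: indicator_def)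
    then show ?thesis by (rule tendsto_eventually)
  qed
  have mU [measurable]: "indicat_real (U n) \<in> borel_measurable (lebesgue_on \<Omega>)" for n
    using U by (intro borel_measurable_lebesgue_onI) simp
  have [measurable]: "indicat_real (\<Omega> \<inter> D) \<in> borel_measurable (lebesgue_on \<Omega>)"
    using lim mU by (rule borel_measurable_LIMSEQ_real)
  have "(\<lambda>n. LINT x|lebesgue_on \<Omega>. indicator (U n) x *\<^sub>R g x) \<longlonglongrightarrow> (LINT x|lebesgue_on \<Omega>. indicator (\<Omega> \<inter> D) x *\<^sub>R g x)"
  proof (rule integral_dominated_convergence[where w = "\<lambda>x. norm (g x)"])
    show "AE x in lebesgue_on \<Omega>. (\<lambda>n. indicator (U n) x *\<^sub>R g x) \<longlonglongrightarrow> indicator (\<Omega> \<inter> D) x *\<^sub>R g x"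
      using lim by (intro AE_I2 tendsto_intros)
    show "AE x in lebesgue_on \<Omega>. norm (indicator (U n) x *\<^sub>R g x) \<le> norm (g x)" for n
      by (intro AE_I2) (simp add: indicator_def)
    show "integrable (lebesgue_on \<Omega>) (\<lambda>x. norm (g x))" using int by simp
  qed measurable
  then have z: "(LINT x|lebesgue_on \<Omega>. indicator (\<Omega> \<inter> D) x *\<^sub>R g x) = 0"
    using open_zero[OF U] by (simp add: set_lebesgue_integral_def LIMSEQ_const_iff)
  have "AE x in lebesgue. x \<notin> N" using N by (rule AE_not_in)
  then have "AE x in lebesgue_on \<Omega>. x \<notin> N"
    using assms(1) by (subst AE_restrict_space_iff) (auto simp: borel_open)
  moreover have "AE x in lebesgue_on \<Omega>. x \<in> \<Omega>" by (intro AE_I2) simp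
  ultimately have ae: "AE x in lebesgue_on \<Omega>. indicator A x *\<^sub>R g x = indicator (\<Omega> \<inter> D) x *\<^sub>R g x"
    by eventually_elim (use AN A in \<open>auto simp: indicator_def\<close>)
  have [measurable]: "indicat_real A \<in> borel_measurable (lebesgue_on \<Omega>)"
    using \<open>A \<in> sets (lebesgue_on \<Omega>)\<close> by simp
  have "set_lebesgue_integral (lebesgue_on \<Omega>) A g = (LINT x|lebesgue_on \<Omega>. indicator (\<Omega> \<inter> D) x *\<^sub>R g x)"
    unfolding set_lebesgue_integral_def by (rule integral_cong_AE[OF _ _ ae]) measurable
  then show "set_lebesgue_integral (lebesgue_on \<Omega>) A g = 0" using z by simp
qed

section \<open>Weak derivatives and plane waves\<close>

lemma lborel_translation:
  fixes f :: "'a::euclidean_space \<Rightarrow> 'b::{banach, second_countable_topology}"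
  assumes "f \<in> borel_measurable borel"
  shows "(LINT x|lborel. f (c + x)) = (LINT x|lborel. f x)"
    and "integrable lborel f \<Longrightarrow> integrable lborel (\<lambda>x. f (c + x))"
proof -
  have "(LINT x|lborel. f x) = (LINT x|distr lborel borel ((+) c). f x)" by (simp only: lborel_distr_plus)
  also have "\<dots> = (LINT x|lborel. f (c + x))" using assms by (intro integral_distr) auto
  finally show "(LINT x|lborel. f (c + x)) = (LINT x|lborel. f x)" by simp
  assume "integrable lborel f"
  then have "integrable (distr lborel borel ((+) c)) f" by (simp only: lborel_distr_plus)
  then show "integrable lborel (\<lambda>x. f (c + x))" using assms by (subst (asm) integrable_distr_eq) auto
qed

definition wave :: "'a::euclidean_space \<Rightarrow> 'a \<Rightarrow> complex" where
  "wave y x = cis (y \<bullet> x)"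

lemma wave_continuous: "continuous_on UNIV (wave y)"
  unfolding wave_def[abs_def] cis_conv_exp by (intro continuous_intros)

lemma cmod_wave [simp]: "cmod (wave y x) = 1"
  by (simp add: wave_def)

locale bounded_open =
  fixes \<Omega> :: "'a::euclidean_space set"
  assumes op: "open \<Omega>" and bd: "bounded \<Omega>"
begin

abbreviation M where "M \<equiv> lebesgue_on \<Omega>"

lemma lmeasurable: "\<Omega> \<in> lmeasurable"
  using bd op by (rule lmeasurable_open)

lemma sets_\<Omega> [simp]: "\<Omega> \<in> sets lebesgue"
  using lmeasurable by (rule fmeasurableD)

lemma integrable_const [simp]: "integrable M (\<lambda>x. c :: 'b::{banach, second_countable_topology})"
  using finite_measure_lebesgue_on[OF lmeasurable] by (rule finite_measure.integrable_const)

lemma measure_M [simp]: "measure M \<Omega> = measure lebesgue \<Omega>"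
  by (simp add: measure_restrict_space)

lemma integrable_M_bounded_mult:
  fixes f :: "'a \<Rightarrow> real" and u :: "'a \<Rightarrow> complex"
  assumes "integrable M u" "f \<in> borel_measurable M" "\<And>x. \<bar>f x\<bar> \<le> B"
  shows "integrable M (\<lambda>x. f x *\<^sub>R u x)"
proof (rule Bochner_Integration.integrable_bound)
  show "integrable M (\<lambda>x. B *\<^sub>R u x)" using assms(1) by simp
  show "AE x in M. norm (f x *\<^sub>R u x) \<le> norm (B *\<^sub>R u x)"
    using order_trans[OF assms(3) abs_ge_self] by (intro AE_I2) (simp add: mult_right_mono)
  show "(\<lambda>x. f x *\<^sub>R u x) \<in> borel_measurable M"
    using assms by (intro borel_measurable_scaleR) auto
qed

lemma L2_bounded:
  assumes "u \<in> borel_measurable M" "\<And>x. cmod (u x) \<le> B"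
  shows "u \<in> L2 \<Omega>"
  unfolding L2_def
proof (intro CollectI conjI assms(1))
  show "integrable M (\<lambda>x. (cmod (u x))\<^sup>2)"
  proof (rule Bochner_Integration.integrable_bound)
    show "integrable M (\<lambda>x. B\<^sup>2)" by simp
    show "AE x in M. norm ((cmod (u x))\<^sup>2) \<le> norm (B\<^sup>2)"
      using assms(2) by (intro AE_I2) (simp add: power_mono)
    show "(\<lambda>x. (cmod (u x))\<^sup>2) \<in> borel_measurable M" using assms(1) by measurable
  qed
qed

lemma L2_integrable_self:
  assumes "u \<in> L2 \<Omega>" shows "integrable M u"
  using L2_prod_integrable[OF assms L2_bounded[of "\<lambda>_. 1" 1]] by simp

lemma test_function_differentiable: fixes \<phi> :: "'a \<Rightarrow> real" shows "test_function U \<phi> \<Longrightarrow> \<phi> differentiable (at x)"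
  unfolding test_function_def by (metis C_diff.simps(2))

lemma test_function_partial_continuous:
  fixes \<phi> :: "'a \<Rightarrow> real" shows "test_function U \<phi> \<Longrightarrow> b \<in> Basis \<Longrightarrow> continuous_on UNIV (partial_deriv b \<phi>)"
  unfolding test_function_def by (metis C_diff.simps)

lemma partial_deriv_support:
  fixes \<phi> :: "'a \<Rightarrow> real"
  assumes "x \<notin> closure {x. \<phi> x \<noteq> 0}"
  shows "partial_deriv b \<phi> x = 0"
proof -
  have "((\<lambda>_. 0) has_derivative (\<lambda>_. 0)) (at x)" by simp
  then have "(\<phi> has_derivative (\<lambda>_. 0)) (at x)"
  proof (rule has_derivative_transform_within_open[of _ _ _ _ "- closure {x. \<phi> x \<noteq> 0}"])
    show "0 = \<phi> y" if "y \<in> - closure {x. \<phi> x \<noteq> 0}" for y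
      using that closure_subset[of "{x. \<phi> x \<noteq> 0}"] by auto
  qed (use assms in auto)
  from frechet_derivative_at[OF this] show ?thesis by (simp add: partial_deriv_def fun_eq_iff)
qed

lemma compact_support_bounded:
  fixes f :: "'a \<Rightarrow> real"
  assumes "continuous_on UNIV f" "compact K" "\<And>x. x \<notin> K \<Longrightarrow> f x = 0"
  shows "\<exists>B\<ge>0. \<forall>x. \<bar>f x\<bar> \<le> B"
proof -
  have "compact (f ` K)" using assms by (intro compact_continuous_image) (auto intro: continuous_on_subset)
  then obtain B where "\<And>y. y \<in> f ` K \<Longrightarrow> norm y \<le> B" "B > 0" by (metis compact_imp_bounded bounded_pos)
  then have "\<bar>f x\<bar> \<le> B" for x using assms(3)[of x] by (cases "x \<in> K") auto
  then show ?thesis using \<open>B > 0\<close> by (intro exI[of _ B]) simp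
qed

lemma test_function_bounded:
  fixes \<phi> :: "'a \<Rightarrow> real"
  assumes "test_function U \<phi>" shows "\<exists>B\<ge>0. \<forall>x. \<bar>\<phi> x\<bar> \<le> B"
proof (rule compact_support_bounded[OF test_function_continuous[OF assms]])
  show "compact (closure {x. \<phi> x \<noteq> 0})" using assms by (simp add: test_function_def)
  show "\<phi> x = 0" if "x \<notin> closure {x. \<phi> x \<noteq> 0}" for x using that closure_subset[of "{x. \<phi> x \<noteq> 0}"] by auto
qed

lemma test_function_partial_bounded:
  fixes \<phi> :: "'a \<Rightarrow> real"
  assumes "test_function U \<phi>" "b \<in> Basis" shows "\<exists>B\<ge>0. \<forall>x. \<bar>partial_deriv b \<phi> x\<bar> \<le> B"
proof (rule compact_support_bounded[OF test_function_partial_continuous[OF assms]])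
  show "compact (closure {x. \<phi> x \<noteq> 0})" using assms by (simp add: test_function_def)
  show "partial_deriv b \<phi> x = 0" if "x \<notin> closure {x. \<phi> x \<noteq> 0}" for x
    using that by (rule partial_deriv_support)
qed

lemma test_integrable:
  fixes \<phi> :: "'a \<Rightarrow> real" and u :: "'a \<Rightarrow> complex"
  assumes "test_function U \<phi>" "integrable M u" shows "integrable M (\<lambda>x. \<phi> x *\<^sub>R u x)"
proof -
  obtain B where "\<And>x. \<bar>\<phi> x\<bar> \<le> B" using test_function_bounded[OF assms(1)] by metis
  then show ?thesis
    by (intro integrable_M_bounded_mult[OF assms(2)] borel_measurable_lebesgue_onI test_function_measurable[OF assms(1)])
qed

lemma test_partial_integrable:
  fixes \<phi> :: "'a \<Rightarrow> real" and u :: "'a \<Rightarrow> complex"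
  assumes "test_function U \<phi>" "b \<in> Basis" "integrable M u"
  shows "integrable M (\<lambda>x. partial_deriv b \<phi> x *\<^sub>R u x)"
proof -
  obtain B where "\<And>x. \<bar>partial_deriv b \<phi> x\<bar> \<le> B" using test_function_partial_bounded[OF assms(1,2)] by metis
  then show ?thesis
    by (intro integrable_M_bounded_mult[OF assms(3)] borel_measurable_lebesgue_onI borel_measurable_continuous_onI
      test_function_partial_continuous[OF assms(1,2)])
qed

text \<open>This gives the choice in \<open>weak_partial\<close> a meaning: the chosen function is
  determined almost everywhere, and inner products do not see the difference.\<close>

lemma weak_partial_deriv_unique:
  assumes "weak_partial_deriv \<Omega> b u g" "weak_partial_deriv \<Omega> b u h" "g \<in> L2 \<Omega>" "h \<in> L2 \<Omega>"
  shows "AE x in M. g x = h x"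
proof -
  note gi = L2_integrable_self[OF assms(3)] and hi = L2_integrable_self[OF assms(4)]
  have "AE x in M. g x - h x = 0"
  proof (rule fundamental_lemma_of_variations[OF op bd])
    show "integrable M (\<lambda>x. g x - h x)" using gi hi by simp
    show "(LINT x|M. \<phi> x *\<^sub>R (g x - h x)) = 0" if "test_function \<Omega> \<phi>" for \<phi>
      using assms(1,2) that test_integrable[OF that gi] test_integrable[OF that hi]
      by (simp add: weak_partial_deriv_def scaleR_diff_right)
  qed
  then show ?thesis by simp
qed

lemma weak_partial_deriv_add:
  assumes "weak_partial_deriv \<Omega> b u g" "weak_partial_deriv \<Omega> b v h" "b \<in> Basis"
    "u \<in> L2 \<Omega>" "v \<in> L2 \<Omega>" "g \<in> L2 \<Omega>" "h \<in> L2 \<Omega>"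
  shows "weak_partial_deriv \<Omega> b (\<lambda>x. u x + v x) (\<lambda>x. g x + h x)"
  using assms unfolding weak_partial_deriv_def
  by (auto simp: scaleR_add_right test_integrable test_partial_integrable L2_integrable_self)

lemma weak_partial_deriv_cmult:
  assumes "weak_partial_deriv \<Omega> b u g"
  shows "weak_partial_deriv \<Omega> b (\<lambda>x. c * u x) (\<lambda>x. c * g x)"
  unfolding weak_partial_deriv_def
proof (intro allI impI)
  fix \<phi> :: "'a \<Rightarrow> real" assume "test_function \<Omega> \<phi>"
  then have "(LINT x|M. partial_deriv b \<phi> x *\<^sub>R u x) = - (LINT x|M. \<phi> x *\<^sub>R g x)"
    using assms by (simp add: weak_partial_deriv_def)
  moreover have "(LINT x|M. f x *\<^sub>R (c * v x)) = c * (LINT x|M. f x *\<^sub>R v x)" for f :: "'a \<Rightarrow> real" and v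
    by (simp only: mult_scaleR_right[symmetric] integral_mult_right_zero)
  ultimately show "(LINT x|M. partial_deriv b \<phi> x *\<^sub>R (c * u x)) = - (LINT x|M. \<phi> x *\<^sub>R (c * g x))"
    by simp
qed

section \<open>The space H^1 and sesquilinearity of the Dirichlet form\<close>

lemma H1_L2: "u \<in> H1 \<Omega> \<Longrightarrow> u \<in> L2 \<Omega>"
  by (simp add: H1_def)

lemma weak_partial:
  assumes "u \<in> H1 \<Omega>" "b \<in> Basis"
  shows "weak_partial \<Omega> b u \<in> L2 \<Omega>" "weak_partial_deriv \<Omega> b u (weak_partial \<Omega> b u)"
proof -
  have "\<exists>g. g \<in> L2 \<Omega> \<and> weak_partial_deriv \<Omega> b u g" using assms by (auto simp: H1_def)
  from someI_ex[OF this] show "weak_partial \<Omega> b u \<in> L2 \<Omega>" "weak_partial_deriv \<Omega> b u (weak_partial \<Omega> b u)"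
    unfolding weak_partial_def by auto
qed

text \<open>The route for computing with \<open>weak_partial\<close>: exhibit some weak derivative
  in L^2, and the chosen one agrees with it almost everywhere.\<close>

lemma weak_partial_AE_eq:
  assumes "u \<in> L2 \<Omega>" "b \<in> Basis" "weak_partial_deriv \<Omega> b u g" "g \<in> L2 \<Omega>"
  shows "weak_partial \<Omega> b u \<in> L2 \<Omega>" "AE x in M. weak_partial \<Omega> b u x = g x"
proof -
  have "\<exists>g. g \<in> L2 \<Omega> \<and> weak_partial_deriv \<Omega> b u g" using assms by auto
  from someI_ex[OF this] show "weak_partial \<Omega> b u \<in> L2 \<Omega>" "AE x in M. weak_partial \<Omega> b u x = g x"
    unfolding weak_partial_def using weak_partial_deriv_unique[OF _ assms(3) _ assms(4)] by auto
qed

lemma H1_add: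
  assumes u: "u \<in> H1 \<Omega>" and v: "v \<in> H1 \<Omega>" shows "(\<lambda>x. u x + v x) \<in> H1 \<Omega>"
  unfolding H1_def
proof (intro CollectI conjI ballI)
  show "(\<lambda>x. u x + v x) \<in> L2 \<Omega>" using assms by (intro L2_add H1_L2)
  fix b :: 'a assume b: "b \<in> Basis"
  show "\<exists>g\<in>L2 \<Omega>. weak_partial_deriv \<Omega> b (\<lambda>x. u x + v x) g"
    using weak_partial_deriv_add[OF weak_partial(2)[OF u b] weak_partial(2)[OF v b] b H1_L2[OF u] H1_L2[OF v]
      weak_partial(1)[OF u b] weak_partial(1)[OF v b]] L2_add[OF weak_partial(1)[OF u b] weak_partial(1)[OF v b]]
    by (rule bexI)
qed

lemma H1_cmult:
  assumes u: "u \<in> H1 \<Omega>" shows "(\<lambda>x. c * u x) \<in> H1 \<Omega>"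
  unfolding H1_def
proof (intro CollectI conjI ballI)
  show "(\<lambda>x. c * u x) \<in> L2 \<Omega>" using assms by (intro L2_cmult H1_L2)
  fix b :: 'a assume b: "b \<in> Basis"
  show "\<exists>g\<in>L2 \<Omega>. weak_partial_deriv \<Omega> b (\<lambda>x. c * u x) g"
    using weak_partial_deriv_cmult[OF weak_partial(2)[OF u b]] L2_cmult[OF weak_partial(1)[OF u b]]
    by (rule bexI)
qed

lemma H1_diff: "u \<in> H1 \<Omega> \<Longrightarrow> v \<in> H1 \<Omega> \<Longrightarrow> (\<lambda>x. u x - v x) \<in> H1 \<Omega>"
  using H1_add[of u "\<lambda>x. (- 1) * v x"] H1_cmult[of v "- 1"] by simp

lemma H1_zero: "(\<lambda>x. 0) \<in> H1 \<Omega>"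
proof -
  have "weak_partial_deriv \<Omega> b (\<lambda>x. 0) (\<lambda>x. 0)" for b by (simp add: weak_partial_deriv_def)
  then have "\<exists>g\<in>L2 \<Omega>. weak_partial_deriv \<Omega> b (\<lambda>x. 0) g" for b by (intro bexI[of _ "\<lambda>x. 0"] L2_zero)
  then show ?thesis by (simp add: H1_def)
qed

lemma H1_sum: "(\<And>i. i \<in> I \<Longrightarrow> f i \<in> H1 \<Omega>) \<Longrightarrow> (\<lambda>x. \<Sum>i\<in>I. f i x) \<in> H1 \<Omega>"
  by (induction I rule: infinite_finite_induct) (auto simp: H1_zero intro: H1_add)

lemma weak_partial_add:
  assumes "u \<in> H1 \<Omega>" "v \<in> H1 \<Omega>" "b \<in> Basis"
  shows "AE x in M. weak_partial \<Omega> b (\<lambda>x. u x + v x) x = weak_partial \<Omega> b u x + weak_partial \<Omega> b v x"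
  using weak_partial_AE_eq(2)[OF L2_add[OF H1_L2[OF assms(1)] H1_L2[OF assms(2)]] assms(3)
      weak_partial_deriv_add[OF weak_partial(2)[OF assms(1,3)] weak_partial(2)[OF assms(2,3)] assms(3)
        H1_L2[OF assms(1)] H1_L2[OF assms(2)] weak_partial(1)[OF assms(1,3)] weak_partial(1)[OF assms(2,3)]]
      L2_add[OF weak_partial(1)[OF assms(1,3)] weak_partial(1)[OF assms(2,3)]]] .

lemma weak_partial_cmult:
  assumes "u \<in> H1 \<Omega>" "b \<in> Basis"
  shows "AE x in M. weak_partial \<Omega> b (\<lambda>x. c * u x) x = c * weak_partial \<Omega> b u x"
  using weak_partial_AE_eq(2)[OF L2_cmult[OF H1_L2[OF assms(1)]] assms(2)
      weak_partial_deriv_cmult[OF weak_partial(2)[OF assms]] L2_cmult[OF weak_partial(1)[OF assms]]] .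

lemma form_add:
  assumes "u \<in> H1 \<Omega>" "v \<in> H1 \<Omega>" "w \<in> H1 \<Omega>"
  shows "dirichlet_form \<Omega> (\<lambda>x. u x + v x) w = dirichlet_form \<Omega> u w + dirichlet_form \<Omega> v w"
  unfolding dirichlet_form_def sum.distrib[symmetric]
proof (rule sum.cong[OF refl])
  fix b :: 'a assume b: "b \<in> Basis"
  have "L2_inner \<Omega> (weak_partial \<Omega> b (\<lambda>x. u x + v x)) (weak_partial \<Omega> b w)
      = L2_inner \<Omega> (\<lambda>x. weak_partial \<Omega> b u x + weak_partial \<Omega> b v x) (weak_partial \<Omega> b w)"
    using assms b by (intro L2_inner_AE_cong weak_partial_add L2_add weak_partial H1_add) auto
  then show "L2_inner \<Omega> (weak_partial \<Omega> b (\<lambda>x. u x + v x)) (weak_partial \<Omega> b w)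
      = L2_inner \<Omega> (weak_partial \<Omega> b u) (weak_partial \<Omega> b w) + L2_inner \<Omega> (weak_partial \<Omega> b v) (weak_partial \<Omega> b w)"
    using assms b by (simp add: L2_inner_add weak_partial)
qed

lemma form_cmult:
  assumes "u \<in> H1 \<Omega>" "w \<in> H1 \<Omega>"
  shows "dirichlet_form \<Omega> (\<lambda>x. c * u x) w = c * dirichlet_form \<Omega> u w"
  unfolding dirichlet_form_def sum_distrib_left
proof (rule sum.cong[OF refl])
  fix b :: 'a assume b: "b \<in> Basis"
  have "L2_inner \<Omega> (weak_partial \<Omega> b (\<lambda>x. c * u x)) (weak_partial \<Omega> b w)
      = L2_inner \<Omega> (\<lambda>x. c * weak_partial \<Omega> b u x) (weak_partial \<Omega> b w)"
    using assms b by (intro L2_inner_AE_cong weak_partial_cmult L2_cmult weak_partial H1_cmult) auto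
  then show "L2_inner \<Omega> (weak_partial \<Omega> b (\<lambda>x. c * u x)) (weak_partial \<Omega> b w)
      = c * L2_inner \<Omega> (weak_partial \<Omega> b u) (weak_partial \<Omega> b w)"
    by (simp add: L2_inner_cmult)
qed

lemma form_cnj: "dirichlet_form \<Omega> v u = cnj (dirichlet_form \<Omega> u v)"
  unfolding dirichlet_form_def cnj_sum by (rule sum.cong[OF refl], rule L2_inner_cnj)

lemma form_self_Re_nonneg: "0 \<le> Re (dirichlet_form \<Omega> u u)"
  unfolding dirichlet_form_def Re_sum Re_L2_inner_self by (intro sum_nonneg integral_nonneg_AE) auto

lemma form_diff:
  assumes "u \<in> H1 \<Omega>" "v \<in> H1 \<Omega>" "w \<in> H1 \<Omega>"
  shows "dirichlet_form \<Omega> (\<lambda>x. u x - v x) w = dirichlet_form \<Omega> u w - dirichlet_form \<Omega> v w"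
  using form_add[of u "\<lambda>x. (- 1) * v x" w] form_cmult[of v w "- 1"] H1_cmult[of v "- 1"] assms by simp

lemma form_zero: "w \<in> H1 \<Omega> \<Longrightarrow> dirichlet_form \<Omega> (\<lambda>x. 0) w = 0"
  using form_cmult[of "\<lambda>x. 0" w 0] H1_zero by simp

lemma form_sum:
  "(\<And>i. i \<in> I \<Longrightarrow> f i \<in> H1 \<Omega>) \<Longrightarrow> w \<in> H1 \<Omega> \<Longrightarrow>
    dirichlet_form \<Omega> (\<lambda>x. \<Sum>i\<in>I. f i x) w = (\<Sum>i\<in>I. dirichlet_form \<Omega> (f i) w)"
  by (induction I rule: infinite_finite_induct) (auto simp: form_zero form_add H1_sum)

section \<open>Plane waves as elements of H^1\<close>

lemma wave_L2: "wave y \<in> L2 \<Omega>"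
  by (rule L2_bounded[of _ 1]) (auto intro: borel_measurable_lebesgue_onI borel_measurable_continuous_onI wave_continuous)

lemma wave_inner_self: "L2_inner \<Omega> (wave y) (wave y) = of_real (measure lebesgue \<Omega>)"
  by (simp add: L2_inner_self)

lemma test_integral_whole_space:
  fixes f :: "'a \<Rightarrow> complex"
  assumes "f \<in> borel_measurable borel" "\<And>x. x \<notin> \<Omega> \<Longrightarrow> f x = 0"
  shows "(LINT x|M. f x) = (LINT x|lborel. f x)"
proof -
  have "(LINT x|M. f x) = (LINT x|lebesgue. indicator \<Omega> x *\<^sub>R f x)"
    by (subst integral_restrict_space) auto
  also have "\<dots> = (LINT x|lebesgue. f x)"
    using assms(2) by (intro Bochner_Integration.integral_cong refl) (auto simp: indicator_def)
  also have "\<dots> = (LINT x|lborel. f x)" using assms(1) by (intro integral_completion) simp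
  finally show ?thesis .
qed

text \<open>Differentiate \<open>\<integral> \<phi> (x + s b) wave y x dx = cis (- s y \<bullet> b) \<integral> \<phi> (x) wave y x dx\<close> at \<open>s = 0\<close>.\<close>

lemma test_function_wave_by_parts:
  assumes t: "test_function \<Omega> \<phi>" and b: "b \<in> Basis"
  shows "(LINT x|lborel. partial_deriv b \<phi> x *\<^sub>R wave y x) = - (\<i> * (y \<bullet> b)) * (LINT x|lborel. \<phi> x *\<^sub>R wave y x)"
proof -
  define K where "K = closure {x. \<phi> x \<noteq> 0}"
  have K: "compact K" "K \<subseteq> \<Omega>" using t by (auto simp: K_def test_function_def)
  have \<phi>0: "\<phi> x = 0" if "x \<notin> K" for x using that closure_subset[of "{x. \<phi> x \<noteq> 0}"] unfolding K_def by auto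
  note [measurable] = test_function_measurable[OF t] borel_measurable_continuous_onI[OF wave_continuous]
    borel_measurable_continuous_onI[OF test_function_partial_continuous[OF t b]]
  obtain B where B: "B \<ge> 0" "\<And>x. \<bar>partial_deriv b \<phi> x\<bar> \<le> B" using test_function_partial_bounded[OF t b] by metis
  obtain A where A: "\<And>x. \<bar>\<phi> x\<bar> \<le> A" using test_function_bounded[OF t] by metis
  define h where "h n = 1 / real (Suc n)" for n
  have h: "0 < h n" "h n \<le> 1" for n by (auto simp: h_def)
  have hlim: "h \<longlonglongrightarrow> 0" unfolding h_def by (rule LIMSEQ_Suc[OF lim_1_over_n])
  have der: "((\<lambda>t. \<phi> (x + t *\<^sub>R b)) has_real_derivative partial_deriv b \<phi> (x + t *\<^sub>R b)) (at t)" for x t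
  proof -
    have 1: "((\<lambda>t. x + t *\<^sub>R b) has_derivative (\<lambda>s. s *\<^sub>R b)) (at t)"
      by (auto intro!: derivative_eq_intros)
    have 2: "(\<phi> has_derivative frechet_derivative \<phi> (at (x + t *\<^sub>R b))) (at (x + t *\<^sub>R b))"
      using test_function_differentiable[OF t] frechet_derivative_works by blast
    have "((\<lambda>t. \<phi> (x + t *\<^sub>R b)) has_derivative (\<lambda>s. frechet_derivative \<phi> (at (x + t *\<^sub>R b)) (s *\<^sub>R b))) (at t)"
      using has_derivative_compose[OF 1 2] by simp
    moreover have "frechet_derivative \<phi> (at (x + t *\<^sub>R b)) (s *\<^sub>R b) = partial_deriv b \<phi> (x + t *\<^sub>R b) * s" for s
      using linear_scale[OF has_derivative_linear[OF 2]] by (simp add: partial_deriv_def mult.commute)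
    ultimately show ?thesis by (simp add: has_field_derivative_def)
  qed
  define q where "q n x = (\<phi> (x + h n *\<^sub>R b) - \<phi> x) / h n" for n x
  \<comment> \<open>The mean value theorem bounds the difference quotients uniformly; as the
    increments are at most 1, they also vanish outside one fixed ball, and dominated convergence
    applies.\<close>
  have q_bound: "\<bar>q n x\<bar> \<le> B" for n x
  proof -
    obtain z where "\<phi> (x + h n *\<^sub>R b) - \<phi> (x + 0 *\<^sub>R b) = (h n - 0) * partial_deriv b \<phi> (x + z *\<^sub>R b)"
      using MVT2[OF h(1)[of n], of "\<lambda>t. \<phi> (x + t *\<^sub>R b)" "\<lambda>t. partial_deriv b \<phi> (x + t *\<^sub>R b)"] der by blast
    then show ?thesis using B(2)[of "x + z *\<^sub>R b"] h[of n] by (simp add: q_def)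
  qed
  have q_lim: "(\<lambda>n. q n x) \<longlonglongrightarrow> partial_deriv b \<phi> x" for x
  proof -
    have "((\<lambda>t. (\<phi> (x + t *\<^sub>R b) - \<phi> x) / t) \<longlongrightarrow> partial_deriv b \<phi> x) (at 0)"
      using der[of x 0] by (simp add: DERIV_def)
    moreover have "filterlim h (at 0) sequentially"
      using hlim h by (auto simp: filterlim_at intro!: always_eventually) (metis less_irrefl)
    ultimately show ?thesis unfolding q_def by (rule filterlim_compose)
  qed
  obtain r where r: "K \<subseteq> ball 0 r" using bounded_subset_ballD[OF compact_imp_bounded[OF K(1)], of 0] by auto
  have q_supp: "q n x = 0" if "x \<notin> ball 0 (r + 1)" for n x
  proof -
    have "norm x \<ge> r + 1" using that by simp
    moreover have "norm (x + h n *\<^sub>R b) \<ge> norm x - norm (h n *\<^sub>R b)" by (metis norm_diff_ineq)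
    moreover have "norm (h n *\<^sub>R b) \<le> 1" using h[of n] b by simp
    ultimately have "x \<notin> K" "x + h n *\<^sub>R b \<notin> K" using r by (auto simp: subset_iff)
    then show ?thesis by (simp add: q_def \<phi>0)
  qed
  have lim1: "(\<lambda>n. LINT x|lborel. q n x *\<^sub>R wave y x) \<longlonglongrightarrow> (LINT x|lborel. partial_deriv b \<phi> x *\<^sub>R wave y x)"
  proof (rule integral_dominated_convergence[where w = "\<lambda>x. indicator (ball 0 (r + 1)) x *\<^sub>R B"])
    show "AE x in lborel. (\<lambda>n. q n x *\<^sub>R wave y x) \<longlonglongrightarrow> partial_deriv b \<phi> x *\<^sub>R wave y x"
      using q_lim by (intro AE_I2 tendsto_intros)
    show "AE x in lborel. norm (q n x *\<^sub>R wave y x) \<le> indicator (ball 0 (r + 1)) x *\<^sub>R B" for n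
      using q_bound[of n] q_supp[of _ n] by (intro AE_I2) (auto simp: indicator_def)
    show "integrable lborel (\<lambda>x::'a. indicator (ball 0 (r + 1)) x *\<^sub>R B)"
      by (intro integrable_scaleR_left integrable_real_indicator emeasure_lborel_ball_finite impI) simp
    show "(\<lambda>x. q n x *\<^sub>R wave y x) \<in> borel_measurable lborel" for n unfolding q_def by measurable
  qed measurable
  have int\<phi>: "integrable lborel (\<lambda>x. \<phi> x *\<^sub>R wave y x)"
  proof (rule Bochner_Integration.integrable_bound)
    show "integrable lborel (\<lambda>x::'a. indicator (ball 0 r) x *\<^sub>R A)"
      by (intro integrable_scaleR_left integrable_real_indicator emeasure_lborel_ball_finite impI) simp
    show "AE x in lborel. norm (\<phi> x *\<^sub>R wave y x) \<le> norm (indicator (ball 0 r) x *\<^sub>R A)"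
      using A \<phi>0 r by (intro AE_I2) (auto simp: indicator_def subset_iff intro: order_trans[OF _ abs_ge_self])
  qed measurable
  define I where "I = (LINT x|lborel. \<phi> x *\<^sub>R wave y x)"
  have shift: "integrable lborel (\<lambda>x. \<phi> (x + s *\<^sub>R b) *\<^sub>R wave y x)"
    "(LINT x|lborel. \<phi> (x + s *\<^sub>R b) *\<^sub>R wave y x) = cis (- (s * (y \<bullet> b))) * I" for s
  proof -
    have eq: "\<phi> (x + s *\<^sub>R b) *\<^sub>R wave y x = cis (- (s * (y \<bullet> b))) * (\<phi> (s *\<^sub>R b + x) *\<^sub>R wave y (s *\<^sub>R b + x))" for x
      by (simp add: wave_def inner_add_right cis_mult[symmetric] add.commute) (simp add: cis_mult mult.assoc[symmetric])
    show "integrable lborel (\<lambda>x. \<phi> (x + s *\<^sub>R b) *\<^sub>R wave y x)"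
      unfolding eq using lborel_translation(2)[OF _ int\<phi>, of "s *\<^sub>R b"] by (intro integrable_mult_right) simp
    have "(LINT x|lborel. \<phi> (x + s *\<^sub>R b) *\<^sub>R wave y x)
        = (LINT x|lborel. cis (- (s * (y \<bullet> b))) * (\<phi> (s *\<^sub>R b + x) *\<^sub>R wave y (s *\<^sub>R b + x)))"
      unfolding eq ..
    also have "\<dots> = cis (- (s * (y \<bullet> b))) * (LINT x|lborel. \<phi> (s *\<^sub>R b + x) *\<^sub>R wave y (s *\<^sub>R b + x))"
      by (rule integral_mult_right_zero)
    also have "(LINT x|lborel. \<phi> (s *\<^sub>R b + x) *\<^sub>R wave y (s *\<^sub>R b + x)) = I"
      unfolding I_def by (rule lborel_translation(1)) measurable
    finally show "(LINT x|lborel. \<phi> (x + s *\<^sub>R b) *\<^sub>R wave y x) = cis (- (s * (y \<bullet> b))) * I" .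
  qed
  have val: "(LINT x|lborel. q n x *\<^sub>R wave y x) = ((cis (- (h n * (y \<bullet> b))) - 1) / of_real (h n)) * I" for n
  proof -
    have "q n x *\<^sub>R wave y x = (1 / of_real (h n)) * (\<phi> (x + h n *\<^sub>R b) *\<^sub>R wave y x - \<phi> x *\<^sub>R wave y x)" for x
      using h(1)[of n] by (simp add: q_def scaleR_conv_of_real field_simps)
    then have "(LINT x|lborel. q n x *\<^sub>R wave y x) = (1 / of_real (h n)) * (cis (- (h n * (y \<bullet> b))) * I - I)"
      using shift[of "h n"] int\<phi> by (simp add: I_def)
    then show ?thesis by (simp add: field_simps)
  qed
  have lim2: "(\<lambda>n. (cis (- (h n * (y \<bullet> b))) - 1) / of_real (h n)) \<longlonglongrightarrow> - (\<i> * (y \<bullet> b))"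
  proof -
    let ?c = "- (\<i> * complex_of_real (y \<bullet> b))"
    have "((\<lambda>z. exp (?c * z)) has_field_derivative ?c) (at 0)"
      by (auto intro!: derivative_eq_intros)
    then have "((\<lambda>z. (exp (?c * z) - 1) / z) \<longlongrightarrow> ?c) (at 0)" by (simp add: DERIV_def)
    moreover have "filterlim (\<lambda>n. complex_of_real (h n)) (at 0) sequentially"
    proof -
      have "(\<lambda>n. complex_of_real (h n)) \<longlonglongrightarrow> of_real 0" by (intro tendsto_intros hlim)
      moreover have "complex_of_real (h n) \<noteq> 0" for n using h(1)[of n] by simp
      ultimately show ?thesis by (simp add: filterlim_at)
    qed
    ultimately have "(\<lambda>n. (exp (?c * of_real (h n)) - 1) / of_real (h n)) \<longlonglongrightarrow> ?c" by (rule filterlim_compose)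
    moreover have "exp (?c * of_real (h n)) = cis (- (h n * (y \<bullet> b)))" for n by (simp add: cis_conv_exp mult_ac)
    ultimately show ?thesis by simp
  qed
  have "(\<lambda>n. LINT x|lborel. q n x *\<^sub>R wave y x) \<longlonglongrightarrow> - (\<i> * (y \<bullet> b)) * I"
    unfolding val by (intro tendsto_intros lim2)
  from LIMSEQ_unique[OF lim1 this] show ?thesis by (simp add: I_def)
qed

lemma wave_weak_partial_deriv:
  assumes b: "b \<in> Basis"
  shows "weak_partial_deriv \<Omega> b (wave y) (\<lambda>x. (\<i> * (y \<bullet> b)) * wave y x)"
  unfolding weak_partial_deriv_def
proof (intro allI impI)
  fix \<phi> assume t: "test_function \<Omega> \<phi>"
  note [measurable] = test_function_measurable[OF t] borel_measurable_continuous_onI[OF wave_continuous]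
    borel_measurable_continuous_onI[OF test_function_partial_continuous[OF t b]]
  have out: "x \<notin> closure {x. \<phi> x \<noteq> 0}" if "x \<notin> \<Omega>" for x using t that by (auto simp: test_function_def)
  have out2: "\<phi> x = 0" if "x \<notin> \<Omega>" for x using out[OF that] closure_subset[of "{x. \<phi> x \<noteq> 0}"] by auto
  have "(LINT x|M. partial_deriv b \<phi> x *\<^sub>R wave y x) = (LINT x|lborel. partial_deriv b \<phi> x *\<^sub>R wave y x)"
    by (rule test_integral_whole_space) (measurable, simp add: partial_deriv_support out)
  moreover have "(LINT x|M. \<phi> x *\<^sub>R wave y x) = (LINT x|lborel. \<phi> x *\<^sub>R wave y x)"
    by (rule test_integral_whole_space) (measurable, simp add: out2)
  moreover have "(LINT x|M. \<phi> x *\<^sub>R ((\<i> * (y \<bullet> b)) * wave y x)) = (\<i> * (y \<bullet> b)) * (LINT x|M. \<phi> x *\<^sub>R wave y x)"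
    by (simp only: mult_scaleR_right[symmetric] integral_mult_right_zero)
  ultimately show "(LINT x|M. partial_deriv b \<phi> x *\<^sub>R wave y x) = - (LINT x|M. \<phi> x *\<^sub>R ((\<i> * (y \<bullet> b)) * wave y x))"
    using test_function_wave_by_parts[OF t b, of y] by simp
qed

lemma wave_H1: "wave y \<in> H1 \<Omega>"
  unfolding H1_def
proof (intro CollectI conjI ballI wave_L2)
  fix b :: 'a assume "b \<in> Basis"
  from wave_weak_partial_deriv[OF this] L2_cmult[OF wave_L2]
  show "\<exists>g\<in>L2 \<Omega>. weak_partial_deriv \<Omega> b (wave y) g" by (rule bexI)
qed

lemma wave_form: "dirichlet_form \<Omega> (wave y) (wave y) = of_real ((norm y)\<^sup>2 * measure lebesgue \<Omega>)"
proof -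
  have "L2_inner \<Omega> (weak_partial \<Omega> b (wave y)) (weak_partial \<Omega> b (wave y)) = of_real ((y \<bullet> b)\<^sup>2 * measure lebesgue \<Omega>)"
    if b: "b \<in> Basis" for b
  proof -
    note w = weak_partial_AE_eq[OF wave_L2 b wave_weak_partial_deriv[OF b] L2_cmult[OF wave_L2], of y]
    have "L2_inner \<Omega> (weak_partial \<Omega> b (wave y)) (weak_partial \<Omega> b (wave y))
      = L2_inner \<Omega> (\<lambda>x. (\<i> * (y \<bullet> b)) * wave y x) (\<lambda>x. (\<i> * (y \<bullet> b)) * wave y x)"
      using w by (intro L2_inner_AE_cong L2_cmult wave_L2)
    then show ?thesis by (simp add: L2_inner_cmult L2_inner_cmult_right wave_inner_self power2_eq_square complex_eq_iff)
  qed
  then have "dirichlet_form \<Omega> (wave y) (wave y) = of_real (\<Sum>b\<in>Basis. (y \<bullet> b)\<^sup>2 * measure lebesgue \<Omega>)"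
    unfolding dirichlet_form_def by simp
  also have "(\<Sum>b\<in>Basis. (y \<bullet> b)\<^sup>2 * measure lebesgue \<Omega>) = (norm y)\<^sup>2 * measure lebesgue \<Omega>"
    unfolding power2_norm_eq_inner using euclidean_inner[of y y]
    by (simp add: sum_distrib_right[symmetric] power2_eq_square)
  finally show ?thesis .
qed

end

section \<open>Plancherel's inequality\<close>

lemma lborel_integral_prod:
  fixes f :: "'a::euclidean_space \<Rightarrow> real \<Rightarrow> complex"
  assumes int: "\<And>b. b \<in> Basis \<Longrightarrow> integrable lborel (f b)"
  shows "(LINT x|lborel. (\<Prod>b\<in>Basis. f b (x \<bullet> b))) = (\<Prod>b\<in>Basis. LINT t|lborel. f b t)"
proof -
  interpret product_sigma_finite "\<lambda>_::'a. lborel :: real measure"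
    by (simp add: product_sigma_finite_def lborel.sigma_finite_measure_axioms)
  have [measurable]: "f b \<in> borel_measurable borel" if "b \<in> Basis" for b
    using borel_measurable_integrable[OF int[OF that]] by simp
  have "(LINT x|lborel. (\<Prod>b\<in>Basis. f b (x \<bullet> b)))
      = (LINT g|(\<Pi>\<^sub>M b\<in>Basis. lborel). (\<Prod>b\<in>Basis. f b ((\<Sum>c\<in>Basis. g c *\<^sub>R c) \<bullet> b)))"
    by (subst lborel_eq, subst integral_distr) auto
  also have "\<dots> = (LINT g|(\<Pi>\<^sub>M b\<in>Basis. lborel). (\<Prod>b\<in>Basis. f b (g b)))"
    by (intro Bochner_Integration.integral_cong refl prod.cong) simp
  also have "\<dots> = (\<Prod>b\<in>Basis. LINT t|lborel. f b t)"
    by (rule product_integral_prod) (use int in auto)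
  finally show ?thesis .
qed

lemma cis_sum: "finite A \<Longrightarrow> cis (\<Sum>a\<in>A. f a) = (\<Prod>a\<in>A. cis (f a))"
  by (induction A rule: finite_induct) (auto simp: cis_mult[symmetric])

lemma integral_cis_period:
  assumes k: "k \<in> \<int>" "k \<noteq> 0" and l: "l > 0"
  shows "(LINT t|lborel. indicator {-l<..<l} t *\<^sub>R cis (pi / l * k * t)) = 0"
proof -
  let ?w = "pi / l * k"
  have w: "?w \<noteq> 0" using k l by simp
  have cont: "continuous_on {-l..l} (\<lambda>t. cis (?w * t))" by (intro continuous_intros)
  have "((\<lambda>t. cis (?w * t)) has_integral (cis (?w * l) / (\<i> * ?w) - cis (?w * (-l)) / (\<i> * ?w))) {-l..l}"
  proof (rule fundamental_theorem_of_calculus)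
    fix t assume "t \<in> {-l..l}"
    have "((\<lambda>z. exp (\<i> * ?w * z) / (\<i> * ?w)) has_field_derivative exp (\<i> * ?w * of_real t)) (at (of_real t))"
      using w by (auto intro!: derivative_eq_intros)
    from has_vector_derivative_real_field[OF this]
    have "((\<lambda>t. exp (\<i> * ?w * of_real t) / (\<i> * ?w)) has_vector_derivative exp (\<i> * ?w * of_real t)) (at t within {-l..l})" .
    then show "((\<lambda>t. cis (?w * t) / (\<i> * ?w)) has_vector_derivative cis (?w * t)) (at t within {-l..l})"
      by (simp add: cis_conv_exp mult.assoc)
  qed (use l in simp)
  \<comment> \<open>The antiderivative agrees at the two ends because the arguments differ by 2 pi k
    with \<open>k\<close> an integer.\<close>
  moreover have "cis (?w * l) = cis (?w * (-l))"
  proof -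
    have "cis (?w * l) = cis (- (pi * k) + 2 * pi * k)" using l by (simp add: algebra_simps)
    also have "\<dots> = cis (- (pi * k))" by (metis cis_mult cis_multiple_2pi[OF k(1)] mult.right_neutral)
    also have "\<dots> = cis (?w * (-l))" using l by simp
    finally show ?thesis .
  qed
  ultimately have "((\<lambda>t. cis (?w * t)) has_integral 0) {-l..l}" by simp
  then have hk: "((\<lambda>t. cis (?w * t)) has_integral 0) {-l<..<l}" by (simp add: has_integral_Icc_iff_Ioo)
  have int: "set_integrable lborel {-l<..<l} (\<lambda>t. cis (?w * t))"
    using borel_integrable_atLeastAtMost'[OF cont] by (rule set_integrable_subset) auto
  have "(LINT t:{-l<..<l}|lborel. cis (?w * t)) = integral {-l<..<l} (\<lambda>t. cis (?w * t))"
    by (rule set_borel_integral_eq_integral(2)[OF int])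
  then show ?thesis using integral_unique[OF hk] by (simp add: set_lebesgue_integral_def)
qed

text \<open>The integrand factorises over the coordinates, and in a coordinate where the frequency
  is nonzero the factor runs through whole periods.\<close>

lemma integral_cube_wave:
  fixes k :: "'a::euclidean_space"
  assumes k: "\<And>b. b \<in> Basis \<Longrightarrow> k \<bullet> b \<in> \<int>" "k \<noteq> 0" and l: "l > 0"
  shows "(LINT x|lborel. indicator (box (- (l *\<^sub>R One)) (l *\<^sub>R One)) x *\<^sub>R wave ((pi / l) *\<^sub>R k) x) = 0"
proof -
  have eq: "indicator (box (- (l *\<^sub>R One)) (l *\<^sub>R One)) x *\<^sub>R wave ((pi / l) *\<^sub>R k) x
      = (\<Prod>b\<in>Basis. indicator {-l<..<l} (x \<bullet> b) *\<^sub>R cis (pi / l * (k \<bullet> b) * (x \<bullet> b)))" for x :: 'a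
  proof -
    have "wave ((pi / l) *\<^sub>R k) x = cis (\<Sum>b\<in>Basis. pi / l * (k \<bullet> b) * (x \<bullet> b))"
      by (simp add: wave_def euclidean_inner[of k x] sum_distrib_left mult.assoc)
    also have "\<dots> = (\<Prod>b\<in>Basis. cis (pi / l * (k \<bullet> b) * (x \<bullet> b)))" by (rule cis_sum) simp
    finally have w: "wave ((pi / l) *\<^sub>R k) x = (\<Prod>b\<in>Basis. cis (pi / l * (k \<bullet> b) * (x \<bullet> b)))" .
    have "indicat_real (box (- (l *\<^sub>R One)) (l *\<^sub>R One)) x = (\<Prod>b\<in>Basis. indicator {-l<..<l} (x \<bullet> b))"
      by (auto simp: indicator_def mem_box intro!: prod.neutral[symmetric] prod_zero[symmetric])
    then show ?thesis unfolding w scaleR_conv_of_real by (simp add: prod.distrib)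
  qed
  have "(LINT x|lborel. indicator (box (- (l *\<^sub>R One)) (l *\<^sub>R One)) x *\<^sub>R wave ((pi / l) *\<^sub>R k) x)
     = (\<Prod>b\<in>(Basis::'a set). LINT t|lborel. indicator {-l<..<l} t *\<^sub>R cis (pi / l * (k \<bullet> b) * t))"
    unfolding eq
  proof (rule lborel_integral_prod)
    fix b :: 'a
    have "set_integrable lborel {-l..l} (\<lambda>t. cis (pi / l * (k \<bullet> b) * t))"
      by (intro borel_integrable_atLeastAtMost' continuous_intros)
    then have "set_integrable lborel {-l<..<l} (\<lambda>t. cis (pi / l * (k \<bullet> b) * t))"
      by (rule set_integrable_subset) auto
    then show "integrable lborel (\<lambda>t. indicator {-l<..<l} t *\<^sub>R cis (pi / l * (k \<bullet> b) * t))"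
      by (simp add: set_integrable_def)
  qed
  moreover obtain b where b: "b \<in> Basis" "k \<bullet> b \<noteq> 0" using k(2) euclidean_all_zero_iff[of k] by blast
  ultimately show ?thesis
    using integral_cis_period[OF k(1)[OF b(1)] b(2) l] b(1) by (auto intro!: prod_zero)
qed

text \<open>The common squared norm \<open>c\<close> lets one statement serve for orthonormal
  families (Gram-Schmidt, projection onto eigenfunctions) and for lattice waves, where
  \<open>c\<close> is the volume of the cube.\<close>

lemma L2_orthogonal_remainder:
  assumes fin: "finite I" and u: "u \<in> L2 \<Omega>" and e: "\<And>i. i \<in> I \<Longrightarrow> e i \<in> L2 \<Omega>" and c: "c > 0"
    and orth: "\<And>i j. i \<in> I \<Longrightarrow> j \<in> I \<Longrightarrow> L2_inner \<Omega> (e i) (e j) = (if i = j then of_real c else 0)"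
  defines "r \<equiv> (\<lambda>x. u x - (\<Sum>i\<in>I. (L2_inner \<Omega> u (e i) / of_real c) * e i x))"
  shows "r \<in> L2 \<Omega>" "\<And>j. j \<in> I \<Longrightarrow> L2_inner \<Omega> r (e j) = 0"
    "L2_inner \<Omega> r r = L2_inner \<Omega> u u - of_real ((\<Sum>i\<in>I. (cmod (L2_inner \<Omega> u (e i)))\<^sup>2) / c)"
proof -
  have s: "(\<lambda>x. \<Sum>i\<in>I. (L2_inner \<Omega> u (e i) / of_real c) * e i x) \<in> L2 \<Omega>"
    using e by (intro L2_sum L2_cmult)
  show r: "r \<in> L2 \<Omega>" unfolding r_def by (intro L2_diff u s)
  have sum_inner: "L2_inner \<Omega> (\<lambda>x. \<Sum>i\<in>I. a i * e i x) w = (\<Sum>i\<in>I. a i * L2_inner \<Omega> (e i) w)" if "w \<in> L2 \<Omega>" for a w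
    using that e by (subst L2_inner_sum) (auto simp: L2_inner_cmult intro: L2_cmult)
  show z: "L2_inner \<Omega> r (e j) = 0" if j: "j \<in> I" for j
  proof -
    have "(\<Sum>i\<in>I. (L2_inner \<Omega> u (e i) / of_real c) * L2_inner \<Omega> (e i) (e j)) = L2_inner \<Omega> u (e j)"
      using j fin c by (simp add: orth if_distrib[of "\<lambda>z. _ * z"] sum.delta cong: if_cong)
    then show ?thesis unfolding r_def L2_inner_diff[OF u s e[OF j]] sum_inner[OF e[OF j]] by simp
  qed
  have "L2_inner \<Omega> (\<lambda>x. \<Sum>i\<in>I. (L2_inner \<Omega> u (e i) / of_real c) * e i x) r
      = (\<Sum>i\<in>I. (L2_inner \<Omega> u (e i) / of_real c) * cnj (L2_inner \<Omega> r (e i)))"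
    unfolding sum_inner[OF r] by (intro sum.cong refl arg_cong2[where f="(*)"] L2_inner_cnj)
  then have "L2_inner \<Omega> (\<lambda>x. \<Sum>i\<in>I. (L2_inner \<Omega> u (e i) / of_real c) * e i x) r = 0"
    using z by simp
  then have "L2_inner \<Omega> r (\<lambda>x. \<Sum>i\<in>I. (L2_inner \<Omega> u (e i) / of_real c) * e i x) = 0"
    by (subst L2_inner_cnj) simp
  then have "L2_inner \<Omega> r r = L2_inner \<Omega> r u"
    using L2_inner_diff_right[OF u s r] unfolding r_def[symmetric] by simp
  also have "\<dots> = L2_inner \<Omega> u u - (\<Sum>i\<in>I. (L2_inner \<Omega> u (e i) / of_real c) * L2_inner \<Omega> (e i) u)"
    unfolding r_def L2_inner_diff[OF u s u] sum_inner[OF u] ..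
  also have "(\<Sum>i\<in>I. (L2_inner \<Omega> u (e i) / of_real c) * L2_inner \<Omega> (e i) u)
      = (\<Sum>i\<in>I. of_real ((cmod (L2_inner \<Omega> u (e i)))\<^sup>2) / of_real c)"
    unfolding complex_norm_square L2_inner_cnj[of \<Omega> "e _" u] by simp
  finally show "L2_inner \<Omega> r r = L2_inner \<Omega> u u - of_real ((\<Sum>i\<in>I. (cmod (L2_inner \<Omega> u (e i)))\<^sup>2) / c)"
    by (simp add: sum_divide_distrib)
qed

lemma L2_bessel:
  assumes "finite I" "u \<in> L2 \<Omega>" "\<And>i. i \<in> I \<Longrightarrow> e i \<in> L2 \<Omega>" and c: "c > 0"
    and "\<And>i j. i \<in> I \<Longrightarrow> j \<in> I \<Longrightarrow> L2_inner \<Omega> (e i) (e j) = (if i = j then of_real c else 0)"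
  shows "(\<Sum>i\<in>I. (cmod (L2_inner \<Omega> u (e i)))\<^sup>2) \<le> c * (L2_norm \<Omega> u)\<^sup>2"
proof -
  let ?r = "\<lambda>x. u x - (\<Sum>i\<in>I. (L2_inner \<Omega> u (e i) / of_real c) * e i x)"
  have "complex_of_real ((L2_norm \<Omega> ?r)\<^sup>2) = of_real ((L2_norm \<Omega> u)\<^sup>2 - (\<Sum>i\<in>I. (cmod (L2_inner \<Omega> u (e i)))\<^sup>2) / c)"
    using L2_orthogonal_remainder(3)[OF assms] unfolding L2_inner_self_norm by simp
  then have "(L2_norm \<Omega> ?r)\<^sup>2 = (L2_norm \<Omega> u)\<^sup>2 - (\<Sum>i\<in>I. (cmod (L2_inner \<Omega> u (e i)))\<^sup>2) / c"
    by (simp only: of_real_eq_iff)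
  moreover have "0 \<le> (L2_norm \<Omega> ?r)\<^sup>2" by simp
  ultimately have "(\<Sum>i\<in>I. (cmod (L2_inner \<Omega> u (e i)))\<^sup>2) / c \<le> (L2_norm \<Omega> u)\<^sup>2" by linarith
  then show ?thesis using c by (simp add: pos_divide_le_eq mult.commute)
qed

text \<open>By the layer cake formula the left hand side is the integral of the volumes of the balls
  of radius \<open>sqrt t\<close> over \<open>0 < t < z\<close>.\<close>

lemma nn_integral_ball_paraboloid:
  fixes z :: real
  assumes z: "z > 0"
  defines "d \<equiv> real DIM('a::euclidean_space)"
  shows "(\<integral>\<^sup>+y. ennreal (z - (norm y)\<^sup>2) \<partial>(lborel::'a measure)) = ennreal (unit_ball_vol d * (2 / (d + 2)) * z powr (1 + d / 2))"
proof -
  have [measurable]: "{p::'a \<times> real. (norm (fst p))\<^sup>2 < snd p \<and> snd p < z} \<in> sets (lborel \<Otimes>\<^sub>M lborel)"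
  proof -
    have "open ({p::'a \<times> real. (norm (fst p))\<^sup>2 < snd p} \<inter> {p. snd p < z})"
      by (intro open_Int open_Collect_less continuous_intros)
    then have "{p::'a \<times> real. (norm (fst p))\<^sup>2 < snd p \<and> snd p < z} \<in> sets borel" by (simp add: Collect_conj_eq)
    also have "sets borel = sets (lborel \<Otimes>\<^sub>M lborel :: ('a \<times> real) measure)" by (simp only: lborel_prod sets_lborel)
    finally show ?thesis .
  qed
  let ?S = "{p::'a \<times> real. (norm (fst p))\<^sup>2 < snd p \<and> snd p < z}"
  have "(\<integral>\<^sup>+y. ennreal (z - (norm y)\<^sup>2) \<partial>(lborel::'a measure)) = (\<integral>\<^sup>+y. (\<integral>\<^sup>+t. indicator ?S (y, t) \<partial>lborel) \<partial>(lborel::'a measure))"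
  proof (rule nn_integral_cong)
    fix y :: 'a
    have "(\<integral>\<^sup>+t. indicator ?S (y, t) \<partial>lborel) = (\<integral>\<^sup>+t. indicator {(norm y)\<^sup>2<..<z} t \<partial>lborel)"
      by (intro nn_integral_cong) (auto simp: indicator_def)
    also have "\<dots> = emeasure lborel {(norm y)\<^sup>2<..<z}" by simp
    also have "\<dots> = ennreal (z - (norm y)\<^sup>2)"
      by (cases "(norm y)\<^sup>2 \<le> z") (auto simp: ennreal_neg)
    finally show "ennreal (z - (norm y)\<^sup>2) = (\<integral>\<^sup>+t. indicator ?S (y, t) \<partial>lborel)" by simp
  qed
  also have "\<dots> = (\<integral>\<^sup>+t. (\<integral>\<^sup>+y. indicator ?S (y, t) \<partial>lborel) \<partial>lborel)"
    by (rule lborel_pair.Fubini'[symmetric]) (simp add: borel_measurable_indicator)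
  also have "\<dots> = (\<integral>\<^sup>+t. ennreal (unit_ball_vol d * t powr (d / 2)) * indicator {0..z} t \<partial>lborel)"
  proof (rule nn_integral_cong_AE)
    \<comment> \<open>The value t = z is set aside: the layer is empty there, whereas the closed
      interval of the power integral contains it.\<close>
    have "AE t in lborel. t \<noteq> (z::real)" by (rule AE_lborel_singleton)
    then show "AE t in lborel. (\<integral>\<^sup>+y. indicator ?S (y, t) \<partial>lborel) = ennreal (unit_ball_vol d * t powr (d / 2)) * indicator {0..z} t"
    proof eventually_elim
      case (elim t)
      show ?case
      proof (cases "0 < t \<and> t < z")
        case True
        have "(\<integral>\<^sup>+y. indicator ?S (y, t) \<partial>lborel) = (\<integral>\<^sup>+y. indicator (ball (0::'a) (sqrt t)) y \<partial>lborel)"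
        proof (rule nn_integral_cong)
          fix y :: 'a
          have "(norm y)\<^sup>2 < t \<longleftrightarrow> norm y < sqrt t"
            using real_sqrt_less_iff[of "(norm y)\<^sup>2" t] by simp
          then show "indicator ?S (y, t) = (indicator (ball 0 (sqrt t)) y :: ennreal)"
            using True by (simp add: indicator_def)
        qed
        also have "\<dots> = ennreal (unit_ball_vol d * sqrt t ^ DIM('a))"
          using True by (simp add: emeasure_ball d_def)
        also have "sqrt t ^ DIM('a) = t powr (d / 2)"
          using True by (simp add: d_def powr_half_sqrt[symmetric] powr_powr powr_realpow[symmetric])
        finally show ?thesis using True by simp
      next
        case False
        have "(\<integral>\<^sup>+y. indicator ?S (y, t) \<partial>lborel) = (\<integral>\<^sup>+y. 0 \<partial>(lborel::'a measure))"
        proof (rule nn_integral_cong)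
          fix y :: 'a
          have "0 \<le> (norm y)\<^sup>2" by simp
          then have "\<not> ((norm y)\<^sup>2 < t \<and> t < z)" using False by linarith
          then show "indicator ?S (y, t) = (0::ennreal)" by (simp add: indicator_def)
        qed
        then show ?thesis using False elim by (auto simp: indicator_def)
      qed
    qed
  qed
  also have "\<dots> = ennreal (unit_ball_vol d * (z powr (d / 2 + 1) / (d / 2 + 1)))"
  proof -
    have "((\<lambda>x. unit_ball_vol d * x powr (d / 2)) has_integral (unit_ball_vol d * (z powr (d / 2 + 1) / (d / 2 + 1)))) {0..z}"
      using z by (intro has_integral_mult_right has_integral_powr_from_0) (auto simp: d_def intro: less_le_trans[of _ 0])
    from nn_integral_has_integral_lebesgue[OF _ this] show ?thesis
      by (simp add: d_def mult.commute ennreal_mult'[symmetric] ennreal_indicator[symmetric])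
  qed
  also have "unit_ball_vol d * (z powr (d / 2 + 1) / (d / 2 + 1)) = unit_ball_vol d * (2 / (d + 2)) * z powr (1 + d / 2)"
    by (simp add: add.commute field_simps d_def)
  finally show ?thesis .
qed

context bounded_open
begin

text \<open>Dominated convergence, as waves have modulus 1 and \<open>u\<close> is integrable on the
  bounded set. It supplies the measurability in \<open>y\<close> for all later integrals over
  frequencies.\<close>

lemma fourier_continuous:
  assumes u: "u \<in> L2 \<Omega>"
  shows "continuous_on UNIV (\<lambda>y. L2_inner \<Omega> (wave y) u)"
  unfolding continuous_on_sequentially
proof (intro allI ballI impI)
  fix y :: "nat \<Rightarrow> 'a" and a assume "(\<forall>n. y n \<in> UNIV) \<and> y \<longlonglongrightarrow> a"
  then have y: "y \<longlonglongrightarrow> a" by simp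
  have [measurable]: "u \<in> borel_measurable M" using u by (simp add: L2_def)
  have cu: "integrable M (\<lambda>x. cnj (u x))" using L2_integrable_self[OF u] by simp
  note [measurable] = borel_measurable_lebesgue_onI[OF borel_measurable_continuous_onI[OF wave_continuous]]
  have "(\<lambda>n. LINT x|M. wave (y n) x * cnj (u x)) \<longlonglongrightarrow> (LINT x|M. wave a x * cnj (u x))"
  proof (rule integral_dominated_convergence[where w = "\<lambda>x. norm (cnj (u x))"])
    show "AE x in M. (\<lambda>n. wave (y n) x * cnj (u x)) \<longlonglongrightarrow> wave a x * cnj (u x)"
      unfolding wave_def cis_conv_exp by (intro AE_I2 tendsto_intros y)
    show "AE x in M. norm (wave (y n) x * cnj (u x)) \<le> norm (cnj (u x))" for n
      by (simp add: norm_mult)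
    show "integrable M (\<lambda>x. norm (cnj (u x)))" using cu by simp
    show "(\<lambda>x. wave (y n) x * cnj (u x)) \<in> borel_measurable M" for n
      using borel_measurable_integrable[OF cu] by measurable
    show "(\<lambda>x. wave a x * cnj (u x)) \<in> borel_measurable M"
      using borel_measurable_integrable[OF cu] by measurable
  qed
  then show "((\<lambda>y. L2_inner \<Omega> (wave y) u) \<circ> y) \<longlonglongrightarrow> L2_inner \<Omega> (wave a) u"
    by (simp add: L2_inner_def o_def)
qed

text \<open>After extending \<open>u\<close> by zero to the cube this is Bessel's inequality there:
  waves with frequencies \<theta> + (pi / l) k are orthogonal for every shift \<theta>, because the
  shift cancels in products, and their squared norm is the volume (2 l)^d.\<close>

lemma fourier_lattice_bessel:
  fixes N :: "'a set"
  assumes u: "u \<in> L2 \<Omega>" and l: "l > 0" and sub: "\<Omega> \<subseteq> box (- (l *\<^sub>R One)) (l *\<^sub>R One)"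
    and N: "finite N" "\<And>k b. k \<in> N \<Longrightarrow> b \<in> Basis \<Longrightarrow> k \<bullet> b \<in> \<int>"
  shows "(\<Sum>k\<in>N. (cmod (L2_inner \<Omega> (wave (\<theta> + (pi / l) *\<^sub>R k)) u))\<^sup>2) \<le> (2 * l) ^ DIM('a) * (L2_norm \<Omega> u)\<^sup>2"
proof -
  let ?Q = "box (- (l *\<^sub>R One)) (l *\<^sub>R One) :: 'a set"
  interpret Q: bounded_open ?Q by unfold_locales auto
  define v where "v x = indicat_real \<Omega> x *\<^sub>R u x" for x
  have restr: "integral\<^sup>L Q.M (\<lambda>x. indicat_real \<Omega> x *\<^sub>R f x) = integral\<^sup>L M f" 
    for f :: "'a \<Rightarrow> 'c::{banach, second_countable_topology}"
  proof -
    have "integral\<^sup>L Q.M (\<lambda>x. indicat_real \<Omega> x *\<^sub>R f x) = (LINT x|lebesgue. indicator ?Q x *\<^sub>R (indicat_real \<Omega> x *\<^sub>R f x))"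
      by (subst integral_restrict_space) auto
    also have "\<dots> = (LINT x|lebesgue. indicat_real \<Omega> x *\<^sub>R f x)"
      using sub by (intro Bochner_Integration.integral_cong refl) (auto simp: indicator_def)
    also have "\<dots> = integral\<^sup>L M f" by (subst integral_restrict_space) auto
    finally show ?thesis .
  qed
  have vL: "v \<in> L2 ?Q"
  proof -
    have m: "v \<in> borel_measurable lebesgue"
      using u unfolding v_def[abs_def] by (subst borel_measurable_restrict_space_iff[symmetric]) (auto simp: L2_def)
    have i: "integrable lebesgue (\<lambda>x. indicat_real \<Omega> x *\<^sub>R (cmod (u x))\<^sup>2)"
      using L2_integrable[OF u] by (subst integrable_restrict_space[symmetric]) auto
    have eq: "(cmod (v x))\<^sup>2 = indicat_real \<Omega> x *\<^sub>R (cmod (u x))\<^sup>2" for x by (simp add: v_def indicator_def)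
    have "integrable Q.M (\<lambda>x. (cmod (v x))\<^sup>2)"
      unfolding eq using integrable_mult_indicator[OF _ i, of ?Q] by (subst integrable_restrict_space) auto
    then show ?thesis using m by (auto simp: L2_def intro: measurable_restrict_space1)
  qed
  have inner_v: "L2_inner ?Q v w = L2_inner \<Omega> u w" for w
    using restr[of "\<lambda>x. u x * cnj (w x)"] by (simp add: L2_inner_def v_def)
  have norm_v: "(L2_norm ?Q v)\<^sup>2 = (L2_norm \<Omega> u)\<^sup>2"
  proof -
    have "(cmod (v x))\<^sup>2 = indicat_real \<Omega> x *\<^sub>R (cmod (u x))\<^sup>2" for x by (simp add: v_def indicator_def)
    then show ?thesis using restr[of "\<lambda>x. (cmod (u x))\<^sup>2"] by (simp add: L2_norm_def)
  qed
  have vol: "measure lebesgue ?Q = (2 * l) ^ DIM('a)"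
  proof -
    have "measure lebesgue ?Q = (\<Prod>b\<in>(Basis::'a set). (l *\<^sub>R One - - (l *\<^sub>R One)) \<bullet> b)"
      using l by (simp add: measure_completion measure_lborel_box_eq)
    also have "\<dots> = (\<Prod>b\<in>(Basis::'a set). 2 * l)"
      by (intro prod.cong refl) (simp add: inner_diff_left inner_add_left)
    finally show ?thesis by simp
  qed
  define e where "e k = wave (\<theta> + (pi / l) *\<^sub>R k)" for k :: 'a
  have orth: "L2_inner ?Q (e k) (e k') = (if k = k' then of_real ((2 * l) ^ DIM('a)) else 0)"
    if "k \<in> N" "k' \<in> N" for k k'
  proof (cases "k = k'")
    case True
    then show ?thesis using Q.wave_inner_self vol by (simp add: e_def)
  next
    case False
    have "e k x * cnj (e k' x) = wave ((pi / l) *\<^sub>R (k - k')) x" for x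
      by (simp add: e_def wave_def cis_cnj cis_mult inner_diff_left inner_add_left scaleR_diff_right)
    then have "L2_inner ?Q (e k) (e k') = (LINT x|Q.M. wave ((pi / l) *\<^sub>R (k - k')) x)" by (simp add: L2_inner_def)
    also have "\<dots> = (LINT x|lebesgue. indicator ?Q x *\<^sub>R wave ((pi / l) *\<^sub>R (k - k')) x)"
      by (subst integral_restrict_space) auto
    also have "\<dots> = (LINT x|lborel. indicator ?Q x *\<^sub>R wave ((pi / l) *\<^sub>R (k - k')) x)"
    proof (rule integral_completion)
      note [measurable] = borel_measurable_continuous_onI[OF wave_continuous]
      show "(\<lambda>x. indicator ?Q x *\<^sub>R wave ((pi / l) *\<^sub>R (k - k')) x) \<in> borel_measurable lborel" by measurable
    qed
    also have "\<dots> = 0"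
      using that N False l by (intro integral_cube_wave) (auto simp: inner_diff_left)
    finally show ?thesis using False by simp
  qed
  have "(\<Sum>k\<in>N. (cmod (L2_inner ?Q v (e k)))\<^sup>2) \<le> (2 * l) ^ DIM('a) * (L2_norm ?Q v)\<^sup>2"
    using N(1) vL l Q.wave_L2 orth by (intro L2_bessel) (auto simp: e_def[abs_def])
  moreover have "cmod (L2_inner ?Q v (e k)) = cmod (L2_inner \<Omega> (e k) u)" for k
    unfolding inner_v by (subst L2_inner_cnj) simp
  ultimately show ?thesis by (simp add: norm_v e_def)
qed

text \<open>The upper half of Plancherel's theorem. Integrating Bessel's inequality for the waves
  \<open>\<theta> + h k\<close>, \<open>k\<close> in a finite part of the integer lattice, over \<open>\<theta>\<close> in a fundamental cell
  recovers the integral over the ball.\<close>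

theorem plancherel_le:
  assumes u: "u \<in> L2 \<Omega>"
  shows "(\<integral>\<^sup>+y. ennreal ((cmod (L2_inner \<Omega> (wave y) u))\<^sup>2) * indicator (ball 0 r) y \<partial>lborel)
      \<le> ennreal ((2 * pi) ^ DIM('a) * (L2_norm \<Omega> u)\<^sup>2)"
proof -
  obtain l where l: "l > 0" and sub: "\<Omega> \<subseteq> box (- (l *\<^sub>R One)) (l *\<^sub>R One)"
  proof -
    obtain a where a: "\<Omega> \<subseteq> box (- a) a" using bounded_subset_box_symmetric[OF bd] by metis
    \<comment> \<open>The added 1 and the absolute value make \<open>l\<close> positive whatever the
      sign of the largest coordinate of \<open>a\<close>.\<close>
    define l where "l = Max ((\<lambda>b. a \<bullet> b) ` Basis) + 1 + \<bar>Max ((\<lambda>b. a \<bullet> b) ` Basis)\<bar>"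
    have le: "a \<bullet> b \<le> l" if "b \<in> Basis" for b
    proof -
      have "a \<bullet> b \<le> Max ((\<lambda>b. a \<bullet> b) ` Basis)" using that by (intro Max_ge) auto
      then show ?thesis by (simp add: l_def)
    qed
    have "l > 0" by (simp add: l_def)
    moreover have "box (- a) a \<subseteq> box (- (l *\<^sub>R One)) (l *\<^sub>R One)"
      using le by (force simp: subset_iff mem_box)
    ultimately show ?thesis using that a by blast
  qed
  define h where "h = pi / l"
  have h: "h > 0" using l by (simp add: h_def)
  define c where "c y = ennreal ((cmod (L2_inner \<Omega> (wave y) u))\<^sup>2)" for y
  have [measurable]: "c \<in> borel_measurable borel"
    unfolding c_def[abs_def] using borel_measurable_continuous_onI[OF fourier_continuous[OF u]] by measurable
  \<comment> \<open>\<open>n y\<close> indexes the half-open lattice cell of side \<open>h\<close>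
    that contains \<open>y\<close>; \<open>N\<close> collects the cells met by the ball.\<close>
  define n where "n y = (\<Sum>b\<in>Basis. of_int \<lfloor>(y \<bullet> b) / h\<rfloor> *\<^sub>R b)" for y :: 'a
  have nb: "n y \<bullet> b = of_int \<lfloor>(y \<bullet> b) / h\<rfloor>" if "b \<in> Basis" for y b using that by (simp add: n_def)
  define N where "N = n ` ball 0 r"
  have finN: "finite N"
  proof -
    define K where "K = \<lceil>\<bar>r\<bar> / h\<rceil> + 1"
    have "N \<subseteq> (\<lambda>g. \<Sum>b\<in>Basis. of_int (g b) *\<^sub>R b) ` (Basis \<rightarrow>\<^sub>E {-K..K})"
    proof
      fix k assume "k \<in> N"
      then obtain y where y: "norm y < r" "k = n y" by (auto simp: N_def)
      let ?g = "restrict (\<lambda>b. \<lfloor>(y \<bullet> b) / h\<rfloor>) Basis"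
      have "?g b \<in> {-K..K}" if b: "b \<in> Basis" for b
      proof -
        have "\<bar>y \<bullet> b\<bar> \<le> \<bar>r\<bar>" using Basis_le_norm[OF b, of y] y by linarith
        then have "\<bar>(y \<bullet> b) / h\<bar> \<le> \<bar>r\<bar> / h" using h by (simp add: divide_right_mono)
        then have "\<lfloor>(y \<bullet> b) / h\<rfloor> \<le> K" "- K \<le> \<lfloor>(y \<bullet> b) / h\<rfloor>" unfolding K_def by linarith+
        then show ?thesis using b by simp
      qed
      then have "?g \<in> Basis \<rightarrow>\<^sub>E {-K..K}" by auto
      moreover have "k = (\<Sum>b\<in>Basis. of_int (?g b) *\<^sub>R b)" unfolding y n_def by (intro sum.cong) auto
      ultimately show "k \<in> (\<lambda>g. \<Sum>b\<in>Basis. of_int (g b) *\<^sub>R b) ` (Basis \<rightarrow>\<^sub>E {-K..K})" by blast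
    qed
    then show ?thesis by (rule finite_subset) (intro finite_imageI finite_PiE, auto)
  qed
  have N_int: "k \<bullet> b \<in> \<int>" if "k \<in> N" "b \<in> Basis" for k b
    using that nb by (auto simp: N_def)
  define Q where "Q = {\<theta>::'a. \<forall>b\<in>Basis. 0 \<le> \<theta> \<bullet> b \<and> \<theta> \<bullet> b < h}"
  have [measurable]: "Q \<in> sets borel"
  proof -
    have "Q = (\<Inter>b\<in>Basis. {\<theta>. 0 \<le> \<theta> \<bullet> b} \<inter> {\<theta>. \<theta> \<bullet> b < h})" by (auto simp: Q_def)
    also have "\<dots> \<in> sets borel" by (intro sets.finite_INT) auto
    finally show ?thesis .
  qed
  have cell: "y - h *\<^sub>R n y \<in> Q" for y
    unfolding Q_def
  proof (intro CollectI ballI)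
    fix b :: 'a assume b: "b \<in> Basis"
    have "of_int \<lfloor>(y \<bullet> b) / h\<rfloor> * h \<le> y \<bullet> b" "y \<bullet> b < (of_int \<lfloor>(y \<bullet> b) / h\<rfloor> + 1) * h"
      using floor_divide_lower[OF h] floor_divide_upper[OF h] by auto
    then show "0 \<le> (y - h *\<^sub>R n y) \<bullet> b \<and> (y - h *\<^sub>R n y) \<bullet> b < h"
      using b by (simp add: inner_diff_left nb algebra_simps)
  qed
  have "(\<integral>\<^sup>+y. c y * indicator (ball 0 r) y \<partial>lborel) \<le> (\<integral>\<^sup>+y. (\<Sum>k\<in>N. c y * indicator Q (- (h *\<^sub>R k) + y)) \<partial>lborel)"
  proof (rule nn_integral_mono)
    fix y :: 'a
    show "c y * indicator (ball 0 r) y \<le> (\<Sum>k\<in>N. c y * indicator Q (- (h *\<^sub>R k) + y))"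
    proof (cases "y \<in> ball 0 r")
      case True
      then have "n y \<in> N" by (auto simp: N_def)
      then have "c y * indicator Q (- (h *\<^sub>R n y) + y) \<le> (\<Sum>k\<in>N. c y * indicator Q (- (h *\<^sub>R k) + y))"
        using finN by (intro member_le_sum) auto
      then show ?thesis using True cell[of y] by simp
    qed simp
  qed
  also have "\<dots> = (\<Sum>k\<in>N. \<integral>\<^sup>+y. c y * indicator Q (- (h *\<^sub>R k) + y) \<partial>lborel)"
    by (intro nn_integral_sum) measurable
  also have "\<dots> = (\<Sum>k\<in>N. \<integral>\<^sup>+\<theta>. c (\<theta> + h *\<^sub>R k) * indicator Q \<theta> \<partial>lborel)"
  proof (rule sum.cong[OF refl])
    fix k
    have "(\<integral>\<^sup>+y. c y * indicator Q (- (h *\<^sub>R k) + y) \<partial>lborel)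
        = (\<integral>\<^sup>+y. c y * indicator Q (- (h *\<^sub>R k) + y) \<partial>distr lborel borel ((+) (h *\<^sub>R k)))"
      by (simp only: lborel_distr_plus)
    also have "\<dots> = (\<integral>\<^sup>+\<theta>. c (\<theta> + h *\<^sub>R k) * indicator Q \<theta> \<partial>lborel)"
      by (subst nn_integral_distr) (auto simp: add.commute)
    finally show "(\<integral>\<^sup>+y. c y * indicator Q (- (h *\<^sub>R k) + y) \<partial>lborel) = (\<integral>\<^sup>+\<theta>. c (\<theta> + h *\<^sub>R k) * indicator Q \<theta> \<partial>lborel)" .
  qed
  also have "\<dots> = (\<integral>\<^sup>+\<theta>. (\<Sum>k\<in>N. c (\<theta> + h *\<^sub>R k) * indicator Q \<theta>) \<partial>lborel)"
    by (intro nn_integral_sum[symmetric]) measurable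
  also have "\<dots> \<le> (\<integral>\<^sup>+\<theta>. ennreal ((2 * l) ^ DIM('a) * (L2_norm \<Omega> u)\<^sup>2) * indicator Q \<theta> \<partial>lborel)"
  proof (rule nn_integral_mono)
    fix \<theta> :: 'a
    have "(\<Sum>k\<in>N. c (\<theta> + h *\<^sub>R k)) = ennreal (\<Sum>k\<in>N. (cmod (L2_inner \<Omega> (wave (\<theta> + h *\<^sub>R k)) u))\<^sup>2)"
      unfolding c_def by (intro sum_ennreal) simp
    also have "\<dots> \<le> ennreal ((2 * l) ^ DIM('a) * (L2_norm \<Omega> u)\<^sup>2)"
      unfolding h_def by (intro ennreal_leI fourier_lattice_bessel[OF u l sub finN N_int])
    finally show "(\<Sum>k\<in>N. c (\<theta> + h *\<^sub>R k) * indicator Q \<theta>) \<le> ennreal ((2 * l) ^ DIM('a) * (L2_norm \<Omega> u)\<^sup>2) * indicator Q \<theta>"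
      by (simp add: sum_distrib_right[symmetric] mult_right_mono)
  qed
  also have "\<dots> = ennreal ((2 * l) ^ DIM('a) * (L2_norm \<Omega> u)\<^sup>2) * emeasure lborel Q"
    by (subst nn_integral_cmult_indicator) auto
  also have "\<dots> \<le> ennreal ((2 * l) ^ DIM('a) * (L2_norm \<Omega> u)\<^sup>2) * ennreal (h ^ DIM('a))"
  proof (rule mult_left_mono)
    have "emeasure lborel Q \<le> emeasure lborel (cbox 0 (h *\<^sub>R One :: 'a))"
      by (intro emeasure_mono) (auto simp: Q_def mem_box less_imp_le)
    also have "\<dots> = ennreal (h ^ DIM('a))" using h by (subst emeasure_lborel_cbox) auto
    finally show "emeasure lborel Q \<le> ennreal (h ^ DIM('a))" .
  qed simp
  \<comment> \<open>The cell volume (pi / l)^d meets the cube volume (2 l)^d, and the auxiliary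
    length \<open>l\<close> cancels.\<close>
  also have "\<dots> = ennreal ((2 * pi) ^ DIM('a) * (L2_norm \<Omega> u)\<^sup>2)"
    using l h by (simp add: ennreal_mult[symmetric] h_def power_divide power_mult_distrib)
  finally show ?thesis by (simp add: c_def)
qed

end

section \<open>Eigenfunctions of the Neumann Laplacian\<close>

text \<open>Dimension is counted modulo null sets. Totality is expressed by orthogonality to all
  \<open>e i\<close> instead of an expansion: this is the form that later excludes further
  eigenfunctions.\<close>

lemma gram_schmidt:
  assumes sub: "E \<subseteq> L2 \<Omega>" and add: "\<And>u v. u \<in> E \<Longrightarrow> v \<in> E \<Longrightarrow> (\<lambda>x. u x + v x) \<in> E"
    and cmult: "\<And>c u. u \<in> E \<Longrightarrow> (\<lambda>x. c * u x) \<in> E"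
    and dim: "has_ae_dim \<Omega> E n"
  shows "\<exists>e. (\<forall>i<n. e i \<in> E) \<and> (\<forall>i<n. \<forall>j<n. L2_inner \<Omega> (e i) (e j) = (if i = j then 1 else 0)) \<and>
    (\<forall>u\<in>E. (\<forall>i<n. L2_inner \<Omega> u (e i) = 0) \<longrightarrow> L2_norm \<Omega> u = 0)"
proof -
  obtain b where b: "\<And>i. i < n \<Longrightarrow> b i \<in> E"
    and indep: "\<And>c. AE x in lebesgue_on \<Omega>. (\<Sum>i<n. c i * b i x) = 0 \<Longrightarrow> \<forall>i<n. c i = (0::complex)"
    and span: "\<And>u. u \<in> E \<Longrightarrow> \<exists>c. AE x in lebesgue_on \<Omega>. u x = (\<Sum>i<n. c i * b i x)"
    using dim unfolding has_ae_dim_def by blast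
  have bL: "b i \<in> L2 \<Omega>" if "i < n" for i using b[OF that] sub by auto
  have zero: "(\<lambda>x. 0) \<in> E" if "u \<in> E" for u using cmult[OF that, of 0] by simp
  have sumE: "(\<lambda>x. u x - (\<Sum>i<m. a i * f i x)) \<in> E" if "u \<in> E" "\<And>i. i < m \<Longrightarrow> f i \<in> E" for u f and a :: "nat \<Rightarrow> complex" and m :: nat
    using that(2)
  proof (induction m)
    case 0
    then show ?case using that(1) by simp
  next
    case (Suc m)
    have "(\<lambda>x. (u x - (\<Sum>i<m. a i * f i x)) + (- a m) * f m x) \<in> E"
      using Suc by (intro add cmult) auto
    then show ?case by (simp add: algebra_simps)
  qed
  \<comment> \<open>The coefficients \<open>c\<close> are carried along so that independence of the
    \<open>b l\<close> can show the next remainder not to be null; the last clause replaces the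
    statement that the \<open>b i\<close> lie in the span of the \<open>e i\<close>.\<close>
  have "m \<le> n \<Longrightarrow> \<exists>e c. (\<forall>i<m. e i \<in> E) \<and> (\<forall>i<m. \<forall>j<m. L2_inner \<Omega> (e i) (e j) = (if i = j then 1 else 0)) \<and>
      (\<forall>i<m. \<forall>x. e i x = (\<Sum>l<m. c i l * b l x)) \<and>
      (\<forall>u\<in>L2 \<Omega>. (\<forall>i<m. L2_inner \<Omega> u (e i) = 0) \<longrightarrow> (\<forall>i<m. L2_inner \<Omega> u (b i) = 0))" for m
  proof (induction m)
    case 0
    then show ?case by simp
  next
    case (Suc m)
    then obtain e c where *: "(\<forall>i<m. e i \<in> E) \<and> (\<forall>i<m. \<forall>j<m. L2_inner \<Omega> (e i) (e j) = (if i = j then 1 else 0)) \<and>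
      (\<forall>i<m. \<forall>x. e i x = (\<Sum>l<m. c i l * b l x)) \<and>
      (\<forall>u\<in>L2 \<Omega>. (\<forall>i<m. L2_inner \<Omega> u (e i) = 0) \<longrightarrow> (\<forall>i<m. L2_inner \<Omega> u (b i) = 0))"
      using Suc_leD by blast
    have e: "e i \<in> E" if "i < m" for i using * that by blast
    have on: "L2_inner \<Omega> (e i) (e j) = (if i = j then 1 else 0)" if "i < m" "j < m" for i j using * that by blast
    have ec: "e i x = (\<Sum>l<m. c i l * b l x)" if "i < m" for i x using * that by blast
    have perp: "\<forall>i<m. L2_inner \<Omega> u (b i) = 0" if "u \<in> L2 \<Omega>" "\<forall>i<m. L2_inner \<Omega> u (e i) = 0" for u using * that by blast
    have mn: "m < n" using Suc by simp
    have eL: "e i \<in> L2 \<Omega>" if "i < m" for i using e[OF that] sub by auto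
    define a where "a i = L2_inner \<Omega> (b m) (e i)" for i
    define w where "w x = b m x - (\<Sum>i<m. a i * e i x)" for x
    have wE: "w \<in> E" unfolding w_def[abs_def] by (rule sumE) (use b[OF mn] e in auto)
    then have wL: "w \<in> L2 \<Omega>" using sub by auto
    have w_perp: "L2_inner \<Omega> w (e j) = 0" if "j < m" for j
      using L2_orthogonal_remainder(2)[of "{..<m}" "b m" \<Omega> e 1 j] bL[OF mn] eL on that
      by (simp add: w_def[abs_def] a_def)
    \<comment> \<open>Coefficients of the remainder \<open>w\<close> in terms of the
      \<open>b l\<close>. The entry 1 at index \<open>m\<close> contradicts independence if
      \<open>w\<close> is null.\<close>
    define d where "d l = (if l = m then 1 else if l < m then - (\<Sum>i<m. a i * c i l) else 0)" for l
    have wd: "w x = (\<Sum>l<Suc m. d l * b l x)" for x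
    proof -
      have "(\<Sum>i<m. a i * e i x) = (\<Sum>i<m. \<Sum>l<m. a i * c i l * b l x)"
        by (simp add: ec sum_distrib_left mult.assoc)
      also have "\<dots> = (\<Sum>l<m. (\<Sum>i<m. a i * c i l) * b l x)"
        by (subst sum.swap) (simp add: sum_distrib_right)
      finally show ?thesis by (simp add: w_def d_def sum_negf)
    qed
    have wn: "L2_norm \<Omega> w \<noteq> 0"
    proof
      assume "L2_norm \<Omega> w = 0"
      then have "AE x in lebesgue_on \<Omega>. w x = 0" using L2_norm_eq_0_iff[OF wL] by simp
      moreover have "w x = (\<Sum>l<n. d l * b l x)" for x
        unfolding wd using mn by (intro sum.mono_neutral_left) (auto simp: d_def)
      ultimately have "\<forall>i<n. d i = 0" by (intro indep) simp
      then show False using mn by (auto simp: d_def)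
    qed
    define r where "r = 1 / complex_of_real (L2_norm \<Omega> w)"
    have r: "r \<noteq> 0" "cnj r = r" using wn by (auto simp: r_def)
    define e' where "e' i = (if i = m then (\<lambda>x. r * w x) else e i)" for i
    define c' where "c' i l = (if i = m then r * d l else if l < m then c i l else 0)" for i l
    have ww: "L2_inner \<Omega> w w = of_real (L2_norm \<Omega> w) * of_real (L2_norm \<Omega> w)"
      by (simp add: L2_inner_self_norm power2_eq_square)
    have "\<forall>i<Suc m. e' i \<in> E" using e wE cmult by (auto simp: e'_def less_Suc_eq)
    moreover have "\<forall>i<Suc m. \<forall>j<Suc m. L2_inner \<Omega> (e' i) (e' j) = (if i = j then 1 else 0)"
    proof (intro allI impI)
      fix i j assume "i < Suc m" "j < Suc m"
      then consider "i < m" "j < m" | "i = m" "j < m" | "i < m" "j = m" | "i = m" "j = m" by linarith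
      then show "L2_inner \<Omega> (e' i) (e' j) = (if i = j then 1 else 0)"
      proof cases
        case 3
        then show ?thesis using w_perp[of i] L2_inner_cnj[of \<Omega> "e i" w]
          by (simp add: e'_def L2_inner_cmult_right)
      next
        case 4
        have "L2_inner \<Omega> (\<lambda>x. r * w x) (\<lambda>x. r * w x) = r * (r * (of_real (L2_norm \<Omega> w) * of_real (L2_norm \<Omega> w)))"
          by (simp only: L2_inner_cmult L2_inner_cmult_right ww r(2))
        also have "\<dots> = 1" using wn by (simp add: r_def)
        finally show ?thesis using 4 by (simp add: e'_def)
      qed (use on w_perp in \<open>auto simp: e'_def L2_inner_cmult\<close>)
    qed
    moreover have "\<forall>i<Suc m. \<forall>x. e' i x = (\<Sum>l<Suc m. c' i l * b l x)"
    proof (intro allI impI)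
      fix i x assume "i < Suc m"
      then consider "i < m" | "i = m" by linarith
      then show "e' i x = (\<Sum>l<Suc m. c' i l * b l x)"
      proof cases
        case 2
        have "r * (\<Sum>l<Suc m. d l * b l x) = (\<Sum>l<Suc m. (r * d l) * b l x)"
          by (simp only: sum_distrib_left mult.assoc)
        moreover have "e' i x = r * w x" "c' i = (\<lambda>l. r * d l)" using 2 by (auto simp: e'_def c'_def)
        ultimately show ?thesis by (simp only: wd)
      qed (simp add: e'_def c'_def ec)
    qed
    moreover have "\<forall>u\<in>L2 \<Omega>. (\<forall>i<Suc m. L2_inner \<Omega> u (e' i) = 0) \<longrightarrow> (\<forall>i<Suc m. L2_inner \<Omega> u (b i) = 0)"
    proof (intro ballI impI)
      fix u assume u: "u \<in> L2 \<Omega>" and z: "\<forall>i<Suc m. L2_inner \<Omega> u (e' i) = 0"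
      have ze: "L2_inner \<Omega> u (e i) = 0" if "i < m" for i using z that by (auto simp: e'_def dest: spec[of _ i])
      have zw: "L2_inner \<Omega> u w = 0" using z r by (auto simp: e'_def L2_inner_cmult_right dest: spec[of _ m])
      have "b m = (\<lambda>x. w x + (\<Sum>i<m. a i * e i x))" by (simp add: w_def)
      then have "L2_inner \<Omega> u (b m) = L2_inner \<Omega> u w + L2_inner \<Omega> u (\<lambda>x. \<Sum>i<m. a i * e i x)"
        using L2_inner_add_right[OF wL L2_sum u, of "{..<m}" "\<lambda>i x. a i * e i x"] eL by (simp add: L2_cmult)
      also have "L2_inner \<Omega> u (\<lambda>x. \<Sum>i<m. a i * e i x) = 0"
        using eL u ze by (subst L2_inner_sum_right) (auto simp: L2_inner_cmult_right L2_cmult)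
      finally show "\<forall>i<Suc m. L2_inner \<Omega> u (b i) = 0" using zw perp[OF u] ze by (auto simp: less_Suc_eq)
    qed
    ultimately show ?case by blast
  qed
  from this[of n] obtain e where *: "(\<forall>i<n. e i \<in> E) \<and> (\<forall>i<n. \<forall>j<n. L2_inner \<Omega> (e i) (e j) = (if i = j then 1 else 0)) \<and>
      (\<forall>u\<in>L2 \<Omega>. (\<forall>i<n. L2_inner \<Omega> u (e i) = 0) \<longrightarrow> (\<forall>i<n. L2_inner \<Omega> u (b i) = 0))" by blast
  have perp: "\<forall>i<n. L2_inner \<Omega> u (b i) = 0" if "u \<in> L2 \<Omega>" "\<forall>i<n. L2_inner \<Omega> u (e i) = 0" for u using * that by blast
  have "L2_norm \<Omega> u = 0" if u: "u \<in> E" and z: "\<forall>i<n. L2_inner \<Omega> u (e i) = 0" for u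
  proof -
    have uL: "u \<in> L2 \<Omega>" using u sub by auto
    have zb: "\<forall>i<n. L2_inner \<Omega> u (b i) = 0" by (rule perp[OF uL z])
    obtain c where c: "AE x in lebesgue_on \<Omega>. u x = (\<Sum>i<n. c i * b i x)" using span[OF u] by blast
    have "L2_inner \<Omega> u u = L2_inner \<Omega> u (\<lambda>x. \<Sum>i<n. c i * b i x)"
      using uL bL c by (intro L2_inner_AE_cong L2_sum L2_cmult) auto
    also have "\<dots> = 0" using uL bL zb by (subst L2_inner_sum_right) (auto simp: L2_inner_cmult_right L2_cmult)
    finally show ?thesis by (simp add: L2_inner_self_norm)
  qed
  then show ?thesis using * by (intro exI[of _ e]) blast
qed

context bounded_open
begin

section \<open>Linearity of the operator graph, eigenvalues and eigenspaces\<close>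

lemma neumann_H1: "neumann_laplacian \<Omega> u f \<Longrightarrow> u \<in> H1 \<Omega>"
  and neumann_L2: "neumann_laplacian \<Omega> u f \<Longrightarrow> f \<in> L2 \<Omega>"
  and neumann_form: "neumann_laplacian \<Omega> u f \<Longrightarrow> v \<in> H1 \<Omega> \<Longrightarrow> dirichlet_form \<Omega> u v = L2_inner \<Omega> f v"
  by (auto simp: neumann_laplacian_def)

lemma neumann_AE_cong:
  assumes N: "neumann_laplacian \<Omega> u f" and g: "g \<in> L2 \<Omega>" "AE x in M. f x = g x"
  shows "neumann_laplacian \<Omega> u g"
proof -
  have "L2_inner \<Omega> f v = L2_inner \<Omega> g v" if "v \<in> H1 \<Omega>" for v
    using g neumann_L2[OF N] H1_L2[OF that] by (intro L2_inner_AE_cong) auto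
  then show ?thesis using N g by (simp add: neumann_laplacian_def)
qed

lemma neumann_add:
  assumes "neumann_laplacian \<Omega> u f" "neumann_laplacian \<Omega> v g"
  shows "neumann_laplacian \<Omega> (\<lambda>x. u x + v x) (\<lambda>x. f x + g x)"
  using assms unfolding neumann_laplacian_def
  by (auto simp: H1_add L2_add form_add L2_inner_add H1_L2)

lemma neumann_cmult:
  assumes "neumann_laplacian \<Omega> u f"
  shows "neumann_laplacian \<Omega> (\<lambda>x. c * u x) (\<lambda>x. c * f x)"
  using assms unfolding neumann_laplacian_def
  by (auto simp: H1_cmult L2_cmult form_cmult L2_inner_cmult)

lemma neumann_diff:
  assumes "neumann_laplacian \<Omega> u f" "neumann_laplacian \<Omega> v g"
  shows "neumann_laplacian \<Omega> (\<lambda>x. u x - v x) (\<lambda>x. f x - g x)"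
  using neumann_add[OF assms(1) neumann_cmult[OF assms(2), of "-1"]] by simp

definition is_eigenvalue :: "real \<Rightarrow> bool" where
  "is_eigenvalue t \<longleftrightarrow> (\<exists>u. neumann_laplacian \<Omega> u (\<lambda>x. of_real t * u x) \<and> L2_norm \<Omega> u \<noteq> 0)"

text \<open>Testing the equation with \<open>u\<close> itself. It makes - 1 available as a point of
  the resolvent set.\<close>

lemma eigenvalue_nonneg:
  assumes "is_eigenvalue t" shows "0 \<le> t"
proof -
  obtain u where N: "neumann_laplacian \<Omega> u (\<lambda>x. of_real t * u x)" and n: "L2_norm \<Omega> u \<noteq> 0"
    using assms by (auto simp: is_eigenvalue_def)
  have "dirichlet_form \<Omega> u u = of_real (t * (L2_norm \<Omega> u)\<^sup>2)"
    using neumann_form[OF N neumann_H1[OF N]] by (simp add: L2_inner_cmult L2_inner_self_norm)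
  then have "0 \<le> t * (L2_norm \<Omega> u)\<^sup>2" using form_self_Re_nonneg[of u] by simp
  moreover have "0 < (L2_norm \<Omega> u)\<^sup>2" using n by simp
  ultimately show ?thesis by (simp add: zero_le_mult_iff)
qed

lemma eigenspace_add_cmult:
  shows "neumann_eigenspace \<Omega> z \<subseteq> L2 \<Omega>"
    and "u \<in> neumann_eigenspace \<Omega> z \<Longrightarrow> v \<in> neumann_eigenspace \<Omega> z \<Longrightarrow> (\<lambda>x. u x + v x) \<in> neumann_eigenspace \<Omega> z"
    and "u \<in> neumann_eigenspace \<Omega> z \<Longrightarrow> (\<lambda>x. c * u x) \<in> neumann_eigenspace \<Omega> z"
proof -
  show "neumann_eigenspace \<Omega> z \<subseteq> L2 \<Omega>"
    unfolding neumann_eigenspace_def using H1_L2[OF neumann_H1] by blast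
  show "u \<in> neumann_eigenspace \<Omega> z \<Longrightarrow> v \<in> neumann_eigenspace \<Omega> z \<Longrightarrow> (\<lambda>x. u x + v x) \<in> neumann_eigenspace \<Omega> z"
    using neumann_add[of u "\<lambda>x. z * u x" v "\<lambda>x. z * v x"] by (simp add: neumann_eigenspace_def distrib_left)
  show "u \<in> neumann_eigenspace \<Omega> z \<Longrightarrow> (\<lambda>x. c * u x) \<in> neumann_eigenspace \<Omega> z"
    using neumann_cmult[of u "\<lambda>x. z * u x" c] by (simp add: neumann_eigenspace_def mult.left_commute)
qed

end

locale neumann_eigenvalue_setting = bounded_open \<Omega> for \<Omega> :: "'a::euclidean_space set" +
  fixes \<mu> :: "nat \<Rightarrow> real"
  assumes discrete: "neumann_discrete_spectrum \<Omega>" and eigenvalues: "neumann_eigenvalues \<Omega> \<mu>"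
begin

lemma resolvent:
  assumes "\<not> is_eigenvalue t"
  shows "\<And>f. f \<in> L2 \<Omega> \<Longrightarrow> \<exists>u. neumann_laplacian \<Omega> u (\<lambda>x. of_real t * u x + f x)"
    and "\<exists>C. \<forall>u. \<forall>f\<in>L2 \<Omega>. neumann_laplacian \<Omega> u (\<lambda>x. of_real t * u x + f x) \<longrightarrow> L2_norm \<Omega> u \<le> C * L2_norm \<Omega> f"
proof -
  have "complex_of_real t \<in> neumann_resolvent_set \<Omega>"
  proof (rule ccontr)
    assume "complex_of_real t \<notin> neumann_resolvent_set \<Omega>"
    then have "complex_of_real t \<in> neumann_spectrum \<Omega>" by (simp add: neumann_spectrum_def)
    then obtain n where n: "n > 0" "has_ae_dim \<Omega> (neumann_eigenspace \<Omega> (of_real t)) n"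
      using discrete unfolding neumann_discrete_spectrum_def by blast
    then obtain e where e: "\<And>i. i < n \<Longrightarrow> e i \<in> neumann_eigenspace \<Omega> (of_real t)"
      and ind: "\<And>c. AE x in M. (\<Sum>i<n. c i * e i x) = 0 \<Longrightarrow> \<forall>i<n. c i = (0::complex)"
      unfolding has_ae_dim_def by blast
    \<comment> \<open>The coefficient vector that selects \<open>e 0\<close>: independence shows
      that \<open>e 0\<close> is not null, hence a genuine eigenfunction.\<close>
    have "(\<Sum>i<n. (if i = 0 then 1 else 0) * e i x) = e 0 x" for x
      using n(1) by (simp add: if_distrib[of "\<lambda>c. c * _"] sum.delta cong: if_cong)
    then have "AE x in M. e 0 x = 0 \<Longrightarrow> \<forall>i<n. (if i = 0 then 1 else 0) = (0::complex)"
      by (intro ind) simp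
    then have "\<not> (AE x in M. e 0 x = 0)" using n(1) by (metis zero_neq_one)
    moreover have "e 0 \<in> L2 \<Omega>" using e[OF n(1)] eigenspace_add_cmult(1) by blast
    ultimately have "L2_norm \<Omega> (e 0) \<noteq> 0" by (simp add: L2_norm_eq_0_iff)
    then show False using assms e[OF n(1)] by (auto simp: is_eigenvalue_def neumann_eigenspace_def)
  qed
  then show "\<And>f. f \<in> L2 \<Omega> \<Longrightarrow> \<exists>u. neumann_laplacian \<Omega> u (\<lambda>x. of_real t * u x + f x)"
    and "\<exists>C. \<forall>u. \<forall>f\<in>L2 \<Omega>. neumann_laplacian \<Omega> u (\<lambda>x. of_real t * u x + f x) \<longrightarrow> L2_norm \<Omega> u \<le> C * L2_norm \<Omega> f"
    by (auto simp: neumann_resolvent_set_def)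
qed

lemma mu_mono: "1 \<le> i \<Longrightarrow> i \<le> j \<Longrightarrow> \<mu> i \<le> \<mu> j"
  using eigenvalues by (auto simp: neumann_eigenvalues_def mono_on_def)

text \<open>The indices with value \<open>t\<close> are matched bijectively with an orthonormal
  basis of the eigenspace. If no index has value \<open>t\<close>, the last clause says that the
  eigenspace is trivial, so it also records that every eigenvalue occurs in the list.\<close>

lemma eigenfunctions_at:
  "\<forall>t. \<exists>e. (\<forall>j. 1 \<le> j \<and> \<mu> j = t \<longrightarrow> neumann_laplacian \<Omega> (e j) (\<lambda>x. of_real t * e j x)) \<and>
     (\<forall>i j. 1 \<le> i \<and> \<mu> i = t \<and> 1 \<le> j \<and> \<mu> j = t \<longrightarrow> L2_inner \<Omega> (e i) (e j) = (if i = j then 1 else 0)) \<and>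
     (\<forall>u. neumann_laplacian \<Omega> u (\<lambda>x. of_real t * u x) \<and> (\<forall>j. 1 \<le> j \<and> \<mu> j = t \<longrightarrow> L2_inner \<Omega> u (e j) = 0)
        \<longrightarrow> L2_norm \<Omega> u = 0)"
proof
  fix t
  let ?J = "{j \<in> {1..}. \<mu> j = t}"
  have fin: "finite ?J" and dim: "has_ae_dim \<Omega> (neumann_eigenspace \<Omega> (of_real t)) (card ?J)"
    using eigenvalues by (auto simp: neumann_eigenvalues_def)
  obtain e where e: "\<forall>i<card ?J. e i \<in> neumann_eigenspace \<Omega> (of_real t)"
      "\<forall>i<card ?J. \<forall>j<card ?J. L2_inner \<Omega> (e i) (e j) = (if i = j then 1 else 0)"
      "\<forall>u\<in>neumann_eigenspace \<Omega> (of_real t). (\<forall>i<card ?J. L2_inner \<Omega> u (e i) = 0) \<longrightarrow> L2_norm \<Omega> u = 0"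
    using gram_schmidt[OF eigenspace_add_cmult dim] by blast
  obtain h where h: "bij_betw h ?J {0..<card ?J}" using ex_bij_betw_finite_nat[OF fin] by blast
  have h1: "h j < card ?J" if "j \<in> ?J" for j using bij_betwE[OF h] that by auto
  have h2: "h i = h j \<longleftrightarrow> i = j" if "i \<in> ?J" "j \<in> ?J" for i j
    using bij_betw_imp_inj_on[OF h] that by (auto simp: inj_on_def)
  have h3: "\<exists>j\<in>?J. i = h j" if "i < card ?J" for i
    using h that by (auto simp: bij_betw_def image_iff set_eq_iff)
  show "\<exists>e. (\<forall>j. 1 \<le> j \<and> \<mu> j = t \<longrightarrow> neumann_laplacian \<Omega> (e j) (\<lambda>x. of_real t * e j x)) \<and>
     (\<forall>i j. 1 \<le> i \<and> \<mu> i = t \<and> 1 \<le> j \<and> \<mu> j = t \<longrightarrow> L2_inner \<Omega> (e i) (e j) = (if i = j then 1 else 0)) \<and>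
     (\<forall>u. neumann_laplacian \<Omega> u (\<lambda>x. of_real t * u x) \<and> (\<forall>j. 1 \<le> j \<and> \<mu> j = t \<longrightarrow> L2_inner \<Omega> u (e j) = 0)
        \<longrightarrow> L2_norm \<Omega> u = 0)"
  proof (intro exI[of _ "\<lambda>j. e (h j)"] conjI allI impI)
    show "neumann_laplacian \<Omega> (e (h j)) (\<lambda>x. of_real t * e (h j) x)" if "1 \<le> j \<and> \<mu> j = t" for j
      using e(1) h1[of j] that by (auto simp: neumann_eigenspace_def)
    show "L2_inner \<Omega> (e (h i)) (e (h j)) = (if i = j then 1 else 0)" if "1 \<le> i \<and> \<mu> i = t \<and> 1 \<le> j \<and> \<mu> j = t" for i j
      using e(2) h1[of i] h1[of j] h2[of i j] that by auto
    show "L2_norm \<Omega> u = 0"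
      if "neumann_laplacian \<Omega> u (\<lambda>x. of_real t * u x) \<and> (\<forall>j. 1 \<le> j \<and> \<mu> j = t \<longrightarrow> L2_inner \<Omega> u (e (h j)) = 0)" for u
    proof -
      have "L2_inner \<Omega> u (e i) = 0" if i: "i < card ?J" for i
        using h3[OF i] that \<open>_ \<and> _\<close> by auto
      then show ?thesis using e(3) that by (auto simp: neumann_eigenspace_def)
    qed
  qed
qed

text \<open>The bases for the separate values of \<open>t\<close> are glued along t = \<mu> j;
  orthogonality across different eigenvalues comes from the symmetry of the form.\<close>

lemma orthonormal_eigenfunctions:
  "\<exists>U. (\<forall>j\<ge>1. neumann_laplacian \<Omega> (U j) (\<lambda>x. of_real (\<mu> j) * U j x)) \<and>
     (\<forall>i\<ge>1. \<forall>j\<ge>1. L2_inner \<Omega> (U i) (U j) = (if i = j then 1 else 0)) \<and>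
     (\<forall>t u. neumann_laplacian \<Omega> u (\<lambda>x. of_real t * u x) \<and> (\<forall>j\<ge>1. \<mu> j = t \<longrightarrow> L2_inner \<Omega> u (U j) = 0)
        \<longrightarrow> L2_norm \<Omega> u = 0)"
proof -
  obtain E where E: "\<forall>t. (\<forall>j. 1 \<le> j \<and> \<mu> j = t \<longrightarrow> neumann_laplacian \<Omega> (E t j) (\<lambda>x. of_real t * E t j x)) \<and>
     (\<forall>i j. 1 \<le> i \<and> \<mu> i = t \<and> 1 \<le> j \<and> \<mu> j = t \<longrightarrow> L2_inner \<Omega> (E t i) (E t j) = (if i = j then 1 else 0)) \<and>
     (\<forall>u. neumann_laplacian \<Omega> u (\<lambda>x. of_real t * u x) \<and> (\<forall>j. 1 \<le> j \<and> \<mu> j = t \<longrightarrow> L2_inner \<Omega> u (E t j) = 0)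
        \<longrightarrow> L2_norm \<Omega> u = 0)"
      by (rule exE[OF choice[OF eigenfunctions_at]])
  have N: "neumann_laplacian \<Omega> (E t j) (\<lambda>x. of_real t * E t j x)" if "1 \<le> j" "\<mu> j = t" for t j
    using spec[OF E, of t] that by blast
  have on: "L2_inner \<Omega> (E t i) (E t j) = (if i = j then 1 else 0)" if "1 \<le> i" "\<mu> i = t" "1 \<le> j" "\<mu> j = t" for t i j
    using conjunct1[OF conjunct2[OF spec[OF E, of t]]] that by blast
  have total: "L2_norm \<Omega> u = 0"
    if "neumann_laplacian \<Omega> u (\<lambda>x. of_real t * u x)" "\<And>j. 1 \<le> j \<Longrightarrow> \<mu> j = t \<Longrightarrow> L2_inner \<Omega> u (E t j) = 0" for t u
    using conjunct2[OF conjunct2[OF spec[OF E, of t]]] that by blast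
  define U where "U j = E (\<mu> j) j" for j
  have NU: "neumann_laplacian \<Omega> (U j) (\<lambda>x. of_real (\<mu> j) * U j x)" if "1 \<le> j" for j
    using N[OF that refl] by (simp add: U_def)
  have "L2_inner \<Omega> (U i) (U j) = (if i = j then 1 else 0)" if ij: "1 \<le> i" "1 \<le> j" for i j
  proof (cases "\<mu> i = \<mu> j")
    case True
    then show ?thesis using on[OF ij(1) True ij(2) refl] by (simp add: U_def)
  next
    case False
    have "dirichlet_form \<Omega> (U i) (U j) = of_real (\<mu> i) * L2_inner \<Omega> (U i) (U j)"
      using neumann_form[OF NU[OF ij(1)] neumann_H1[OF NU[OF ij(2)]]] by (simp add: L2_inner_cmult)
    moreover have "dirichlet_form \<Omega> (U j) (U i) = of_real (\<mu> j) * L2_inner \<Omega> (U j) (U i)"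
      using neumann_form[OF NU[OF ij(2)] neumann_H1[OF NU[OF ij(1)]]] by (simp add: L2_inner_cmult)
    ultimately have "of_real (\<mu> i) * L2_inner \<Omega> (U i) (U j) = of_real (\<mu> j) * L2_inner \<Omega> (U i) (U j)"
      using form_cnj[of "U i" "U j"] L2_inner_cnj[of \<Omega> "U i" "U j"] by auto
    then show ?thesis using False by auto
  qed
  moreover have "L2_norm \<Omega> u = 0"
    if "neumann_laplacian \<Omega> u (\<lambda>x. of_real t * u x)" "\<forall>j\<ge>1. \<mu> j = t \<longrightarrow> L2_inner \<Omega> u (U j) = 0" for t u
    using that by (intro total) (auto simp: U_def)
  ultimately show ?thesis using NU by (intro exI[of _ U]) blast
qed

end

section \<open>The variational principle\<close>

context neumann_eigenvalue_setting
begin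

text \<open>The resolvent at \<open>- 1\<close>, bounded and symmetric on all of \<open>L\<^sup>2(\<Omega>)\<close>.\<close>

definition solve :: "('a \<Rightarrow> complex) \<Rightarrow> 'a \<Rightarrow> complex" where
  "solve f = (SOME u. neumann_laplacian \<Omega> u (\<lambda>x. of_real (- 1) * u x + f x))"

lemma solve:
  assumes "f \<in> L2 \<Omega>"
  shows "neumann_laplacian \<Omega> (solve f) (\<lambda>x. of_real (- 1) * solve f x + f x)"
proof -
  have "\<not> is_eigenvalue (- 1)" using eigenvalue_nonneg[of "- 1"] by auto
  from someI_ex[OF resolvent(1)[OF this assms]] show ?thesis by (simp add: solve_def)
qed

lemma solve_form:
  assumes f: "f \<in> L2 \<Omega>" and v: "v \<in> H1 \<Omega>"
  shows "dirichlet_form \<Omega> (solve f) v + L2_inner \<Omega> (solve f) v = L2_inner \<Omega> f v"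
proof -
  have "L2_inner \<Omega> (\<lambda>x. of_real (- 1) * solve f x + f x) v = of_real (- 1) * L2_inner \<Omega> (solve f) v + L2_inner \<Omega> f v"
    using L2_inner_add[OF L2_cmult[OF H1_L2[OF neumann_H1[OF solve[OF f]]], of "of_real (- 1)"] f H1_L2[OF v]]
    by (simp only: L2_inner_cmult)
  then show ?thesis using neumann_form[OF solve[OF f] v] by simp
qed

lemma solve_H1: "f \<in> L2 \<Omega> \<Longrightarrow> solve f \<in> H1 \<Omega>"
  by (rule neumann_H1[OF solve])

lemma solve_L2: "f \<in> L2 \<Omega> \<Longrightarrow> solve f \<in> L2 \<Omega>"
  by (rule H1_L2[OF solve_H1])

lemma solve_symmetric:
  assumes f: "f \<in> L2 \<Omega>" and g: "g \<in> L2 \<Omega>"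
  shows "L2_inner \<Omega> (solve f) g = L2_inner \<Omega> f (solve g)"
proof -
  have "L2_inner \<Omega> (solve f) g = cnj (L2_inner \<Omega> g (solve f))" by (rule L2_inner_cnj)
  also have "\<dots> = cnj (dirichlet_form \<Omega> (solve g) (solve f) + L2_inner \<Omega> (solve g) (solve f))"
    using solve_form[OF g solve_H1[OF f]] by simp
  also have "\<dots> = dirichlet_form \<Omega> (solve f) (solve g) + L2_inner \<Omega> (solve f) (solve g)"
    by (simp add: form_cnj[symmetric] L2_inner_cnj[symmetric])
  also have "\<dots> = L2_inner \<Omega> f (solve g)" by (rule solve_form[OF f solve_H1[OF g]])
  finally show ?thesis .
qed

text \<open>With a the Dirichlet form, (solve f, f) = a(solve f, solve f) + |solve f|^2. Hence the
  resolvent lies between 0 and 1.\<close>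

lemma solve_numerical:
  assumes f: "f \<in> L2 \<Omega>"
  shows "(L2_norm \<Omega> (solve f))\<^sup>2 \<le> Re (L2_inner \<Omega> (solve f) f)"
    and "L2_norm \<Omega> (solve f) \<le> L2_norm \<Omega> f"
    and "Re (L2_inner \<Omega> (solve f) f) \<le> (L2_norm \<Omega> f)\<^sup>2"
proof -
  have "Re (L2_inner \<Omega> (solve f) f) = Re (dirichlet_form \<Omega> (solve f) (solve f)) + (L2_norm \<Omega> (solve f))\<^sup>2"
    unfolding solve_symmetric[OF f f] solve_form[OF f solve_H1[OF f], symmetric] by (simp add: L2_inner_self_norm)
  then show 1: "(L2_norm \<Omega> (solve f))\<^sup>2 \<le> Re (L2_inner \<Omega> (solve f) f)" using form_self_Re_nonneg[of "solve f"] by simp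
  have 2: "Re (L2_inner \<Omega> (solve f) f) \<le> L2_norm \<Omega> (solve f) * L2_norm \<Omega> f"
    using complex_Re_le_cmod[of "L2_inner \<Omega> (solve f) f"] L2_cauchy_schwarz[OF solve_L2[OF f] f] by linarith
  show 3: "L2_norm \<Omega> (solve f) \<le> L2_norm \<Omega> f"
  proof (cases "L2_norm \<Omega> (solve f) = 0")
    case False
    then have "0 < L2_norm \<Omega> (solve f)" using L2_norm_nonneg[of \<Omega> "solve f"] by linarith
    moreover have "L2_norm \<Omega> (solve f) * L2_norm \<Omega> (solve f) \<le> L2_norm \<Omega> (solve f) * L2_norm \<Omega> f"
      using 1 2 by (simp add: power2_eq_square)
    ultimately show ?thesis by (simp only: mult_le_cancel_left_pos)
  qed simp
  have "L2_norm \<Omega> (solve f) * L2_norm \<Omega> f \<le> (L2_norm \<Omega> f)\<^sup>2"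
    unfolding power2_eq_square by (rule mult_right_mono[OF 3]) simp
  then show "Re (L2_inner \<Omega> (solve f) f) \<le> (L2_norm \<Omega> f)\<^sup>2" using 2 by linarith
qed

lemma solve_unique:
  assumes f: "f \<in> L2 \<Omega>" and v: "neumann_laplacian \<Omega> v (\<lambda>x. of_real (- 1) * v x + f x)"
  shows "L2_norm \<Omega> (\<lambda>x. v x - solve f x) = 0"
proof -
  let ?d = "\<lambda>x. v x - solve f x"
  have "neumann_laplacian \<Omega> ?d (\<lambda>x. of_real (- 1) * ?d x)"
    using neumann_diff[OF v solve[OF f]] by (simp add: algebra_simps)
  then have "L2_norm \<Omega> ?d \<noteq> 0 \<Longrightarrow> is_eigenvalue (- 1)" unfolding is_eigenvalue_def by blast
  then show ?thesis using eigenvalue_nonneg[of "- 1"] by auto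
qed

text \<open>Symmetry of the form gives (t - s) (v, e) = 0. It makes the complement of the
  eigenfunctions invariant under the resolvents.\<close>

lemma perp_of_equation:
  assumes N: "neumann_laplacian \<Omega> v (\<lambda>x. of_real t * v x + f x)" and f: "f \<in> L2 \<Omega>"
    and e: "neumann_laplacian \<Omega> e (\<lambda>x. of_real s * e x)" and st: "s \<noteq> t" and fe: "L2_inner \<Omega> f e = 0"
  shows "L2_inner \<Omega> v e = 0"
proof -
  have "dirichlet_form \<Omega> v e = of_real t * L2_inner \<Omega> v e"
    using neumann_form[OF N neumann_H1[OF e]] H1_L2[OF neumann_H1[OF N]] H1_L2[OF neumann_H1[OF e]] f fe
    by (simp add: L2_inner_add L2_inner_cmult L2_cmult)
  moreover have "dirichlet_form \<Omega> e v = of_real s * L2_inner \<Omega> e v"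
    using neumann_form[OF e neumann_H1[OF N]] by (simp add: L2_inner_cmult)
  ultimately have "of_real t * L2_inner \<Omega> v e = of_real s * L2_inner \<Omega> v e"
    using form_cnj[of v e] L2_inner_cnj[of \<Omega> v e] by auto
  then show ?thesis using st by auto
qed

text \<open>Let \<open>S\<close> be the supremum of the numerical range of the resolvent on the complement of the
  eigenfunctions. If \<open>S > 1 / (1 + z)\<close>, then \<open>S\<close> is not an eigenvalue there and the spectrum has a
  gap below \<open>S\<close>, so \<open>S\<close> could be lowered.\<close>

lemma solve_le_on_complement:
  assumes U: "\<And>j. j \<in> J \<Longrightarrow> neumann_laplacian \<Omega> (U j) (\<lambda>x. of_real (m j) * U j x) \<and> L2_norm \<Omega> (U j) \<noteq> 0"
    and J: "finite J" and z: "0 < z"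
    and eig: "\<And>t. is_eigenvalue t \<Longrightarrow> t < z \<Longrightarrow> t \<in> m ` J"
    and total: "\<And>t u. t < z \<Longrightarrow> neumann_laplacian \<Omega> u (\<lambda>x. of_real t * u x) \<Longrightarrow> u \<in> L2_perp \<Omega> (U ` J) \<Longrightarrow> L2_norm \<Omega> u = 0"
    and v: "v \<in> L2_perp \<Omega> (U ` J)"
  shows "(1 + z) * Re (L2_inner \<Omega> (solve v) v) \<le> (L2_norm \<Omega> v)\<^sup>2"
proof (rule ccontr)
  let ?G = "L2_perp \<Omega> (U ` J)"
  let ?ip = "\<lambda>u v. Re (L2_inner \<Omega> u v)"
  assume neg: "\<not> ?thesis"
  have UL: "U ` J \<subseteq> L2 \<Omega>" using U H1_L2[OF neumann_H1] by blast
  interpret G: semi_hilbert ?G ?ip by (rule semi_hilbert_L2_perp[OF UL])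
  have GL: "u \<in> L2 \<Omega>" if "u \<in> ?G" for u using that by (simp add: L2_perp_def)
  have nsq: "?ip u u = (L2_norm \<Omega> u)\<^sup>2" for u by (simp add: L2_inner_self_norm)
  have m_eig: "is_eigenvalue (m j)" if "j \<in> J" for j using U[OF that] by (auto simp: is_eigenvalue_def)
  have in_G: "w \<in> ?G"
    if "neumann_laplacian \<Omega> w (\<lambda>x. of_real t * w x + f x)" "f \<in> ?G" "\<not> is_eigenvalue t" for w f t
    unfolding L2_perp_def
  proof (intro CollectI conjI ballI)
    show "w \<in> L2 \<Omega>" using that(1) by (intro H1_L2 neumann_H1)
    fix e assume "e \<in> U ` J"
    then obtain j where j: "j \<in> J" "e = U j" by auto
    show "L2_inner \<Omega> w e = 0"
      using perp_of_equation[OF that(1) GL[OF that(2)], of e "m j"] U[OF j(1)] m_eig[OF j(1)] that(2,3) j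
      by (auto simp: L2_perp_def)
  qed
  have not_m1: "\<not> is_eigenvalue (- 1)" using eigenvalue_nonneg[of "- 1"] by auto
  have SG: "solve u \<in> ?G" if "u \<in> ?G" for u using in_G[OF solve[OF GL[OF that]] that not_m1] .
  define R where "R = {?ip (solve f) f / ?ip f f | f. f \<in> ?G \<and> ?ip f f \<noteq> 0}"
  have "?ip v v \<noteq> 0"
  proof
    assume v0: "?ip v v = 0"
    then have "?ip v (solve v) = 0" by (rule G.null_ip[OF v SG[OF v]])
    then show False using neg v0 nsq[of v] G.ip_sym[OF v SG[OF v]] z by simp
  qed
  then have vR: "?ip (solve v) v / ?ip v v \<in> R" using v by (auto simp: R_def)
  have vp: "?ip v v > 0" using \<open>?ip v v \<noteq> 0\<close> G.ip_nonneg[OF v] by linarith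
  have Rle: "r \<le> 1" if "r \<in> R" for r
  proof -
    obtain f where f: "f \<in> ?G" "?ip f f \<noteq> 0" "r = ?ip (solve f) f / ?ip f f" using \<open>r \<in> R\<close> by (auto simp: R_def)
    have "?ip f f > 0" using f(2) G.ip_nonneg[OF f(1)] by linarith
    then show ?thesis using solve_numerical(3)[OF GL[OF f(1)]] nsq[of f] f(3) by simp
  qed
  have bR: "bdd_above R" by (rule bdd_aboveI[OF Rle])
  define S where "S = Sup R"
  have S_ge: "r \<le> S" if "r \<in> R" for r unfolding S_def by (rule cSup_upper[OF that bR])
  have "1 / (1 + z) < ?ip (solve v) v / ?ip v v"
    using neg vp z nsq[of v] by (simp add: divide_simps mult.commute)
  then have S1: "1 / (1 + z) < S" using S_ge[OF vR] by linarith
  then have S0: "0 < S" using z divide_pos_pos[of 1 "1 + z"] by linarith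
  have S2: "S \<le> 1" unfolding S_def using vR by (intro cSup_least Rle) auto
  have num: "?ip (solve f) f \<le> S * ?ip f f" if f: "f \<in> ?G" for f
  proof (cases "?ip f f = 0")
    case True
    then show ?thesis using G.null_ip[OF f SG[OF f]] G.ip_sym[OF f SG[OF f]] by simp
  next
    case False
    then have "?ip f f > 0" using G.ip_nonneg[OF f] by linarith
    moreover have "?ip (solve f) f / ?ip f f \<le> S" using False f by (intro S_ge) (auto simp: R_def)
    ultimately show ?thesis by (simp add: divide_le_eq)
  qed
  \<comment> \<open>Inverse of the map sending a form value \<lambda> to the resolvent value 1 / (1
    + \<lambda>).\<close>
  define l where "l \<kappa> = 1 / \<kappa> - 1" for \<kappa> :: real
  \<comment> \<open>No eigenvalue lies strictly between \<open>l S\<close> and \<open>p\<close>: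
    those below \<open>z\<close> are among the \<open>m j\<close>, and \<open>p\<close> is the least
    of the \<open>m j\<close> above \<open>l S\<close>, capped by \<open>z\<close>.\<close>
  define P where "P = insert z {p \<in> m ` J. l S < p}"
  have lS: "l S < z" using S1 S0 z by (simp add: l_def field_simps)
  have finP: "finite P" using J by (simp add: P_def)
  define p where "p = Min P"
  have p: "l S < p" "p \<le> z" and p_le: "q \<in> P \<Longrightarrow> p \<le> q" for q
    using finP lS unfolding p_def by (auto simp: P_def)
  have p1: "0 < 1 + p" using p(1) divide_pos_pos[OF zero_less_one S0] unfolding l_def by linarith
  \<comment> \<open>Half the distance to 1 / (1 + p), so that S - \<tau> stays strictly above 1 / (1
    + p) up to and including \<tau> = \<delta>.\<close>
  define \<delta> where "\<delta> = (S - 1 / (1 + p)) / 2"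
  have pS: "1 / (1 + p) < S" using p(1) S0 p1 by (simp add: l_def field_simps)
  have \<delta>: "0 < \<delta>" using pS by (simp add: \<delta>_def)
  have \<kappa>: "1 / (1 + p) < S - \<tau>" "0 < S - \<tau>" "\<not> is_eigenvalue (l (S - \<tau>))" if t: "0 < \<tau>" "\<tau> \<le> \<delta>" for \<tau>
  proof -
    show 1: "1 / (1 + p) < S - \<tau>" using t pS by (simp add: \<delta>_def field_simps)
    then show 2: "0 < S - \<tau>" using p1 divide_pos_pos[of 1 "1 + p"] by linarith
    have lt: "l (S - \<tau>) < p" using 1 2 p1 by (simp add: l_def field_simps)
    have gt: "l S < l (S - \<tau>)" using 2 t by (simp add: l_def frac_less2)
    show "\<not> is_eigenvalue (l (S - \<tau>))"
    proof
      assume "is_eigenvalue (l (S - \<tau>))"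
      then have "l (S - \<tau>) \<in> P" using eig[of "l (S - \<tau>)"] lt p(2) gt by (auto simp: P_def)
      then show False using p_le lt by fastforce
    qed
  qed
  define T where "T f = S *\<^sub>R f - solve f" for f
  have TG: "T f \<in> ?G" if "f \<in> ?G" for f using that SG by (simp add: T_def)
  have solve_sym: "?ip (solve f) g = ?ip f (solve g)" if "f \<in> ?G" "g \<in> ?G" for f g
    using solve_symmetric[OF GL[OF that(1)] GL[OF that(2)]] by simp
  have psdT: "G.psd T"
    unfolding G.psd_def G.symm_def
    using TG num solve_sym SG by (auto simp: T_def G.ip_diff G.ip_scale G.ip_diff_right G.ip_scale_right)
  \<comment> \<open>Both \<open>S\<close> and the norm of \<open>solve\<close> are at most 1, which
    gives the factor 4 = 2^2.\<close>
  have bddT: "G.bounded_op 2 T"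
    unfolding G.bounded_op_def
  proof
    fix u assume u: "u \<in> ?G"
    have "?ip (T u) (T u) \<le> 2 * ?ip (S *\<^sub>R u) (S *\<^sub>R u) + 2 * ?ip (solve u) (solve u)"
      unfolding T_def using u SG by (intro G.ip_diff_le) auto
    also have "?ip (S *\<^sub>R u) (S *\<^sub>R u) = S\<^sup>2 * ?ip u u"
      using u by (simp add: G.ip_scale G.ip_scale_right power2_eq_square)
    also have "?ip (solve u) (solve u) \<le> ?ip u u"
      unfolding nsq using solve_numerical(2)[OF GL[OF u]] by (intro power_mono) auto
    also have "S\<^sup>2 * ?ip u u \<le> 1 * ?ip u u"
      using S0 S2 G.ip_nonneg[OF u] by (intro mult_right_mono) (auto simp: power_le_one)
    finally show "?ip (T u) (T u) \<le> 2\<^sup>2 * ?ip u u" by simp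
  qed
  \<comment> \<open>The algebra behind \<open>low\<close> and \<open>onto\<close>: if w solves the
    equation at \<open>l \<kappa>\<close> with datum f / \<kappa> and u = (f + w) / \<kappa>, then w
    is \<open>solve u\<close> up to null vectors and \<kappa> u - solve u = f, that is, (T - \<tau>)
    u = f for \<kappa> = S - \<tau>.\<close>
  have res: "neumann_laplacian \<Omega> w (\<lambda>x. of_real (l \<kappa>) * w x + f x / of_real \<kappa>) \<longleftrightarrow>
      neumann_laplacian \<Omega> w (\<lambda>x. of_real (- 1) * w x + (f x + w x) / of_real \<kappa>)" if "\<kappa> > 0" for \<kappa> w f
  proof -
    have "(\<lambda>x. of_real (l \<kappa>) * w x + f x / of_real \<kappa>) = (\<lambda>x. of_real (- 1) * w x + (f x + w x) / of_real \<kappa>)"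
      using that by (simp add: l_def fun_eq_iff field_simps)
    then show ?thesis by simp
  qed
  have low: "\<exists>c>0. G.bounded_below_op c (\<lambda>u. T u - \<tau> *\<^sub>R u)" if \<tau>: "0 < \<tau>" "\<tau> \<le> \<delta>" for \<tau>
  proof -
    define \<kappa> where "\<kappa> = S - \<tau>"
    note k = \<kappa>[OF \<tau>, folded \<kappa>_def]
    obtain C where C: "\<And>u f. f \<in> L2 \<Omega> \<Longrightarrow> neumann_laplacian \<Omega> u (\<lambda>x. of_real (l \<kappa>) * u x + f x) \<Longrightarrow> L2_norm \<Omega> u \<le> C * L2_norm \<Omega> f"
      using resolvent(2)[OF k(3)] by blast
    define B where "B = (1 / \<kappa>)\<^sup>2 * (2 + 2 * (C\<^sup>2 * (1 / \<kappa>)\<^sup>2))"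
    have B: "B > 0" using k(2) by (simp add: B_def add_pos_nonneg)
    have "?ip u u \<le> B * ?ip (T u - \<tau> *\<^sub>R u) (T u - \<tau> *\<^sub>R u)" if u: "u \<in> ?G" for u
    proof -
      define f where "f = T u - \<tau> *\<^sub>R u"
      have fG: "f \<in> ?G" using u TG by (simp add: f_def)
      have f_eq: "f = \<kappa> *\<^sub>R u - solve u" by (simp add: f_def T_def \<kappa>_def scaleR_diff_left)
      have u_eq: "u = (1 / \<kappa>) *\<^sub>R (f + solve u)" using k(2) by (simp add: f_eq)
      have u_pt: "u x = (f x + solve u x) / of_real \<kappa>" for x
        using fun_cong[OF u_eq, of x] by (simp add: scaleR_fun_def scaleR_conv_of_real)
      have "neumann_laplacian \<Omega> (solve u) (\<lambda>x. of_real (- 1) * solve u x + (f x + solve u x) / of_real \<kappa>)"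
        using solve[OF GL[OF u]] unfolding u_pt[symmetric] .
      then have N: "neumann_laplacian \<Omega> (solve u) (\<lambda>x. of_real (l \<kappa>) * solve u x + (1 / of_real \<kappa>) * f x)"
        unfolding res[OF k(2), symmetric] by simp
      have "L2_norm \<Omega> (solve u) \<le> C * L2_norm \<Omega> (\<lambda>x. (1 / of_real \<kappa>) * f x)"
        by (rule C[OF L2_cmult[OF GL[OF fG]] N])
      then have "(L2_norm \<Omega> (solve u))\<^sup>2 \<le> (C * L2_norm \<Omega> (\<lambda>x. (1 / of_real \<kappa>) * f x))\<^sup>2"
        by (intro power_mono) auto
      also have "\<dots> = C\<^sup>2 * ((1 / \<kappa>)\<^sup>2 * ?ip f f)"
        unfolding power_mult_distrib nsq[symmetric] L2_inner_cmult L2_inner_cmult_right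
        by (simp add: power2_eq_square)
      finally have sb: "?ip (solve u) (solve u) \<le> C\<^sup>2 * ((1 / \<kappa>)\<^sup>2 * ?ip f f)" by (simp add: nsq)
      have "?ip u u = (1 / \<kappa>)\<^sup>2 * ?ip (f + solve u) (f + solve u)"
        using arg_cong[OF u_eq, of "\<lambda>w. ?ip w w"] fG SG[OF u]
        by (simp only: G.ip_scale G.ip_scale_right G.mem power2_eq_square mult.assoc)
      also have "\<dots> \<le> (1 / \<kappa>)\<^sup>2 * (2 * ?ip f f + 2 * (C\<^sup>2 * ((1 / \<kappa>)\<^sup>2 * ?ip f f)))"
        using G.ip_add_le[OF fG SG[OF u]] sb by (intro mult_left_mono) auto
      also have "\<dots> = B * ?ip f f" by (simp add: B_def algebra_simps)
      finally show ?thesis by (simp add: f_def)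
    qed
    then have "G.bounded_below_op (1 / B) (\<lambda>u. T u - \<tau> *\<^sub>R u)"
      unfolding G.bounded_below_op_def using B by (simp add: pos_divide_le_eq mult.commute)
    then show ?thesis using B by (intro exI[of _ "1 / B"]) simp
  qed
  have onto: "\<exists>u\<in>?G. ?ip (T u - \<delta> *\<^sub>R u - f) (T u - \<delta> *\<^sub>R u - f) = 0" if f: "f \<in> ?G" for f
  proof -
    define \<kappa> where "\<kappa> = S - \<delta>"
    note k = \<kappa>[OF \<delta> order_refl, folded \<kappa>_def]
    have gG: "(\<lambda>x. (1 / of_real \<kappa>) * f x) \<in> ?G"
    proof -
      have "L2_inner \<Omega> (\<lambda>x. (1 / of_real \<kappa>) * f x) e = 0" if "e \<in> U ` J" for e
        using f that unfolding L2_inner_cmult by (auto simp: L2_perp_def)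
      then show ?thesis unfolding L2_perp_def using L2_cmult[OF GL[OF f]] by blast
    qed
    obtain w where w: "neumann_laplacian \<Omega> w (\<lambda>x. of_real (l \<kappa>) * w x + (1 / of_real \<kappa>) * f x)"
      using resolvent(1)[OF k(3) GL[OF gG]] by blast
    have wG: "w \<in> ?G" by (rule in_G[OF w gG k(3)])
    define u where "u = (1 / \<kappa>) *\<^sub>R (f + w)"
    have uG: "u \<in> ?G" using f wG by (simp add: u_def)
    have u_pt: "u x = (f x + w x) / of_real \<kappa>" for x
      by (simp add: u_def scaleR_fun_def scaleR_conv_of_real)
    have "neumann_laplacian \<Omega> w (\<lambda>x. of_real (l \<kappa>) * w x + f x / of_real \<kappa>)" using w by simp
    then have "neumann_laplacian \<Omega> w (\<lambda>x. of_real (- 1) * w x + u x)"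
      unfolding res[OF k(2)] u_pt .
    from solve_unique[OF GL[OF uG] this] have "?ip (w - solve u) (w - solve u) = 0"
      unfolding nsq by (simp add: fun_diff_def)
    moreover have "T u - \<delta> *\<^sub>R u - f = w - solve u"
    proof -
      have "\<kappa> *\<^sub>R u = f + w" using k(2) by (simp add: u_def)
      moreover have "S *\<^sub>R u = \<kappa> *\<^sub>R u + \<delta> *\<^sub>R u" by (simp add: \<kappa>_def scaleR_diff_left)
      ultimately show ?thesis by (simp add: T_def)
    qed
    ultimately show ?thesis using uG by (intro bexI[of _ u]) auto
  qed
  \<comment> \<open>A null \<open>T u\<close> makes \<open>solve u\<close> a solution of the
    eigenvalue equation at \<open>l S\<close> inside the complement. As l S < z,
    \<open>total\<close> forces it to be null, even if \<open>l S\<close> is one of the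
    \<open>m j\<close>.\<close>
  have inj: "?ip u u = 0" if u: "u \<in> ?G" and Tu: "?ip (T u) (T u) = 0" for u
  proof -
    have SuG: "solve u \<in> ?G" by (rule SG[OF u])
    have "L2_norm \<Omega> (T u) = 0" using Tu by (simp add: nsq)
    then have "AE x in M. T u x = 0" using L2_norm_eq_0_iff[OF GL[OF TG[OF u]]] by simp
    then have "AE x in M. of_real (- 1) * solve u x + u x = of_real (l S) * solve u x"
    proof eventually_elim
      case (elim x)
      then have "solve u x = of_real S * u x" by (simp add: T_def scaleR_fun_def scaleR_conv_of_real)
      then show ?case using S0 by (simp add: l_def field_simps)
    qed
    then have "neumann_laplacian \<Omega> (solve u) (\<lambda>x. of_real (l S) * solve u x)"
      by (rule neumann_AE_cong[OF solve[OF GL[OF u]] L2_cmult[OF GL[OF SuG]]])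
    then have "L2_norm \<Omega> (solve u) = 0" by (rule total[OF lS _ SuG])
    then have s0: "?ip (solve u) (solve u) = 0" by (simp add: nsq)
    have "S\<^sup>2 * ?ip u u = ?ip (S *\<^sub>R u) (S *\<^sub>R u)" using u by (simp add: G.ip_scale G.ip_scale_right power2_eq_square)
    also have "S *\<^sub>R u = T u + solve u" by (simp add: T_def)
    also have "?ip (T u + solve u) (T u + solve u) \<le> 2 * ?ip (T u) (T u) + 2 * ?ip (solve u) (solve u)"
      by (rule G.ip_add_le[OF TG[OF u] SuG])
    finally have "S\<^sup>2 * ?ip u u \<le> 0" using Tu s0 by simp
    then show ?thesis using S0 G.ip_nonneg[OF u] by (simp add: mult_le_0_iff)
  qed
  have coer: "\<delta> * ?ip f f \<le> ?ip (T f) f" if f: "f \<in> ?G" for f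
    by (rule G.coercive_of_gap[OF psdT bddT _ low onto \<delta> inj f]) auto
  have "r \<le> S - \<delta>" if "r \<in> R" for r
  proof -
    obtain f where f: "f \<in> ?G" "?ip f f \<noteq> 0" "r = ?ip (solve f) f / ?ip f f" using \<open>r \<in> R\<close> by (auto simp: R_def)
    have fp: "?ip f f > 0" using f(2) G.ip_nonneg[OF f(1)] by linarith
    have "\<delta> * ?ip f f \<le> S * ?ip f f - ?ip (solve f) f"
      using coer[OF f(1)] f(1) SG[OF f(1)] by (simp add: T_def G.ip_diff G.ip_scale)
    then show ?thesis using f(3) fp by (simp add: pos_divide_le_eq left_diff_distrib)
  qed
  then have "S \<le> S - \<delta>" unfolding S_def using vR by (intro cSup_least) auto
  then show False using \<delta> by simp
qed

text \<open>With a the Dirichlet form and w = solve v, Cauchy-Schwarz for a plus the inner product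
  gives |v|^4 <= (w, v) (a(v, v) + |v|^2), and (1 + z) (w, v) <= |v|^2 by the bound on the
  resolvent. This carries the estimate from the resolvent to every \<open>v\<close> in the form
  domain.\<close>

theorem form_lower_bound:
  assumes U: "\<And>j. j \<in> J \<Longrightarrow> neumann_laplacian \<Omega> (U j) (\<lambda>x. of_real (m j) * U j x) \<and> L2_norm \<Omega> (U j) \<noteq> 0"
    and J: "finite J" and z: "0 < z"
    and eig: "\<And>t. is_eigenvalue t \<Longrightarrow> t < z \<Longrightarrow> t \<in> m ` J"
    and total: "\<And>t u. t < z \<Longrightarrow> neumann_laplacian \<Omega> u (\<lambda>x. of_real t * u x) \<Longrightarrow> u \<in> L2_perp \<Omega> (U ` J) \<Longrightarrow> L2_norm \<Omega> u = 0"
    and v: "v \<in> L2_perp \<Omega> (U ` J)" "v \<in> H1 \<Omega>"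
  shows "z * (L2_norm \<Omega> v)\<^sup>2 \<le> Re (dirichlet_form \<Omega> v v)"
proof -
  let ?n = "(L2_norm \<Omega> v)\<^sup>2"
  have vL: "v \<in> L2 \<Omega>" by (rule H1_L2[OF v(2)])
  define w where "w = solve v"
  have wH: "w \<in> H1 \<Omega>" and wL: "w \<in> L2 \<Omega>" using solve_H1[OF vL] solve_L2[OF vL] by (auto simp: w_def)
  have le: "(1 + z) * Re (L2_inner \<Omega> w v) \<le> ?n"
    unfolding w_def by (rule solve_le_on_complement[OF U J z eig total v(1)])
  have wv: "dirichlet_form \<Omega> w v + L2_inner \<Omega> w v = of_real ?n"
    unfolding w_def solve_form[OF vL v(2)] by (rule L2_inner_self_norm)
  have ww: "Re (dirichlet_form \<Omega> w w + L2_inner \<Omega> w w) = Re (L2_inner \<Omega> w v)"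
    unfolding w_def solve_form[OF vL solve_H1[OF vL]] solve_symmetric[OF vL vL] ..
  define q where "q = Re (dirichlet_form \<Omega> v v) + ?n"
  have "?n\<^sup>2 \<le> Re (L2_inner \<Omega> w v) * q"
  proof (rule discriminant_nonneg_imp)
    fix t :: real
    let ?s = "\<lambda>x. w x + of_real t * v x"
    have tH: "(\<lambda>x. of_real t * v x) \<in> H1 \<Omega>" by (rule H1_cmult[OF v(2)])
    have sH: "?s \<in> H1 \<Omega>" by (rule H1_add[OF wH tH])
    have right: "dirichlet_form \<Omega> u ?s + L2_inner \<Omega> u ?s
        = (dirichlet_form \<Omega> u w + L2_inner \<Omega> u w) + of_real t * (dirichlet_form \<Omega> u v + L2_inner \<Omega> u v)"
      if u: "u \<in> H1 \<Omega>" for u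
    proof -
      have "dirichlet_form \<Omega> ?s u = dirichlet_form \<Omega> w u + of_real t * dirichlet_form \<Omega> v u"
        using wH tH v(2) u by (simp add: form_add form_cmult)
      then have "dirichlet_form \<Omega> u ?s = dirichlet_form \<Omega> u w + of_real t * dirichlet_form \<Omega> u v"
        using form_cnj[of u ?s] form_cnj[of u w] form_cnj[of u v] by simp
      moreover have "L2_inner \<Omega> u ?s = L2_inner \<Omega> u w + of_real t * L2_inner \<Omega> u v"
        using wL vL H1_L2[OF u] H1_L2[OF tH] by (simp add: L2_inner_add_right L2_inner_cmult_right)
      ultimately show ?thesis by (simp add: algebra_simps)
    qed
    have left: "dirichlet_form \<Omega> ?s u + L2_inner \<Omega> ?s u
        = (dirichlet_form \<Omega> w u + L2_inner \<Omega> w u) + of_real t * (dirichlet_form \<Omega> v u + L2_inner \<Omega> v u)"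
      if u: "u \<in> H1 \<Omega>" for u
      using wH tH v(2) u wL vL H1_L2[OF u] H1_L2[OF tH]
      by (simp add: form_add form_cmult L2_inner_add L2_inner_cmult algebra_simps)
    have vw: "dirichlet_form \<Omega> v w + L2_inner \<Omega> v w = of_real ?n"
      using arg_cong[OF wv, of cnj] form_cnj[of v w] L2_inner_cnj[of \<Omega> v w] by simp
    have "0 \<le> Re (dirichlet_form \<Omega> ?s ?s + L2_inner \<Omega> ?s ?s)"
      using form_self_Re_nonneg[of ?s] by (simp add: Re_L2_inner_self)
    also have "\<dots> = Re (dirichlet_form \<Omega> w w + L2_inner \<Omega> w w) + 2 * t * ?n + t\<^sup>2 * Re (dirichlet_form \<Omega> v v + L2_inner \<Omega> v v)"
      unfolding left[OF sH] right[OF wH] right[OF v(2)] wv vw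
      by (simp add: power2_eq_square algebra_simps)
    finally show "0 \<le> Re (L2_inner \<Omega> w v) + 2 * t * ?n + t\<^sup>2 * q"
      unfolding ww by (simp add: q_def L2_inner_self_norm)
  qed (use form_self_Re_nonneg[of v] in \<open>simp add: q_def\<close>)
  then have "(1 + z) * ?n\<^sup>2 \<le> ((1 + z) * Re (L2_inner \<Omega> w v)) * q" using z by (simp add: mult.assoc)
  also have "\<dots> \<le> ?n * q"
    using le form_self_Re_nonneg[of v] by (intro mult_right_mono) (auto simp: q_def)
  finally have *: "?n * ((1 + z) * ?n) \<le> ?n * q" by (simp add: power2_eq_square mult.assoc mult.left_commute)
  show ?thesis
  proof (cases "?n = 0")
    case True
    then show ?thesis using form_self_Re_nonneg[of v] by simp
  next
    case False
    then have "?n > 0" by simp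
    then have "(1 + z) * ?n \<le> q" using * by (simp only: mult_le_cancel_left_pos)
    then show ?thesis by (simp add: q_def algebra_simps)
  qed
qed

end

section \<open>Kroeger's inequality\<close>

text \<open>Young's inequality for x^p and 1 with the weights 1 / p and 1 - 1 / p.\<close>

lemma powr_bernoulli:
  fixes x p :: real
  assumes x: "0 \<le> x" and p: "1 \<le> p"
  shows "x - 1 \<le> (1 / p) * (x powr p - 1)"
proof (cases "p = 1")
  case True
  then show ?thesis using x by simp
next
  case False
  then have p1: "1 < p" using p by simp
  show ?thesis
  proof (cases "x = 0")
    case True
    then show ?thesis using p1 by (simp add: field_simps)
  next
    case False
    have "(x powr p) powr (1 / p) * 1 powr (1 - 1 / p) \<le> (1 / p) * (x powr p) + (1 - 1 / p) * 1"
      by (rule Youngs_inequality_0) (use p1 x False in auto)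
    moreover have "(x powr p) powr (1 / p) = x" using x p1 by (simp add: powr_powr)
    ultimately show ?thesis by (simp add: algebra_simps)
  qed
qed

lemma L2_norm_eq_1:
  assumes "L2_inner \<Omega> u u = 1" shows "L2_norm \<Omega> u = 1"
proof -
  have "complex_of_real ((L2_norm \<Omega> u)\<^sup>2) = of_real 1" using assms by (simp only: L2_inner_self_norm) simp
  then have "(L2_norm \<Omega> u)\<^sup>2 = 1" by (simp only: of_real_eq_iff)
  then show ?thesis using L2_norm_nonneg[of \<Omega> u] by (auto simp: power2_eq_1_iff)
qed

lemma nn_integral_gamma_scaled:
  fixes a t :: real
  assumes a: "0 < a" and t: "0 < t"
  shows "(\<integral>\<^sup>+x. ennreal (indicator {0..} x * x powr (a - 1) * exp (- (t * x))) \<partial>lborel) = ennreal (Gamma a / t powr a)"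
proof -
  have "ennreal (Gamma a) = (\<integral>\<^sup>+u. ennreal (indicator {0..} u * u powr (a - 1) / exp u) \<partial>lborel)"
    by (rule Gamma_conv_nn_integral_real[OF a])
  also have "\<dots> = ennreal t * (\<integral>\<^sup>+x. ennreal (indicator {0..} (t * x) * (t * x) powr (a - 1) / exp (t * x)) \<partial>lborel)"
    using t by (subst nn_integral_real_affine[where c = t and t = 0]) auto
  also have "(\<integral>\<^sup>+x. ennreal (indicator {0..} (t * x) * (t * x) powr (a - 1) / exp (t * x)) \<partial>lborel)
      = (\<integral>\<^sup>+x. ennreal (t powr (a - 1)) * ennreal (indicator {0..} x * x powr (a - 1) * exp (- (t * x))) \<partial>lborel)"
  proof (rule nn_integral_cong)
    fix x
    show "ennreal (indicator {0..} (t * x) * (t * x) powr (a - 1) / exp (t * x))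
       = ennreal (t powr (a - 1)) * ennreal (indicator {0..} x * x powr (a - 1) * exp (- (t * x)))"
    proof (cases "0 \<le> x")
      case True
      then show ?thesis using t by (simp add: ennreal_mult[symmetric] powr_mult exp_minus field_simps)
    next
      case False
      then have "\<not> 0 \<le> t * x" using t by (simp add: zero_le_mult_iff)
      then show ?thesis using False by simp
    qed
  qed
  also have "\<dots> = ennreal (t powr (a - 1)) * (\<integral>\<^sup>+x. ennreal (indicator {0..} x * x powr (a - 1) * exp (- (t * x))) \<partial>lborel)"
    by (rule nn_integral_cmult) measurable
  finally have "ennreal (Gamma a) = ennreal (t powr a) * (\<integral>\<^sup>+x. ennreal (indicator {0..} x * x powr (a - 1) * exp (- (t * x))) \<partial>lborel)"
    using t by (simp add: mult.assoc[symmetric] ennreal_mult[symmetric] powr_mult_base)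
  then have "ennreal (1 / t powr a) * ennreal (Gamma a)
      = (ennreal (1 / t powr a) * ennreal (t powr a)) * (\<integral>\<^sup>+x. ennreal (indicator {0..} x * x powr (a - 1) * exp (- (t * x))) \<partial>lborel)"
    by (simp add: mult.assoc)
  then show ?thesis using t a Gamma_real_pos[OF a] by (simp add: ennreal_mult[symmetric])
qed

text \<open>Shifting by \<open>m\<close> leaves the Gamma integral with exponent 2, and Gamma 2 =
  1.\<close>

lemma nn_integral_laplace_ramp:
  fixes m t :: real
  assumes m: "0 \<le> m" and t: "0 < t"
  shows "(\<integral>\<^sup>+z. ennreal (t\<^sup>2 * max (z - m) 0 * exp (- (t * z))) \<partial>lborel) = ennreal (exp (- m * t))"
proof -
  have "(\<integral>\<^sup>+z. ennreal (t\<^sup>2 * max (z - m) 0 * exp (- (t * z))) \<partial>lborel)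
      = ennreal \<bar>1\<bar> * (\<integral>\<^sup>+x. ennreal (t\<^sup>2 * max ((m + 1 * x) - m) 0 * exp (- (t * (m + 1 * x)))) \<partial>lborel)"
    by (rule nn_integral_real_affine) auto
  also have "\<dots> = (\<integral>\<^sup>+x. ennreal (t\<^sup>2 * exp (- m * t)) * ennreal (indicator {0..} x * x powr (2 - 1) * exp (- (t * x))) \<partial>lborel)"
    unfolding abs_one ennreal_1 mult_1
  proof (rule nn_integral_cong)
    fix x :: real
    have "t\<^sup>2 * max ((m + x) - m) 0 * exp (- (t * (m + x))) = t\<^sup>2 * exp (- m * t) * (indicator {0..} x * x powr (2 - 1) * exp (- (t * x)))"
      by (cases "0 \<le> x") (auto simp: max_def exp_add[symmetric] algebra_simps)
    then show "ennreal (t\<^sup>2 * max ((m + x) - m) 0 * exp (- (t * (m + x))))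
      = ennreal (t\<^sup>2 * exp (- m * t)) * ennreal (indicator {0..} x * x powr (2 - 1) * exp (- (t * x)))"
      by (simp only: ennreal_mult''[symmetric] zero_le_mult_iff) (simp add: ennreal_mult'[symmetric])
  qed
  also have "\<dots> = ennreal (t\<^sup>2 * exp (- m * t)) * ennreal (Gamma 2 / t powr 2)"
    using nn_integral_gamma_scaled[of 2 t] t by (subst nn_integral_cmult) auto
  also have "\<dots> = ennreal (exp (- m * t))"
    using t Gamma_fact[of 1, where 'a=real] by (simp add: ennreal_mult[symmetric] numeral_2_eq_2[symmetric])
  finally show ?thesis .
qed

context neumann_eigenvalue_setting
begin

abbreviation V where "V \<equiv> measure lebesgue \<Omega>"

text \<open>Identifies C^(-d/2) with the Weyl density, the unit ball volume over (2 pi)^d; the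
  latter power is the constant in \<open>plancherel_le\<close>.\<close>

lemma weyl_const_powr: "weyl_const DIM('a) powr (- real DIM('a) / 2) * (2 * pi) ^ DIM('a) = unit_ball_vol (real DIM('a))"
proof -
  let ?d = "real DIM('a)"
  have d: "?d > 0" by simp
  have w: "unit_ball_vol ?d > 0" by simp
  have "weyl_const DIM('a) powr (- ?d / 2) = ((2 * pi) powr 2) powr (- ?d / 2) * (unit_ball_vol ?d powr (- 2 / ?d)) powr (- ?d / 2)"
    by (simp add: weyl_const_def powr_mult power2_eq_square)
  also have "((2 * pi) powr 2) powr (- ?d / 2) = (2 * pi) powr (- ?d)" by (simp only: powr_powr) simp
  also have "(unit_ball_vol ?d powr (- 2 / ?d)) powr (- ?d / 2) = unit_ball_vol ?d"
    using d w by (simp add: powr_powr)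
  finally have "weyl_const DIM('a) powr (- ?d / 2) * (2 * pi) ^ DIM('a) = ((2 * pi) powr (- ?d) * (2 * pi) powr ?d) * unit_ball_vol ?d"
    by (simp add: powr_realpow)
  then show ?thesis by (simp add: powr_add[symmetric])
qed

lemma weyl_const_pos: "0 < weyl_const DIM('a)"
  using unit_ball_vol_pos[of "real DIM('a)"] by (simp add: weyl_const_def less_imp_neq[symmetric])

text \<open>The conditions admit every \<open>k\<close> between the number of eigenvalues below
  \<open>z\<close> and the number of those up to \<open>z\<close>, as terms with \<mu> j = z
  contribute 0. This freedom permits z = \<mu> k and z = \<mu> (k + 1) despite
  multiplicities.\<close>

theorem kroeger_inequality:
  assumes z: "0 < z" and le: "\<And>j. 1 \<le> j \<Longrightarrow> j \<le> k \<Longrightarrow> \<mu> j \<le> z"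
    and below: "\<And>j. 1 \<le> j \<Longrightarrow> \<mu> j < z \<Longrightarrow> j \<le> k"
  shows "2 / (real DIM('a) + 2) * weyl_const DIM('a) powr (- real DIM('a) / 2) * V * z powr (1 + real DIM('a) / 2) \<le> (\<Sum>j=1..k. z - \<mu> j)"
proof -
  let ?d = "real DIM('a)"
  obtain U where U: "\<And>j. 1 \<le> j \<Longrightarrow> neumann_laplacian \<Omega> (U j) (\<lambda>x. of_real (\<mu> j) * U j x)"
    and on: "\<And>i j. 1 \<le> i \<Longrightarrow> 1 \<le> j \<Longrightarrow> L2_inner \<Omega> (U i) (U j) = (if i = j then 1 else 0)"
    and total: "\<And>t u. neumann_laplacian \<Omega> u (\<lambda>x. of_real t * u x) \<Longrightarrow> \<forall>j\<ge>1. \<mu> j = t \<longrightarrow> L2_inner \<Omega> u (U j) = 0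
        \<Longrightarrow> L2_norm \<Omega> u = 0"
    using orthonormal_eigenfunctions by blast
  define J where "J = {1..k}"
  have J: "finite J" "\<And>j. j \<in> J \<Longrightarrow> 1 \<le> j \<and> j \<le> k" by (auto simp: J_def)
  have UH: "U j \<in> H1 \<Omega>" if "j \<in> J" for j using neumann_H1[OF U] J(2)[OF that] by blast
  have UL: "U j \<in> L2 \<Omega>" if "j \<in> J" for j using H1_L2[OF UH[OF that]] .
  have Un: "L2_norm \<Omega> (U j) = 1" if "1 \<le> j" for j
    by (rule L2_norm_eq_1) (use on[OF that that] in simp)
  define c where "c y j = L2_inner \<Omega> (wave y) (U j)" for y j
  have pointwise: "(z - (norm y)\<^sup>2) * V \<le> (\<Sum>j\<in>J. (z - \<mu> j) * (cmod (c y j))\<^sup>2)" for y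
  proof -
    define r where "r = (\<lambda>x. wave y x - (\<Sum>i\<in>J. (L2_inner \<Omega> (wave y) (U i) / of_real 1) * U i x))"
    have onJ: "L2_inner \<Omega> (U i) (U j) = (if i = j then of_real 1 else 0)" if "i \<in> J" "j \<in> J" for i j
      using on J(2)[OF that(1)] J(2)[OF that(2)] by simp
    note rem = L2_orthogonal_remainder[OF J(1) wave_L2[of y] UL zero_less_one onJ, folded r_def]
    have sH: "(\<lambda>x. \<Sum>i\<in>J. (L2_inner \<Omega> (wave y) (U i) / of_real 1) * U i x) \<in> H1 \<Omega>"
      by (intro H1_sum H1_cmult UH)
    have rH: "r \<in> H1 \<Omega>" unfolding r_def by (intro H1_diff wave_H1 sH)
    have rperp: "r \<in> L2_perp \<Omega> (U ` J)" using rem(1,2) by (auto simp: L2_perp_def)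
    have formU: "dirichlet_form \<Omega> (\<lambda>x. \<Sum>i\<in>J. (L2_inner \<Omega> (wave y) (U i) / of_real 1) * U i x) w
        = (\<Sum>i\<in>J. c y i * (of_real (\<mu> i) * L2_inner \<Omega> (U i) w))" if w: "w \<in> H1 \<Omega>" for w
    proof -
      have "dirichlet_form \<Omega> (\<lambda>x. \<Sum>i\<in>J. (L2_inner \<Omega> (wave y) (U i) / of_real 1) * U i x) w
          = (\<Sum>i\<in>J. dirichlet_form \<Omega> (\<lambda>x. (L2_inner \<Omega> (wave y) (U i) / of_real 1) * U i x) w)"
        by (rule form_sum[OF H1_cmult[OF UH] w])
      also have "\<dots> = (\<Sum>i\<in>J. c y i * (of_real (\<mu> i) * L2_inner \<Omega> (U i) w))"
      proof (rule sum.cong[OF refl])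
        fix i assume i: "i \<in> J"
        have "dirichlet_form \<Omega> (U i) w = of_real (\<mu> i) * L2_inner \<Omega> (U i) w"
          using neumann_form[OF U w, of i] J(2)[OF i] by (simp add: L2_inner_cmult)
        then show "dirichlet_form \<Omega> (\<lambda>x. (L2_inner \<Omega> (wave y) (U i) / of_real 1) * U i x) w
            = c y i * (of_real (\<mu> i) * L2_inner \<Omega> (U i) w)"
          using form_cmult[OF UH[OF i] w, of "L2_inner \<Omega> (wave y) (U i) / of_real 1"] by (simp add: c_def)
      qed
      finally show ?thesis .
    qed
    \<comment> \<open>Against the projection the form reduces to inner products of \<open>r\<close>
      with eigenfunctions, which vanish; so the form of \<open>r\<close> with itself equals that of
      the wave with \<open>r\<close>.\<close>
    have "dirichlet_form \<Omega> (\<lambda>x. \<Sum>i\<in>J. (L2_inner \<Omega> (wave y) (U i) / of_real 1) * U i x) r = 0"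
      unfolding formU[OF rH] using rem(2) L2_inner_cnj[of \<Omega> "U _" r] by (intro sum.neutral ballI) simp
    then have "dirichlet_form \<Omega> r r = dirichlet_form \<Omega> (wave y) r"
      using form_diff[OF wave_H1 sH rH, of y] unfolding r_def[symmetric] by simp
    also have "\<dots> = cnj (dirichlet_form \<Omega> r (wave y))" by (rule form_cnj)
    also have "dirichlet_form \<Omega> r (wave y) = of_real ((norm y)\<^sup>2 * V) - (\<Sum>i\<in>J. c y i * (of_real (\<mu> i) * L2_inner \<Omega> (U i) (wave y)))"
      using form_diff[OF wave_H1 sH wave_H1, of y y] unfolding r_def[symmetric] formU[OF wave_H1] wave_form .
    also have "(\<Sum>i\<in>J. c y i * (of_real (\<mu> i) * L2_inner \<Omega> (U i) (wave y))) = of_real (\<Sum>i\<in>J. \<mu> i * (cmod (c y i))\<^sup>2)"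
    proof -
      have "c y i * (of_real (\<mu> i) * L2_inner \<Omega> (U i) (wave y)) = of_real (\<mu> i * (cmod (c y i))\<^sup>2)" for i
        unfolding of_real_mult complex_norm_square c_def L2_inner_cnj[of \<Omega> "U i" "wave y"] by (simp add: mult.left_commute)
      then show ?thesis by (simp only: of_real_sum)
    qed
    finally have Dr: "Re (dirichlet_form \<Omega> r r) = (norm y)\<^sup>2 * V - (\<Sum>i\<in>J. \<mu> i * (cmod (c y i))\<^sup>2)" by simp
    have nr: "(L2_norm \<Omega> r)\<^sup>2 = V - (\<Sum>i\<in>J. (cmod (c y i))\<^sup>2)"
      using arg_cong[OF rem(3), of Re] by (simp add: L2_inner_self_norm[of \<Omega> r] wave_inner_self c_def)
    have "z * (L2_norm \<Omega> r)\<^sup>2 \<le> Re (dirichlet_form \<Omega> r r)"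
    proof (rule form_lower_bound[where U = U and m = \<mu> and J = J])
      show "neumann_laplacian \<Omega> (U j) (\<lambda>x. of_real (\<mu> j) * U j x) \<and> L2_norm \<Omega> (U j) \<noteq> 0" if "j \<in> J" for j
        using U Un J(2)[OF that] by simp
      show "t \<in> \<mu> ` J" if ev: "is_eigenvalue t" and tz: "t < z" for t
      proof -
        obtain u where "neumann_laplacian \<Omega> u (\<lambda>x. of_real t * u x)" "L2_norm \<Omega> u \<noteq> 0"
          using ev by (auto simp: is_eigenvalue_def)
        then obtain j where "1 \<le> j" "\<mu> j = t" using total by blast
        then show ?thesis using below[of j] tz by (auto simp: J_def)
      qed
      show "L2_norm \<Omega> u = 0" if "t < z" "neumann_laplacian \<Omega> u (\<lambda>x. of_real t * u x)" "u \<in> L2_perp \<Omega> (U ` J)" for t u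
        using that below by (intro total) (auto simp: L2_perp_def J_def)
    qed (use J z rperp rH in auto)
    then show ?thesis unfolding Dr nr
      by (simp add: algebra_simps sum_distrib_left sum_subtractf)
  qed
  have meas: "(\<lambda>y. ennreal ((cmod (c y j))\<^sup>2) * indicator (ball 0 (sqrt z)) y) \<in> borel_measurable lborel" if "j \<in> J" for j
  proof -
    note [measurable] = borel_measurable_continuous_onI[OF fourier_continuous[OF UL[OF that]]]
    have [measurable]: "(indicator (ball 0 (sqrt z)) :: 'a \<Rightarrow> ennreal) \<in> borel_measurable borel"
      by (intro borel_measurable_indicator) simp
    show ?thesis unfolding c_def by measurable
  qed
  have zmu: "0 \<le> z - \<mu> j" if "j \<in> J" for j using le J(2)[OF that] by simp
  \<comment> \<open>\<open>ennreal\<close> sends negative numbers to 0, so the integral of the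
    paraboloid over the whole space already carries the cutoff to the ball of radius sqrt z.\<close>
  have "ennreal (unit_ball_vol ?d * (2 / (?d + 2)) * z powr (1 + ?d / 2)) * ennreal V
      = (\<integral>\<^sup>+y. ennreal (z - (norm y)\<^sup>2) * ennreal V \<partial>(lborel :: 'a measure))"
    unfolding nn_integral_ball_paraboloid[OF z, symmetric] by (rule nn_integral_multc[symmetric]) measurable
  also have "\<dots> \<le> (\<integral>\<^sup>+y. (\<Sum>j\<in>J. ennreal (z - \<mu> j) * (ennreal ((cmod (c y j))\<^sup>2) * indicator (ball 0 (sqrt z)) y)) \<partial>lborel)"
  proof (rule nn_integral_mono)
    fix y :: 'a
    show "ennreal (z - (norm y)\<^sup>2) * ennreal V
        \<le> (\<Sum>j\<in>J. ennreal (z - \<mu> j) * (ennreal ((cmod (c y j))\<^sup>2) * indicator (ball 0 (sqrt z)) y))"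
    proof (cases "norm y < sqrt z")
      case True
      then have "(norm y)\<^sup>2 < z" using real_sqrt_less_iff[of "(norm y)\<^sup>2" z] by simp
      then have "ennreal (z - (norm y)\<^sup>2) * ennreal V = ennreal ((z - (norm y)\<^sup>2) * V)"
        by (simp add: ennreal_mult)
      also have "\<dots> \<le> ennreal (\<Sum>j\<in>J. (z - \<mu> j) * (cmod (c y j))\<^sup>2)" by (rule ennreal_leI[OF pointwise])
      also have "\<dots> = (\<Sum>j\<in>J. ennreal ((z - \<mu> j) * (cmod (c y j))\<^sup>2))"
        using zmu by (intro sum_ennreal[symmetric]) simp
      also have "\<dots> = (\<Sum>j\<in>J. ennreal (z - \<mu> j) * ennreal ((cmod (c y j))\<^sup>2))"
        using zmu by (intro sum.cong refl ennreal_mult) auto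
      finally show ?thesis using True by simp
    next
      case False
      then have "\<not> (norm y)\<^sup>2 < z" using real_sqrt_less_iff[of "(norm y)\<^sup>2" z] by simp
      then have "ennreal (z - (norm y)\<^sup>2) = 0" by (simp add: ennreal_neg)
      then show ?thesis by simp
    qed
  qed
  also have "\<dots> = (\<Sum>j\<in>J. \<integral>\<^sup>+y. ennreal (z - \<mu> j) * (ennreal ((cmod (c y j))\<^sup>2) * indicator (ball 0 (sqrt z)) y) \<partial>lborel)"
    by (intro nn_integral_sum borel_measurable_times_ennreal borel_measurable_const meas)
  also have "\<dots> = (\<Sum>j\<in>J. ennreal (z - \<mu> j) * (\<integral>\<^sup>+y. ennreal ((cmod (c y j))\<^sup>2) * indicator (ball 0 (sqrt z)) y \<partial>lborel))"
    by (intro sum.cong refl nn_integral_cmult meas)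
  also have "\<dots> \<le> (\<Sum>j\<in>J. ennreal (z - \<mu> j) * ennreal ((2 * pi) ^ DIM('a)))"
  proof (intro sum_mono mult_left_mono)
    fix j assume j: "j \<in> J"
    show "(\<integral>\<^sup>+y. ennreal ((cmod (c y j))\<^sup>2) * indicator (ball 0 (sqrt z)) y \<partial>lborel) \<le> ennreal ((2 * pi) ^ DIM('a))"
      using plancherel_le[OF UL[OF j], of "sqrt z"] Un J(2)[OF j] by (simp add: c_def)
  qed simp
  also have "\<dots> = ennreal ((\<Sum>j\<in>J. z - \<mu> j) * (2 * pi) ^ DIM('a))"
    using zmu by (simp add: sum_distrib_right[symmetric] ennreal_mult sum_nonneg)
  finally have "ennreal (unit_ball_vol ?d * (2 / (?d + 2)) * z powr (1 + ?d / 2) * V) \<le> ennreal ((\<Sum>j\<in>J. z - \<mu> j) * (2 * pi) ^ DIM('a))"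
    by (simp only: ennreal_mult''[OF measure_nonneg])
  then have "unit_ball_vol ?d * (2 / (?d + 2)) * z powr (1 + ?d / 2) * V \<le> (\<Sum>j\<in>J. z - \<mu> j) * (2 * pi) ^ DIM('a)"
    using zmu by (subst (asm) ennreal_le_iff) (auto intro!: mult_nonneg_nonneg sum_nonneg)
  then have "(2 / (?d + 2) * weyl_const DIM('a) powr (- ?d / 2) * V * z powr (1 + ?d / 2)) * (2 * pi) ^ DIM('a) \<le> (\<Sum>j\<in>J. z - \<mu> j) * (2 * pi) ^ DIM('a)"
    unfolding weyl_const_powr[symmetric] by (simp only: mult_ac)
  moreover have "(0::real) < (2 * pi) ^ DIM('a)" by simp
  ultimately show ?thesis unfolding J_def by (rule mult_right_le_imp_le)
qed

lemma mu_nonneg: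
  assumes "1 \<le> j" shows "0 \<le> \<mu> j"
proof -
  obtain U where "neumann_laplacian \<Omega> (U j) (\<lambda>x. of_real (\<mu> j) * U j x)" "L2_inner \<Omega> (U j) (U j) = 1"
    using orthonormal_eigenfunctions assms by auto
  then have "is_eigenvalue (\<mu> j)" unfolding is_eigenvalue_def
    by (intro exI[of _ "U j"]) (auto simp: L2_inner_self_norm)
  then show ?thesis by (rule eigenvalue_nonneg)
qed

text \<open>Otherwise the eigenvalues increase to a finite limit t. If t were an eigenvalue, the
  sequence would be constant from some index on, against finite multiplicity; so t is in the
  resolvent set, and normalised eigenfunctions with eigenvalues tending to t contradict the bounded
  inverse.\<close>

lemma finite_below: "finite {j. 1 \<le> j \<and> \<mu> j < z}"
proof (rule ccontr)
  assume inf: "infinite {j. 1 \<le> j \<and> \<mu> j < z}"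
  have lt: "\<mu> j < z" if "1 \<le> j" for j
  proof -
    obtain i where "i \<ge> j" "\<mu> i < z" using inf unfolding infinite_nat_iff_unbounded_le by auto
    then show ?thesis using mu_mono[OF that] by fastforce
  qed
  \<comment> \<open>Monotonicity of \<mu> starts at index 1; the shift gives a sequence that is
    increasing on all naturals.\<close>
  define a where "a n = \<mu> (Suc n)" for n
  have "incseq a" unfolding incseq_def a_def using mu_mono by simp
  moreover have "a n \<le> z" for n unfolding a_def using lt[of "Suc n"] by simp
  ultimately obtain t where t: "a \<longlonglongrightarrow> t" "\<And>n. a n \<le> t" using incseq_convergent[of a z] by blast
  obtain U where U: "\<And>j. 1 \<le> j \<Longrightarrow> neumann_laplacian \<Omega> (U j) (\<lambda>x. of_real (\<mu> j) * U j x)"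
    and on: "\<And>i j. 1 \<le> i \<Longrightarrow> 1 \<le> j \<Longrightarrow> L2_inner \<Omega> (U i) (U j) = (if i = j then 1 else 0)"
    and total: "\<And>t u. neumann_laplacian \<Omega> u (\<lambda>x. of_real t * u x) \<Longrightarrow> \<forall>j\<ge>1. \<mu> j = t \<longrightarrow> L2_inner \<Omega> u (U j) = 0
        \<Longrightarrow> L2_norm \<Omega> u = 0"
    using orthonormal_eigenfunctions by blast
  have "\<not> is_eigenvalue t"
  proof
    assume "is_eigenvalue t"
    then obtain j where j: "1 \<le> j" "\<mu> j = t" using total unfolding is_eigenvalue_def by blast
    have "\<mu> i = t" if "i \<ge> j" for i
      using mu_mono[OF j(1) that] t(2)[of "i - 1"] j that by (simp add: a_def)
    then have "{j..} \<subseteq> {j \<in> {1..}. \<mu> j = t}" using j by auto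
    moreover have "finite {j \<in> {1..}. \<mu> j = t}" using eigenvalues by (simp add: neumann_eigenvalues_def)
    ultimately show False using finite_subset infinite_Ici by blast
  qed
  from resolvent(2)[OF this] obtain K where K: "\<And>u f. f \<in> L2 \<Omega> \<Longrightarrow>
      neumann_laplacian \<Omega> u (\<lambda>x. of_real t * u x + f x) \<Longrightarrow> L2_norm \<Omega> u \<le> K * L2_norm \<Omega> f" by blast
  have "1 \<le> K * \<bar>a n - t\<bar>" for n
  proof -
    let ?u = "U (Suc n)"
    have N: "neumann_laplacian \<Omega> ?u (\<lambda>x. of_real (a n) * ?u x)" using U[of "Suc n"] by (simp add: a_def)
    have uL: "?u \<in> L2 \<Omega>" by (rule H1_L2[OF neumann_H1[OF N]])
    have n1: "L2_norm \<Omega> ?u = 1" by (rule L2_norm_eq_1) (simp add: on)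
    have "neumann_laplacian \<Omega> ?u (\<lambda>x. of_real t * ?u x + of_real (a n - t) * ?u x)"
      using N by (simp add: algebra_simps)
    then have "L2_norm \<Omega> ?u \<le> K * L2_norm \<Omega> (\<lambda>x. of_real (a n - t) * ?u x)"
      by (rule K[OF L2_cmult[OF uL]])
    moreover have "(L2_norm \<Omega> (\<lambda>x. of_real (a n - t) * ?u x))\<^sup>2 = (a n - t)\<^sup>2"
    proof -
      have "complex_of_real ((L2_norm \<Omega> (\<lambda>x. of_real (a n - t) * ?u x))\<^sup>2) = of_real ((a n - t)\<^sup>2 * (L2_norm \<Omega> ?u)\<^sup>2)"
        unfolding L2_inner_self_norm[symmetric] L2_inner_cmult L2_inner_cmult_right
        by (simp add: L2_inner_self_norm power2_eq_square)
      then show ?thesis unfolding n1 by (simp only: of_real_eq_iff power_one mult_1_right)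
    qed
    then have "L2_norm \<Omega> (\<lambda>x. of_real (a n - t) * ?u x) = \<bar>a n - t\<bar>"
      by (metis L2_norm_nonneg abs_of_nonneg power2_eq_iff_nonneg abs_ge_zero power2_abs)
    ultimately show ?thesis using n1 by simp
  qed
  moreover have "(\<lambda>n. K * \<bar>a n - t\<bar>) \<longlonglongrightarrow> K * \<bar>t - t\<bar>" by (intro tendsto_intros t(1))
  ultimately have "1 \<le> K * \<bar>t - t\<bar>" by (intro LIMSEQ_le_const) auto
  then show False by simp
qed

end

section \<open>Eigenvalue sums, Riesz means and heat trace\<close>

context neumann_eigenvalue_setting
begin

text \<open>For \<open>d = 2\<close> this is Kroeger's inequality itself; for \<open>d > 2\<close> it is weakened by Bernoulli's
  inequality \<open>x - 1 \<le> (2 / d) (x powr (d / 2) - 1)\<close> at \<open>x = z / c\<close>.\<close>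

lemma eigenvalue_sum_quadratic:
  assumes d2: "2 \<le> DIM('a)" and V: "0 < V" and k: "1 \<le> k" and nonneg: "0 \<le> z"
    and le: "\<And>j. 1 \<le> j \<Longrightarrow> j \<le> k \<Longrightarrow> \<mu> j \<le> z"
    and below: "\<And>j. 1 \<le> j \<Longrightarrow> \<mu> j < z \<Longrightarrow> j \<le> k"
  defines "c \<equiv> weyl_const DIM('a) * (real k / V) powr (2 / real DIM('a))"
  shows "(real DIM('a) + 2) / real DIM('a) * (1 / real k) * (\<Sum>j=1..k. \<mu> j) \<le> 2 * z - z\<^sup>2 / c"
proof (cases "z = 0")
  case True
  \<comment> \<open>Kroeger's inequality needs z > 0. At z = 0 the first \<open>k\<close>
    eigenvalues vanish and both sides are 0.\<close>
  have "\<mu> j = 0" if "j \<in> {1..k}" for j using le[of j] mu_nonneg[of j] True that by auto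
  then show ?thesis using True by simp
next
  case False
  define d where "d = real DIM('a)"
  have d: "2 \<le> d" using d2 by (simp add: d_def)
  have z: "0 < z" using False nonneg by simp
  have c: "0 < c" using weyl_const_pos V k by (simp add: c_def)
  define S where "S = (\<Sum>j=1..k. \<mu> j)"
  \<comment> \<open>This identity is the reason for the choice of \<open>c\<close>: it removes the
    volume and the Weyl constant, leaving only the ratio z / c.\<close>
  have AV: "weyl_const DIM('a) powr (- d / 2) * V = real k * c powr (- d / 2)"
  proof -
    have "c powr (- d / 2) = weyl_const DIM('a) powr (- d / 2) * ((real k / V) powr (2 / d)) powr (- d / 2)"
      using weyl_const_pos V by (simp add: c_def d_def powr_mult)
    also have "((real k / V) powr (2 / d)) powr (- d / 2) = (real k / V) powr (- 1)"
      using d by (simp add: powr_powr)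
    also have "(real k / V) powr (- 1) = V / real k"
      using V k by (subst powr_minus) simp
    finally show ?thesis using k by simp
  qed
  have zc: "z powr (1 + d / 2) * c powr (- d / 2) = z * (z / c) powr (d / 2)"
  proof -
    have "z powr (1 + d / 2) = z * z powr (d / 2)" using z by (simp add: powr_add)
    moreover have "c powr (- d / 2) = 1 / c powr (d / 2)" using powr_minus_divide[of c "d / 2"] by simp
    moreover have "(z / c) powr (d / 2) = z powr (d / 2) / c powr (d / 2)" using z c by (simp add: powr_divide)
    ultimately show ?thesis by simp
  qed
  have "2 / (d + 2) * weyl_const DIM('a) powr (- d / 2) * V * z powr (1 + d / 2) \<le> (\<Sum>j=1..k. z - \<mu> j)"
    unfolding d_def by (rule kroeger_inequality[OF z le below])
  also have "(\<Sum>j=1..k. z - \<mu> j) = real k * z - S" by (simp add: sum_subtractf S_def)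
  also have "2 / (d + 2) * weyl_const DIM('a) powr (- d / 2) * V * z powr (1 + d / 2)
      = 2 / (d + 2) * (weyl_const DIM('a) powr (- d / 2) * V) * z powr (1 + d / 2)" by (simp only: mult.assoc)
  also have "\<dots> = 2 / (d + 2) * real k * (z powr (1 + d / 2) * c powr (- d / 2))" unfolding AV by (simp only: mult_ac)
  finally have "S \<le> real k * z - 2 / (d + 2) * real k * (z * (z / c) powr (d / 2))" unfolding zc by simp
  then have "(d + 2) / d * (1 / real k) * S
      \<le> (d + 2) / d * (1 / real k) * (real k * z - 2 / (d + 2) * real k * (z * (z / c) powr (d / 2)))"
    using d by (intro mult_left_mono) auto
  also have "\<dots> = (d + 2) / d * z - 2 / d * (z * (z / c) powr (d / 2))"
  proof -
    have "(d + 2) / d * (1 / real k) * (real k * z - 2 / (d + 2) * real k * y) = (d + 2) / d * z - 2 / d * y" for y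
      using d k by (simp add: divide_simps) (simp add: algebra_simps)
    then show ?thesis .
  qed
  also have "\<dots> = z - z * ((1 / (d / 2)) * ((z / c) powr (d / 2) - 1))"
    using d by (simp add: field_simps)
  also have "\<dots> \<le> z - z * (z / c - 1)"
    using powr_bernoulli[of "z / c" "d / 2"] z c d by (intro diff_left_mono mult_left_mono) auto
  also have "\<dots> = 2 * z - z\<^sup>2 / c" by (simp add: power2_eq_square algebra_simps)
  finally show ?thesis by (simp only: d_def S_def)
qed

text \<open>The Riesz mean lives on the finite set {1..k}, with \<open>k\<close> the last index of
  an eigenvalue below \<open>z\<close>. Both the infinite sum and the Laplace transform are reduced
  to this finite form.\<close>

lemma riesz_mean_bound:
  assumes z: "0 < z"
  obtains F where "finite F" "F \<subseteq> {1..}" "\<And>j. j \<in> {1..} - F \<Longrightarrow> z \<le> \<mu> j"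
    "2 / (real DIM('a) + 2) * weyl_const DIM('a) powr (- real DIM('a) / 2) * V * z powr (1 + real DIM('a) / 2)
      \<le> (\<Sum>j\<in>F. max (z - \<mu> j) 0)"
proof -
  \<comment> \<open>The inserted 0 stands for the absence of eigenvalues below \<open>z\<close>; the
    range {1..k} is then empty.\<close>
  define k where "k = Max (insert 0 {j. 1 \<le> j \<and> \<mu> j < z})"
  have fin: "finite (insert 0 {j. 1 \<le> j \<and> \<mu> j < z})" using finite_below by simp
  have below: "j \<le> k" if "1 \<le> j" "\<mu> j < z" for j
    unfolding k_def using that by (intro Max_ge[OF fin]) simp
  have le: "\<mu> j \<le> z" if "1 \<le> j" "j \<le> k" for j
  proof -
    have "k \<in> insert 0 {j. 1 \<le> j \<and> \<mu> j < z}" unfolding k_def by (rule Max_in[OF fin]) simp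
    then have "\<mu> k < z" using that by auto
    then show ?thesis using mu_mono[OF that] by simp
  qed
  show ?thesis
  proof (rule that[of "{1..k}"])
    show "z \<le> \<mu> j" if "j \<in> {1..} - {1..k}" for j using below[of j] that by force
    have "(\<Sum>j=1..k. z - \<mu> j) = (\<Sum>j=1..k. max (z - \<mu> j) 0)"
      using le by (intro sum.cong refl max.absorb1[symmetric]) simp
    then show "2 / (real DIM('a) + 2) * weyl_const DIM('a) powr (- real DIM('a) / 2) * V * z powr (1 + real DIM('a) / 2)
      \<le> (\<Sum>j\<in>{1..k}. max (z - \<mu> j) 0)"
      using kroeger_inequality[OF z le below] by simp
  qed auto
qed

text \<open>Laplace transform of the bound on Riesz means, using
  \<open>exp (- \<mu> t) = t\<^sup>2 \<integral> (z - \<mu>)\<^sub>+ exp (- t z) dz\<close>.\<close>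

lemma heat_trace_bound:
  assumes t: "0 < t"
  shows "ennreal (V / (4 * pi * t) powr (real DIM('a) / 2)) \<le> (\<Sum>n. ennreal (exp (- \<mu> (Suc n) * t)))"
proof -
  define d where "d = real DIM('a)"
  have d: "0 < d" by (simp add: d_def)
  define B where "B = 2 / (d + 2) * weyl_const DIM('a) powr (- d / 2) * V"
  have B: "0 \<le> B" using d by (simp add: B_def)
  have B_eq: "B = 2 / (d + 2) * (unit_ball_vol d / (2 * pi) powr d) * V"
  proof -
    have "weyl_const DIM('a) powr (- d / 2) = unit_ball_vol d / (2 * pi) powr d"
      by (simp add: weyl_const_powr[symmetric] d_def powr_realpow)
    then show ?thesis by (simp only: B_def)
  qed
  \<comment> \<open>The right side is t^2 times the Laplace transform of B z^(1 + d/2). One step of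
    the functional equation of Gamma cancels both the factor 2 / (d + 2) and the Gamma value in the
    ball volume.\<close>
  have "V / (4 * pi * t) powr (d / 2) = t\<^sup>2 * B * (Gamma (2 + d / 2) / t powr (2 + d / 2))"
  proof -
    have G: "Gamma (2 + d / 2) = (1 + d / 2) * Gamma (1 + d / 2)"
      using Gamma_plus1[of "1 + d / 2"] d by (simp add: add.assoc[symmetric] add.commute nonpos_Ints_def)
    have G0: "Gamma (d / 2 + 1) \<noteq> 0" using Gamma_real_pos[of "d / 2 + 1"] d by linarith
    have p: "(2 * pi) powr d = (4 * pi) powr (d / 2) * pi powr (d / 2)"
    proof -
      have "(2 * pi) powr d = ((2 * pi) powr 2) powr (d / 2)" by (simp only: powr_powr) simp
      also have "(2 * pi) powr 2 = 4 * pi * pi" by (simp add: power2_eq_square)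
      finally show ?thesis by (simp add: powr_mult)
    qed
    have tt: "t powr (2 + d / 2) = t\<^sup>2 * t powr (d / 2)" using t by (simp add: powr_add)
    have "2 / (d + 2) * (pi powr (d / 2) / g / (a * pi powr (d / 2))) * V * ((1 + d / 2) * g) = V / a" if "g \<noteq> 0" "a \<noteq> 0" for g a
      using that d by (simp add: divide_simps)
    from this[OF G0, of "(4 * pi) powr (d / 2)"]
    have "B * Gamma (2 + d / 2) = V / (4 * pi) powr (d / 2)"
      unfolding B_eq G unit_ball_vol_def p by (simp add: add.commute)
    moreover have "t\<^sup>2 * B * (Gamma (2 + d / 2) / t powr (2 + d / 2)) = (B * Gamma (2 + d / 2)) / t powr (d / 2)"
      unfolding tt using t by (simp add: field_simps)
    ultimately show ?thesis using t by (simp add: powr_mult)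
  qed
  then have "ennreal (V / (4 * pi * t) powr (d / 2)) = ennreal (t\<^sup>2 * B) * ennreal (Gamma (2 + d / 2) / t powr (2 + d / 2))"
    using B by (simp add: ennreal_mult'[symmetric])
  also have "\<dots> = ennreal (t\<^sup>2 * B) * (\<integral>\<^sup>+z. ennreal (indicator {0..} z * z powr ((2 + d / 2) - 1) * exp (- (t * z))) \<partial>lborel)"
    using t d by (subst nn_integral_gamma_scaled) auto
  also have "\<dots> = (\<integral>\<^sup>+z. ennreal (t\<^sup>2 * B) * ennreal (indicator {0..} z * z powr ((2 + d / 2) - 1) * exp (- (t * z))) \<partial>lborel)"
    by (rule nn_integral_cmult[symmetric]) measurable
  also have "\<dots> \<le> (\<integral>\<^sup>+z. (\<Sum>n. ennreal (t\<^sup>2 * max (z - \<mu> (Suc n)) 0 * exp (- (t * z)))) \<partial>lborel)"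
  proof (rule nn_integral_mono)
    fix z :: real
    show "ennreal (t\<^sup>2 * B) * ennreal (indicator {0..} z * z powr ((2 + d / 2) - 1) * exp (- (t * z)))
      \<le> (\<Sum>n. ennreal (t\<^sup>2 * max (z - \<mu> (Suc n)) 0 * exp (- (t * z))))"
    proof (cases "0 < z")
      case True
      obtain F where F: "finite F" "F \<subseteq> {1..}" "B * z powr (1 + d / 2) \<le> (\<Sum>j\<in>F. max (z - \<mu> j) 0)"
        using riesz_mean_bound[OF True] unfolding B_def d_def by metis
      \<comment> \<open>Moves the indices from {1..} to all naturals, over which the series
        runs.\<close>
      have F_eq: "F = Suc ` ((\<lambda>j. j - 1) ` F)" using F(2) by (force simp: image_iff)
      define E where "E = (\<lambda>j. j - 1) ` F"
      have E: "finite E" "F = Suc ` E" using F(1) F_eq by (auto simp: E_def)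
      have "t\<^sup>2 * B * (z powr (1 + d / 2) * exp (- (t * z))) \<le> t\<^sup>2 * exp (- (t * z)) * (\<Sum>j\<in>F. max (z - \<mu> j) 0)"
        using mult_left_mono[OF F(3), of "t\<^sup>2 * exp (- (t * z))"] by (simp add: mult_ac)
      also have "\<dots> = (\<Sum>n\<in>E. t\<^sup>2 * max (z - \<mu> (Suc n)) 0 * exp (- (t * z)))"
        unfolding E(2) by (subst sum.reindex) (auto simp: sum_distrib_left mult_ac)
      finally have "ennreal (t\<^sup>2 * B * (z powr (1 + d / 2) * exp (- (t * z))))
          \<le> ennreal (\<Sum>n\<in>E. t\<^sup>2 * max (z - \<mu> (Suc n)) 0 * exp (- (t * z)))" by (rule ennreal_leI)
      also have "\<dots> = (\<Sum>n\<in>E. ennreal (t\<^sup>2 * max (z - \<mu> (Suc n)) 0 * exp (- (t * z))))"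
        by (intro sum_ennreal[symmetric]) simp
      also have "\<dots> \<le> (\<Sum>n. ennreal (t\<^sup>2 * max (z - \<mu> (Suc n)) 0 * exp (- (t * z))))"
        by (intro sum_le_suminf E(1)) auto
      finally show ?thesis using True B by (simp add: ennreal_mult'[symmetric] add.commute)
    next
      case False
      then have zero: "indicator {0..} z * z powr ((2 + d / 2) - 1) = (0::real)" by (auto simp: indicator_def)
      show ?thesis unfolding zero by simp
    qed
  qed
  also have "\<dots> = (\<Sum>n. \<integral>\<^sup>+z. ennreal (t\<^sup>2 * max (z - \<mu> (Suc n)) 0 * exp (- (t * z))) \<partial>lborel)"
    by (intro nn_integral_suminf) measurable
  also have "\<dots> = (\<Sum>n. ennreal (exp (- \<mu> (Suc n) * t)))"
    using mu_nonneg t by (intro suminf_cong nn_integral_laplace_ramp) auto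
  finally show ?thesis by (simp only: d_def)
qed

end

text \<open>Each partial sum of the series is one of the finite sums whose supremum is the unordered
  sum.\<close>

lemma suminf_Suc_le_infsum_ennreal:
  fixes f :: "nat \<Rightarrow> ennreal"
  shows "(\<Sum>n. f (Suc n)) \<le> (\<Sum>\<^sub>\<infinity>j\<in>{1..}. f j)"
  unfolding suminf_eq_SUP
proof (rule SUP_least)
  fix n
  have "(\<Sum>i<n. f (Suc i)) = (\<Sum>j\<in>Suc ` {..<n}. f j)" by (subst sum.reindex) auto
  also have "\<dots> \<le> (\<Sum>\<^sub>\<infinity>j\<in>{1..}. f j)"
    by (subst nonneg_infsum_complete) (auto intro!: SUP_upper)
  finally show "(\<Sum>i<n. f (Suc i)) \<le> (\<Sum>\<^sub>\<infinity>j\<in>{1..}. f j)" .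
qed

text \<open>The heat trace is summed in \<open>ennreal\<close>, where divergence is a value of the
  sum and not the default 0 of a real \<open>infsum\<close>. For Riesz means a real sum is safe,
  because only finitely many terms are nonzero.\<close>

theorem theorem3p1:
  fixes \<Omega> :: "'a::euclidean_space set" and \<mu> :: "nat \<Rightarrow> real" and d :: nat and V C :: real
  defines "d \<equiv> DIM('a)" and "V \<equiv> measure lebesgue \<Omega>" and "C \<equiv> weyl_const DIM('a)"
  assumes "d \<ge> 2"
    and "open \<Omega>" "connected \<Omega>" "\<Omega> \<noteq> {}" "bounded \<Omega>"
    and "neumann_discrete_spectrum \<Omega>"
    and "neumann_eigenvalues \<Omega> \<mu>"
  shows "(\<forall>k::nat. k \<ge> 1 \<longrightarrow>
            (real d + 2) / real d * (1 / real k) * (\<Sum>j=1..k. \<mu> j)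
              - C * (real k / V) powr (2 / real d)
            \<le> - C * (real k / V) powr (2 / real d)
                * (inverse C * (real k / V) powr (- 2 / real d) * \<mu> (k + 1) - 1)\<^sup>2)
       \<and> (\<forall>k::nat. k \<ge> 1 \<longrightarrow>
            (let s = sqrt (1 - ((real d + 2) / real d * (1 / real k) * (\<Sum>j=1..k. \<mu> j))
                               / (C * (real k / V) powr (2 / real d)))
             in C * (real k / V) powr (2 / real d) * (1 - s) \<le> \<mu> k
                \<and> \<mu> k \<le> \<mu> (k + 1)
                \<and> \<mu> (k + 1) \<le> C * (real k / V) powr (2 / real d) * (1 + s)))
       \<and> (\<forall>z::real. z > 0 \<longrightarrow>
            (\<Sum>\<^sub>\<infinity>j\<in>{1..}. max (z - \<mu> j) 0)
              \<ge> 2 / (real d + 2) * C powr (- real d / 2) * V * z powr (1 + real d / 2))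
       \<and> (\<forall>t::real. t > 0 \<longrightarrow>
            (\<Sum>\<^sub>\<infinity>j\<in>{1..}. ennreal (exp (- \<mu> j * t)))
              \<ge> ennreal (V / (4 * pi * t) powr (real d / 2)))"
proof -
  interpret neumann_eigenvalue_setting \<Omega> \<mu>
    by unfold_locales (use assms in auto)
  have V: "0 < V"
  proof -
    have "measure lebesgue \<Omega> \<noteq> 0"
      using \<open>open \<Omega>\<close> \<open>\<Omega> \<noteq> {}\<close> lmeasurable open_not_negligible negligible_iff_measure by blast
    then show ?thesis using measure_nonneg[of lebesgue \<Omega>] unfolding V_def by linarith
  qed
  have C: "0 < C" using weyl_const_pos by (simp add: C_def)
  define c where "c k = C * (real k / V) powr (2 / real d)" for k :: nat
  define m where "m k = (real d + 2) / real d * (1 / real k) * (\<Sum>j=1..k. \<mu> j)" for k :: nat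
  have c: "0 < c k" if "k \<ge> 1" for k using that V C by (simp add: c_def)
  have quad: "m k \<le> 2 * z - z\<^sup>2 / c k"
    if "k \<ge> 1" "0 \<le> z" "\<And>j. 1 \<le> j \<Longrightarrow> j \<le> k \<Longrightarrow> \<mu> j \<le> z" "\<And>j. 1 \<le> j \<Longrightarrow> \<mu> j < z \<Longrightarrow> j \<le> k" for k z
    unfolding m_def c_def d_def V_def C_def
    by (rule eigenvalue_sum_quadratic) (use that V \<open>d \<ge> 2\<close> in \<open>auto simp: d_def V_def\<close>)
  \<comment> \<open>At z = \<mu> (k + 1) all later eigenvalues are at least \<open>z\<close>, so
    \<open>k\<close> is admissible even when \<mu> k = \<mu> (k + 1).\<close>
  have quad_upper: "m k \<le> 2 * \<mu> (k + 1) - (\<mu> (k + 1))\<^sup>2 / c k" if k: "k \<ge> 1" for k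
  proof (rule quad[OF k])
    show "j \<le> k" if "1 \<le> j" "\<mu> j < \<mu> (k + 1)" for j
      using mu_mono[of "k + 1" j] that by force
  qed (use mu_nonneg mu_mono in auto)
  have quad_lower: "m k \<le> 2 * \<mu> k - (\<mu> k)\<^sup>2 / c k" if k: "k \<ge> 1" for k
  proof (rule quad[OF k])
    show "j \<le> k" if "1 \<le> j" "\<mu> j < \<mu> k" for j
      using mu_mono[of k j] k that by force
  qed (use mu_nonneg mu_mono k in auto)
  \<comment> \<open>Completing the square: m <= 2 x - x^2 / c is equivalent to (x / c - 1)^2 <= 1 -
    m / c. In particular the radicand is nonnegative.\<close>
  have dev: "\<bar>x / c k - 1\<bar> \<le> sqrt (1 - m k / c k)" if k: "k \<ge> 1" and x: "m k \<le> 2 * x - x\<^sup>2 / c k" for k x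
  proof -
    have "m k / c k \<le> (2 * x - x\<^sup>2 / c k) / c k" using x c[OF k] by (simp add: divide_right_mono)
    moreover have "(x / c k - 1)\<^sup>2 = 1 - (2 * x - x\<^sup>2 / c k) / c k"
      using c[OF k] by (simp add: power2_eq_square field_simps)
    ultimately have "(x / c k - 1)\<^sup>2 \<le> 1 - m k / c k" by linarith
    then show ?thesis using real_sqrt_le_mono by fastforce
  qed
  have 1: "m k - c k \<le> - C * (real k / V) powr (2 / real d)
                * (inverse C * (real k / V) powr (- 2 / real d) * \<mu> (k + 1) - 1)\<^sup>2" if k: "k \<ge> 1" for k
  proof -
    have inv: "inverse C * (real k / V) powr (- 2 / real d) = 1 / c k"
      using C by (simp add: c_def powr_minus_divide field_simps)
    have "- C * (real k / V) powr (2 / real d) * (1 / c k * \<mu> (k + 1) - 1)\<^sup>2 = - c k * (\<mu> (k + 1) / c k - 1)\<^sup>2"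
      by (simp add: c_def)
    also have "\<dots> = 2 * \<mu> (k + 1) - (\<mu> (k + 1))\<^sup>2 / c k - c k"
      using c[OF k] by (simp add: power2_eq_square field_simps)
    finally show ?thesis unfolding inv using quad_upper[OF k] by simp
  qed
  have 2: "c k * (1 - s) \<le> \<mu> k \<and> \<mu> k \<le> \<mu> (k + 1) \<and> \<mu> (k + 1) \<le> c k * (1 + s)"
    if k: "k \<ge> 1" and s: "s = sqrt (1 - m k / c k)" for k s
  proof -
    have "1 - s \<le> \<mu> k / c k" using dev[OF k quad_lower[OF k]] unfolding s by linarith
    moreover have "\<mu> (k + 1) / c k \<le> 1 + s" using dev[OF k quad_upper[OF k]] unfolding s by linarith
    ultimately show ?thesis
      using c[OF k] mu_mono[OF k, of "k + 1"] by (simp add: pos_le_divide_eq pos_divide_le_eq mult.commute)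
  qed
  have 3: "2 / (real d + 2) * C powr (- real d / 2) * V * z powr (1 + real d / 2) \<le> (\<Sum>\<^sub>\<infinity>j\<in>{1..}. max (z - \<mu> j) 0)"
    if z: "z > 0" for z
  proof -
    obtain F where F: "finite F" "F \<subseteq> {1..}" "\<And>j. j \<in> {1..} - F \<Longrightarrow> z \<le> \<mu> j"
      "2 / (real d + 2) * C powr (- real d / 2) * V * z powr (1 + real d / 2) \<le> (\<Sum>j\<in>F. max (z - \<mu> j) 0)"
      using riesz_mean_bound[OF z] unfolding d_def V_def C_def by metis
    have "(\<Sum>\<^sub>\<infinity>j\<in>{1..}. max (z - \<mu> j) 0) = (\<Sum>\<^sub>\<infinity>j\<in>F. max (z - \<mu> j) 0)"
      \<comment> \<open>Terms outside \<open>F\<close> vanish, so the unordered sum is a finite one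
        and cannot fall back to its default value 0.\<close>
      using F(2,3) by (intro infsum_cong_neutral) (auto simp: max_def)
    also have "\<dots> = (\<Sum>j\<in>F. max (z - \<mu> j) 0)" using F(1) by simp
    finally show ?thesis using F(4) by simp
  qed
  have 4: "ennreal (V / (4 * pi * t) powr (real d / 2)) \<le> (\<Sum>\<^sub>\<infinity>j\<in>{1..}. ennreal (exp (- \<mu> j * t)))"
    if t: "t > 0" for t
    unfolding V_def d_def
    using heat_trace_bound[OF t] suminf_Suc_le_infsum_ennreal[of "\<lambda>j. ennreal (exp (- \<mu> j * t))"] by (rule order_trans)
  show ?thesis
    using 1 2 3 4 unfolding Let_def m_def c_def by blast
qed

end
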